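(* Let $\theta,\alpha$ be two nonconstant inner functions. The space $\mathcal{T}(K_\theta,K_\alpha)$ of all bounded asymmetric truncated Toeplitz operators is weak*-closed (and WOT-closed) in $\mathcal{B}(K_\theta,K_\alpha)$, transitive, and $2$-reflexive.
   Context: $L^2=L^2(\mathbb{T},m)$ with $m$ normalized Lebesgue measure on the unit circle; $H^2\subset L^2$ is the Hardy space. For an inner function $\theta$, $K_\theta=H^2\ominus\theta H^2$, and $P_\theta$ is the orthogonal projection of $L^2$ onto $K_\theta$. For $\varphi\in L^2$, $A^{\theta,\alpha}_\varphi$ is defined on $K_\theta\cap L^\infty$ (dense in $K_\theta$) by $A^{\theta,\alpha}_\varphi f=P_\alpha(\varphi f)$. If it extends to a bounded operator $K_\theta\to K_\alpha$, it is called an asymmetric truncated Toeplitz operator; $\mathcal{T}(K_\theta,K_\alpha)\subset\mathcal{B}(K_\theta,K_\alpha)$ is the set of all such bounded operators with $\varphi\in L^2$. For separable complex Hilbert spaces $\mathcal{H},\mathcal{K}$, $\mathcal{B}(\mathcal{H},\mathcal{K})$ is the space of bounded linear operators $\mathcal{H}\to\mathcal{K}$ and $\mathcal{B}_1(\mathcal{K},\mathcal{H})$ the space of trace class operators $\mathcal{K}\to\mathcal{H}$; $f\otimes g$ ($f\in\mathcal{H}$, $g\in\mathcal{K}$) is the operator $x\mapsto\langle x,g\rangle f$. $\mathcal{B}(\mathcal{H},\mathcal{K})$ is the dual of $\mathcal{B}_1(\mathcal{K},\mathcal{H})$ via $<T,t>=\sum_n\langle Tf_n,g_n\rangle$ for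 $t=\sum_n f_n\otimes g_n$ with $\sum\|f_n\|^2<\infty$, $\sum\|g_n\|^2<\infty$; this gives the weak* topology. WOT is the weak operator topology. $\mathcal{F}_k$ is the set of operators in $\mathcal{B}_1(\mathcal{K},\mathcal{H})$ of rank at most $k$. For $\mathcal{S}\subset\mathcal{B}(\mathcal{H},\mathcal{K})$, $\mathcal{S}_\perp=\{t\in\mathcal{B}_1(\mathcal{K},\mathcal{H}):<T,t>=0\ \forall T\in\mathcal{S}\}$; for $\mathcal{M}\subset\mathcal{B}_1(\mathcal{K},\mathcal{H})$, $\mathcal{M}^\perp=\{T\in\mathcal{B}(\mathcal{H},\mathcal{K}):<T,t>=0\ \forall t\in\mathcal{M}\}$. A weak*-closed subspace $\mathcal{S}$ is transitive if $\mathcal{S}_\perp\cap\mathcal{F}_1=\{0\}$, and $k$-reflexive ($k\ge2$) if $\mathcal{S}=(\mathcal{S}_\perp\cap\mathcal{F}_k)^\perp$. *)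

theory Defs
  imports "HOL-Probability.Probability"
begin

section \<open>Complex inner product spaces\<close>

text \<open>
  The inner product \<open>cinner\<close> is linear in its \<^emph>\<open>first\<close> argument.
\<close>

class complex_inner = real_inner +
  fixes scaleC :: "complex \<Rightarrow> 'a \<Rightarrow> 'a" (infixr \<open>*\<^sub>C\<close> 75)
    and cinner :: "'a \<Rightarrow> 'a \<Rightarrow> complex"
  assumes scaleC_add_right: "c *\<^sub>C (x + y) = c *\<^sub>C x + c *\<^sub>C y"
    and scaleC_add_left: "(c + d) *\<^sub>C x = c *\<^sub>C x + d *\<^sub>C x"
    and scaleC_scaleC: "c *\<^sub>C d *\<^sub>C x = (c * d) *\<^sub>C x"
    and scaleC_one: "1 *\<^sub>C x = x"
    and scaleR_scaleC: "r *\<^sub>R x = complex_of_real r *\<^sub>C x"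
    and cinner_commute: "cinner x y = cnj (cinner y x)"
    and cinner_add_left: "cinner (x + y) z = cinner x z + cinner y z"
    and cinner_scaleC_left: "cinner (c *\<^sub>C x) y = c * cinner x y"
    and inner_cinner: "inner x y = Re (cinner x y)"

global_interpretation complex_vector:
  vector_space "scaleC :: complex \<Rightarrow> 'a \<Rightarrow> 'a::complex_inner"
  by unfold_locales
    (rule scaleC_add_right scaleC_add_left scaleC_scaleC scaleC_one)+


section \<open>Operators between two subspaces\<close>

text \<open>
  A Hilbert space is given by its carrier, a closed subspace of an ambient complex inner product
  space; an operator with domain \<open>H\<close> is a function that is \<^const>\<open>undefined\<close> off \<open>H\<close>.  Hence
  two operators are equal iff they agree on \<open>H\<close>.
\<close>

definition bounded_ops ::
  "'a::complex_inner set \<Rightarrow> 'b::complex_inner set \<Rightarrow> ('a \<Rightarrow> 'b) set" where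
  "bounded_ops H K = {T \<in> H \<rightarrow>\<^sub>E K.
     (\<forall>x\<in>H. \<forall>y\<in>H. T (x + y) = T x + T y) \<and>
     (\<forall>c. \<forall>x\<in>H. T (c *\<^sub>C x) = c *\<^sub>C T x) \<and>
     (\<exists>B. \<forall>x\<in>H. norm (T x) \<le> B * norm x)}"

definition operator_subspace ::
  "'a::complex_inner set \<Rightarrow> 'b::complex_inner set \<Rightarrow> ('a \<Rightarrow> 'b) set \<Rightarrow> bool" where
  "operator_subspace H K S \<longleftrightarrow> S \<subseteq> bounded_ops H K \<and>
     (\<lambda>x\<in>H. 0) \<in> S \<and>
     (\<forall>A\<in>S. \<forall>B\<in>S. (\<lambda>x\<in>H. A x + B x) \<in> S) \<and>
     (\<forall>c. \<forall>A\<in>S. (\<lambda>x\<in>H. c *\<^sub>C A x) \<in> S)"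

text \<open>
  \<open>nuclear_rep H K t f g\<close> says that \<open>t = (\<Sum>n. f n \<otimes> g n)\<close> as an operator from \<open>K\<close> to \<open>H\<close>, where
  \<open>(f \<otimes> g) x = cinner x g *\<^sub>C f\<close>, with square-summable \<open>f\<close> and \<open>g\<close>.  Under this summability
  the series converges absolutely in operator norm, so pointwise convergence is no restriction.
\<close>

definition nuclear_rep ::
  "'a::complex_inner set \<Rightarrow> 'b::complex_inner set \<Rightarrow> ('b \<Rightarrow> 'a) \<Rightarrow>
   (nat \<Rightarrow> 'a) \<Rightarrow> (nat \<Rightarrow> 'b) \<Rightarrow> bool" where
  "nuclear_rep H K t f g \<longleftrightarrow>
     (\<forall>n. f n \<in> H) \<and> (\<forall>n. g n \<in> K) \<and>
     summable (\<lambda>n. (norm (f n))\<^sup>2) \<and> summable (\<lambda>n. (norm (g n))\<^sup>2) \<and>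
     (\<forall>x\<in>K. (\<lambda>n. cinner x (g n) *\<^sub>C f n) sums t x)"

text \<open>Note the order of the arguments: these are the trace class operators from \<open>K\<close> to \<open>H\<close>.\<close>

definition trace_class ::
  "'a::complex_inner set \<Rightarrow> 'b::complex_inner set \<Rightarrow> ('b \<Rightarrow> 'a) set" where
  "trace_class H K = {t \<in> bounded_ops K H. \<exists>f g. nuclear_rep H K t f g}"

text \<open>
  For closed subspaces \<open>H\<close>, \<open>K\<close> of Hilbert spaces the sum below is the trace of \<open>T \<circ> t\<close>, so it does
  not depend on the representation of \<open>t\<close>.
\<close>

definition trace_pairing ::
  "'a::complex_inner set \<Rightarrow> 'b::complex_inner set \<Rightarrow> ('a \<Rightarrow> 'b) \<Rightarrow> ('b \<Rightarrow> 'a) \<Rightarrow> complex" where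
  "trace_pairing H K T t =
     (THE c. \<exists>f g. nuclear_rep H K t f g \<and> c = (\<Sum>n. cinner (T (f n)) (g n)))"

definition weak_star_topology ::
  "'a::complex_inner set \<Rightarrow> 'b::complex_inner set \<Rightarrow> ('a \<Rightarrow> 'b) topology" where
  "weak_star_topology H K = topology_generated_by
     {{T \<in> bounded_ops H K. trace_pairing H K T t \<in> U} | t U. t \<in> trace_class H K \<and> open U}"

definition weak_operator_topology ::
  "'a::complex_inner set \<Rightarrow> 'b::complex_inner set \<Rightarrow> ('a \<Rightarrow> 'b) topology" where
  "weak_operator_topology H K = topology_generated_by
     {{T \<in> bounded_ops H K. cinner (T x) y \<in> U} | x y U. x \<in> H \<and> y \<in> K \<and> open U}"

definition rank_at_most ::
  "nat \<Rightarrow> 'a::complex_inner set \<Rightarrow> 'b::complex_inner set \<Rightarrow> ('b \<Rightarrow> 'a) set" where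
  "rank_at_most k H K = {t \<in> trace_class H K.
     \<exists>B. finite B \<and> card B \<le> k \<and> t ` K \<subseteq> complex_vector.span B}"

definition preannihilator ::
  "'a::complex_inner set \<Rightarrow> 'b::complex_inner set \<Rightarrow> ('a \<Rightarrow> 'b) set \<Rightarrow> ('b \<Rightarrow> 'a) set" where
  "preannihilator H K S = {t \<in> trace_class H K. \<forall>T\<in>S. trace_pairing H K T t = 0}"

definition annihilator ::
  "'a::complex_inner set \<Rightarrow> 'b::complex_inner set \<Rightarrow> ('b \<Rightarrow> 'a) set \<Rightarrow> ('a \<Rightarrow> 'b) set" where
  "annihilator H K M = {T \<in> bounded_ops H K. \<forall>t\<in>M. trace_pairing H K T t = 0}"

definition weak_star_closed_subspace ::
  "'a::complex_inner set \<Rightarrow> 'b::complex_inner set \<Rightarrow> ('a \<Rightarrow> 'b) set \<Rightarrow> bool" where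
  "weak_star_closed_subspace H K S \<longleftrightarrow>
     operator_subspace H K S \<and> closedin (weak_star_topology H K) S"

definition transitive_space ::
  "'a::complex_inner set \<Rightarrow> 'b::complex_inner set \<Rightarrow> ('a \<Rightarrow> 'b) set \<Rightarrow> bool" where
  "transitive_space H K S \<longleftrightarrow> preannihilator H K S \<inter> rank_at_most 1 H K = {\<lambda>x\<in>K. 0}"

definition k_reflexive ::
  "nat \<Rightarrow> 'a::complex_inner set \<Rightarrow> 'b::complex_inner set \<Rightarrow> ('a \<Rightarrow> 'b) set \<Rightarrow> bool" where
  "k_reflexive k H K S \<longleftrightarrow> S = annihilator H K (preannihilator H K S \<inter> rank_at_most k H K)"


section \<open>The space \<open>L\<^sup>2\<close> of the unit circle\<close>

text \<open>
  Normalized Lebesgue measure of the unit circle, as a Borel measure on the complex plane that is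
  concentrated on the circle.
\<close>

definition circle_measure :: "complex measure" where
  "circle_measure = distr (uniform_measure lborel {0..<2 * pi}) borel cis"

lemma prob_space_circle_measure: "prob_space circle_measure"
proof -
  have "prob_space (uniform_measure lborel {0..<2 * pi})"
    by (rule prob_space_uniform_measure) auto
  moreover have "cis \<in> measurable (uniform_measure lborel {0..<2 * pi}) borel"
    by (simp add: measurable_cong_sets[OF sets_uniform_measure refl]
        borel_measurable_continuous_onI continuous_intros)
  ultimately show ?thesis
    unfolding circle_measure_def by (rule prob_space.prob_space_distr)
qed

lemma AE_circle_measure_norm: "AE z in circle_measure. norm z = 1"
proof -
  have "cis \<in> measurable (uniform_measure lborel {0..<2 * pi}) borel"
    by (simp add: measurable_cong_sets[OF sets_uniform_measure refl]
        borel_measurable_continuous_onI continuous_intros)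
  then show ?thesis
    unfolding circle_measure_def by (subst AE_distr_iff) auto
qed

definition square_integrable :: "(complex \<Rightarrow> complex) \<Rightarrow> bool" where
  "square_integrable f \<longleftrightarrow>
     f \<in> borel_measurable circle_measure \<and> integrable circle_measure (\<lambda>z. (norm (f z))\<^sup>2)"

lemma square_integrable_zero: "square_integrable (\<lambda>_. 0)"
  by (simp add: square_integrable_def)

lemma square_integrable_add:
  assumes "square_integrable f" "square_integrable g"
  shows "square_integrable (\<lambda>z. f z + g z)"
proof -
  have [measurable]: "f \<in> borel_measurable circle_measure" "g \<in> borel_measurable circle_measure"
    using assms by (auto simp: square_integrable_def)
  have bd: "(norm (a + b))\<^sup>2 \<le> 2 * (norm a)\<^sup>2 + 2 * (norm b)\<^sup>2" for a b :: complex
  proof -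
    have "(norm (a + b))\<^sup>2 \<le> (norm a + norm b)\<^sup>2"
      by (rule power_mono[OF norm_triangle_ineq]) simp
    also have "\<dots> \<le> 2 * (norm a)\<^sup>2 + 2 * (norm b)\<^sup>2"
      using zero_le_power2[of "norm a - norm b"] by (simp add: power2_eq_square algebra_simps)
    finally show ?thesis .
  qed
  have "integrable circle_measure (\<lambda>z. (norm (f z + g z))\<^sup>2)"
  proof (rule Bochner_Integration.integrable_bound)
    show "integrable circle_measure (\<lambda>z. 2 * (norm (f z))\<^sup>2 + 2 * (norm (g z))\<^sup>2)"
      using assms by (auto simp: square_integrable_def)
    show "AE z in circle_measure.
        norm ((norm (f z + g z))\<^sup>2) \<le> norm (2 * (norm (f z))\<^sup>2 + 2 * (norm (g z))\<^sup>2)"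
      using bd by (intro AE_I2) simp
  qed measurable
  then show ?thesis by (simp add: square_integrable_def)
qed

lemma square_integrable_scale:
  assumes "square_integrable f"
  shows "square_integrable (\<lambda>z. c * f z)"
  using assms by (auto simp: square_integrable_def norm_mult power_mult_distrib)

lemma integrable_square_integrable_mult:
  assumes "square_integrable f" "square_integrable g"
  shows "integrable circle_measure (\<lambda>z. f z * cnj (g z))"
proof -
  have [measurable]: "f \<in> borel_measurable circle_measure" "g \<in> borel_measurable circle_measure"
    using assms by (auto simp: square_integrable_def)
  have bd: "norm (a * cnj b) \<le> (norm a)\<^sup>2 + (norm b)\<^sup>2" for a b :: complex
  proof -
    have "2 * (norm a * norm b) \<le> (norm a)\<^sup>2 + (norm b)\<^sup>2"
      using zero_le_power2[of "norm a - norm b"] by (simp add: power2_eq_square algebra_simps)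
    moreover have "0 \<le> norm a * norm b" by simp
    ultimately have "norm a * norm b \<le> (norm a)\<^sup>2 + (norm b)\<^sup>2" by linarith
    then show ?thesis by (simp add: norm_mult)
  qed
  show ?thesis
  proof (rule Bochner_Integration.integrable_bound)
    show "integrable circle_measure (\<lambda>z. (norm (f z))\<^sup>2 + (norm (g z))\<^sup>2)"
      using assms by (auto simp: square_integrable_def)
    show "AE z in circle_measure.
        norm (f z * cnj (g z)) \<le> norm ((norm (f z))\<^sup>2 + (norm (g z))\<^sup>2)"
      using bd by (intro AE_I2) simp
    have [measurable]: "cnj \<in> borel_measurable borel"
      by (intro borel_measurable_continuous_onI continuous_intros)
    show "(\<lambda>z. f z * cnj (g z)) \<in> borel_measurable circle_measure"
      by measurable
  qed
qed

definition circle_L2_rel :: "(complex \<Rightarrow> complex) \<Rightarrow> (complex \<Rightarrow> complex) \<Rightarrow> bool" where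
  "circle_L2_rel f g \<longleftrightarrow>
     square_integrable f \<and> square_integrable g \<and> (AE z in circle_measure. f z = g z)"

quotient_type circle_L2 = "complex \<Rightarrow> complex" / partial: circle_L2_rel
proof (rule part_equivpI)
  show "\<exists>f. circle_L2_rel f f"
    using square_integrable_zero by (auto simp: circle_L2_rel_def)
  show "symp circle_L2_rel"
    by (auto simp: symp_def circle_L2_rel_def)
  show "transp circle_L2_rel"
    unfolding transp_def circle_L2_rel_def by (auto elim: AE_mp)
qed

instantiation circle_L2 :: complex_inner
begin

lift_definition zero_circle_L2 :: circle_L2 is "\<lambda>_. 0"
  by (simp add: circle_L2_rel_def square_integrable_zero)

lift_definition plus_circle_L2 :: "circle_L2 \<Rightarrow> circle_L2 \<Rightarrow> circle_L2"
  is "\<lambda>f g z. f z + g z"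
  by (auto simp: circle_L2_rel_def intro!: square_integrable_add elim: AE_mp)

lift_definition scaleC_circle_L2 :: "complex \<Rightarrow> circle_L2 \<Rightarrow> circle_L2"
  is "\<lambda>c f z. c * f z"
  by (auto simp: circle_L2_rel_def intro!: square_integrable_scale elim: AE_mp)

lift_definition cinner_circle_L2 :: "circle_L2 \<Rightarrow> circle_L2 \<Rightarrow> complex"
  is "\<lambda>f g. \<integral>z. f z * cnj (g z) \<partial>circle_measure"
proof -
  fix f f' g g' :: "complex \<Rightarrow> complex"
  assume fg: "circle_L2_rel f f'" "circle_L2_rel g g'"
  show "(\<integral>z. f z * cnj (g z) \<partial>circle_measure) = (\<integral>z. f' z * cnj (g' z) \<partial>circle_measure)"
  proof (rule integral_cong_AE)
    show "AE z in circle_measure. f z * cnj (g z) = f' z * cnj (g' z)"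
      using fg unfolding circle_L2_rel_def by (auto elim: AE_mp)
  qed (use fg in \<open>auto simp: circle_L2_rel_def intro!: borel_measurable_integrable
      integrable_square_integrable_mult\<close>)
qed

definition uminus_circle_L2 :: "circle_L2 \<Rightarrow> circle_L2" where
  "uminus_circle_L2 x = (-1) *\<^sub>C x"

definition minus_circle_L2 :: "circle_L2 \<Rightarrow> circle_L2 \<Rightarrow> circle_L2" where
  "minus_circle_L2 x y = x + - y"

definition scaleR_circle_L2 :: "real \<Rightarrow> circle_L2 \<Rightarrow> circle_L2" where
  "scaleR_circle_L2 r x = complex_of_real r *\<^sub>C x"

definition inner_circle_L2 :: "circle_L2 \<Rightarrow> circle_L2 \<Rightarrow> real" where
  "inner_circle_L2 x y = Re (cinner x y)"

definition norm_circle_L2 :: "circle_L2 \<Rightarrow> real" where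
  "norm_circle_L2 x = sqrt (inner x x)"

definition sgn_circle_L2 :: "circle_L2 \<Rightarrow> circle_L2" where
  "sgn_circle_L2 x = inverse (norm x) *\<^sub>R x"

definition dist_circle_L2 :: "circle_L2 \<Rightarrow> circle_L2 \<Rightarrow> real" where
  "dist_circle_L2 x y = norm (x - y)"

definition uniformity_circle_L2 :: "(circle_L2 \<times> circle_L2) filter" where
  "uniformity_circle_L2 = (INF e\<in>{0<..}. principal {(x, y). dist x y < e})"

definition open_circle_L2 :: "circle_L2 set \<Rightarrow> bool" where
  "open_circle_L2 U = (\<forall>x\<in>U. eventually (\<lambda>(x', y). x' = x \<longrightarrow> y \<in> U) uniformity)"

instance
proof
  have add_left: "(c + d) *\<^sub>C x = c *\<^sub>C x + d *\<^sub>C x" for c d and x :: circle_L2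
    by transfer
      (auto simp: circle_L2_rel_def algebra_simps intro!: square_integrable_add square_integrable_scale)
  have add_right: "c *\<^sub>C (x + y) = c *\<^sub>C x + c *\<^sub>C y" for c and x y :: circle_L2
    by transfer
      (auto simp: circle_L2_rel_def algebra_simps intro!: square_integrable_add square_integrable_scale)
  have assoc: "c *\<^sub>C d *\<^sub>C x = (c * d) *\<^sub>C x" for c d and x :: circle_L2
    by transfer (auto simp: circle_L2_rel_def mult.assoc intro!: square_integrable_scale)
  have one: "1 *\<^sub>C x = x" for x :: circle_L2
    by transfer (auto simp: circle_L2_rel_def)
  have comm: "cinner x y = cnj (cinner y x)" for x y :: circle_L2
    by transfer (simp add: mult.commute flip: Bochner_Integration.integral_cnj)
  have cadd: "cinner (x + y) z = cinner x z + cinner y z" for x y z :: circle_L2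
    by transfer
      (simp add: circle_L2_rel_def distrib_right integrable_square_integrable_mult)
  have cscale: "cinner (c *\<^sub>C x) y = c * cinner x y" for c and x y :: circle_L2
    by transfer (simp add: mult.assoc)
  have zero_scale: "0 *\<^sub>C x = 0" for x :: circle_L2
    by transfer (auto simp: circle_L2_rel_def square_integrable_zero)
  have inner_eq: "x \<bullet> x = 0 \<longleftrightarrow> x = 0" and inner_pos: "0 \<le> x \<bullet> x" for x :: circle_L2
  proof -
    have "0 \<le> Re (cinner x x) \<and> (Re (cinner x x) = 0 \<longleftrightarrow> x = 0)"
    proof transfer
      fix f :: "complex \<Rightarrow> complex"
      assume "circle_L2_rel f f"
      then have f: "square_integrable f" by (simp add: circle_L2_rel_def)
      then have int: "integrable circle_measure (\<lambda>z. (norm (f z))\<^sup>2)"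
        by (simp add: square_integrable_def)
      have eq: "Re (\<integral>z. f z * cnj (f z) \<partial>circle_measure) = (\<integral>z. (norm (f z))\<^sup>2 \<partial>circle_measure)"
        unfolding complex_norm_square[symmetric] integral_complex_of_real by simp
      have "(\<integral>z. (norm (f z))\<^sup>2 \<partial>circle_measure) = 0 \<longleftrightarrow>
          (AE z in circle_measure. (norm (f z))\<^sup>2 = 0)"
        by (rule integral_nonneg_eq_0_iff_AE[OF int]) simp
      then show "0 \<le> Re (\<integral>z. f z * cnj (f z) \<partial>circle_measure) \<and>
          (Re (\<integral>z. f z * cnj (f z) \<partial>circle_measure) = 0 \<longleftrightarrow> circle_L2_rel f (\<lambda>_. 0))"
        using f by (simp add: eq circle_L2_rel_def square_integrable_zero)
    qed
    then show "x \<bullet> x = 0 \<longleftrightarrow> x = 0" "0 \<le> x \<bullet> x"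
      by (simp_all add: inner_circle_L2_def)
  qed
  fix x y z :: circle_L2 and a b :: real and c d :: complex and U :: "circle_L2 set"
  show "x + y + z = x + (y + z)"
    by transfer (auto simp: circle_L2_rel_def add.assoc intro!: square_integrable_add)
  show "x + y = y + x"
    by transfer (auto simp: circle_L2_rel_def add.commute intro!: square_integrable_add)
  show "0 + x = x"
    by transfer (auto simp: circle_L2_rel_def)
  show "- x + x = 0"
    unfolding uminus_circle_L2_def
    by (metis add_left add.left_inverse one zero_scale)
  show "x - y = x + - y"
    by (simp add: minus_circle_L2_def)
  show "a *\<^sub>R (x + y) = a *\<^sub>R x + a *\<^sub>R y"
    by (simp add: scaleR_circle_L2_def add_right)
  show "(a + b) *\<^sub>R x = a *\<^sub>R x + b *\<^sub>R x"
    by (simp add: scaleR_circle_L2_def add_left)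
  show "a *\<^sub>R b *\<^sub>R x = (a * b) *\<^sub>R x"
    by (simp add: scaleR_circle_L2_def assoc)
  show "1 *\<^sub>R x = x"
    by (simp add: scaleR_circle_L2_def one)
  show "sgn x = inverse (norm x) *\<^sub>R x"
    by (simp add: sgn_circle_L2_def)
  show "dist x y = norm (x - y)"
    by (simp add: dist_circle_L2_def)
  show "(uniformity :: (circle_L2 \<times> circle_L2) filter) =
      (INF e\<in>{0<..}. principal {(x, y). dist x y < e})"
    by (simp add: uniformity_circle_L2_def)
  show "open U \<longleftrightarrow> (\<forall>x\<in>U. \<forall>\<^sub>F (x', y) in uniformity. x' = x \<longrightarrow> y \<in> U)"
    by (simp add: open_circle_L2_def)
  show "x \<bullet> y = y \<bullet> x"
    unfolding inner_circle_L2_def by (subst comm) simp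
  show "(x + y) \<bullet> z = x \<bullet> z + y \<bullet> z"
    by (simp add: inner_circle_L2_def cadd)
  show "(a *\<^sub>R x) \<bullet> y = a * (x \<bullet> y)"
    by (simp add: inner_circle_L2_def scaleR_circle_L2_def cscale)
  show "0 \<le> x \<bullet> x" by (rule inner_pos)
  show "x \<bullet> x = 0 \<longleftrightarrow> x = 0" by (rule inner_eq)
  show "norm x = sqrt (x \<bullet> x)"
    by (simp add: norm_circle_L2_def)
  show "c *\<^sub>C (x + y) = c *\<^sub>C x + c *\<^sub>C y" by (rule add_right)
  show "(c + d) *\<^sub>C x = c *\<^sub>C x + d *\<^sub>C x" by (rule add_left)
  show "c *\<^sub>C d *\<^sub>C x = (c * d) *\<^sub>C x" by (rule assoc)
  show "1 *\<^sub>C x = x" by (rule one)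
  show "a *\<^sub>R x = complex_of_real a *\<^sub>C x"
    by (simp add: scaleR_circle_L2_def)
  show "cinner x y = cnj (cinner y x)" by (rule comm)
  show "cinner (x + y) z = cinner x z + cinner y z" by (rule cadd)
  show "cinner (c *\<^sub>C x) y = c * cinner x y" by (rule cscale)
  show "x \<bullet> y = Re (cinner x y)"
    by (simp add: inner_circle_L2_def)
qed

end

text \<open>
  A representative \<open>fun_of f\<close> of the class \<open>f\<close>; all uses below are invariant under changes on null
  sets.  Conversely, \<open>L2_of f\<close> is the class of \<open>f\<close>, with \<open>0\<close> as a dummy value if \<open>f\<close> is not
  square integrable.
\<close>

definition fun_of :: "circle_L2 \<Rightarrow> complex \<Rightarrow> complex" where
  "fun_of f = rep_circle_L2 f"

definition L2_of :: "(complex \<Rightarrow> complex) \<Rightarrow> circle_L2" where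
  "L2_of f = (if square_integrable f then abs_circle_L2 f else 0)"

lemma square_integrable_fun_of: "square_integrable (fun_of f)"
  using Quotient_rep_reflp[OF Quotient_circle_L2, of f]
  by (simp add: fun_of_def circle_L2_rel_def)

lemma L2_of_fun_of: "L2_of (fun_of f) = f"
  using square_integrable_fun_of[of f]
  by (simp add: L2_of_def fun_of_def Quotient_abs_rep[OF Quotient_circle_L2])

lemma AE_fun_of_L2_of:
  assumes "square_integrable f"
  shows "AE z in circle_measure. fun_of (L2_of f) z = f z"
  using rep_abs_rsp_left[OF Quotient3_circle_L2, of f f] assms
  by (simp add: L2_of_def fun_of_def circle_L2_rel_def)


section \<open>Model spaces and asymmetric truncated Toeplitz operators\<close>

definition fourier_coeff :: "circle_L2 \<Rightarrow> int \<Rightarrow> complex" where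
  "fourier_coeff f n = (\<integral>z. fun_of f z * z powi (- n) \<partial>circle_measure)"

definition hardy_space :: "circle_L2 set" where
  "hardy_space = {f. \<forall>n<0. fourier_coeff f n = 0}"

definition essentially_bounded :: "circle_L2 set" where
  "essentially_bounded = {f. \<exists>C. AE z in circle_measure. norm (fun_of f z) \<le> C}"

text \<open>An inner function is identified with its boundary function.\<close>

definition inner_function :: "circle_L2 \<Rightarrow> bool" where
  "inner_function \<theta> \<longleftrightarrow>
     \<theta> \<in> hardy_space \<and> (AE z in circle_measure. norm (fun_of \<theta> z) = 1)"

definition nonconstant :: "circle_L2 \<Rightarrow> bool" where
  "nonconstant \<theta> \<longleftrightarrow> \<not> (\<exists>c. AE z in circle_measure. fun_of \<theta> z = c)"

text \<open>
  The pointwise product.  It is square integrable, and hence not the dummy value of \<^const>\<open>L2_of\<close>,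
  as soon as one of the factors is essentially bounded.
\<close>

definition L2_mult :: "circle_L2 \<Rightarrow> circle_L2 \<Rightarrow> circle_L2" where
  "L2_mult \<phi> f = L2_of (\<lambda>z. fun_of \<phi> z * fun_of f z)"

definition model_space :: "circle_L2 \<Rightarrow> circle_L2 set" where
  "model_space \<theta> = {f \<in> hardy_space. \<forall>g\<in>hardy_space. cinner f (L2_mult \<theta> g) = 0}"

definition orth_proj :: "'a::complex_inner set \<Rightarrow> 'a \<Rightarrow> 'a" where
  "orth_proj M x = (THE y. y \<in> M \<and> (\<forall>z\<in>M. cinner (x - y) z = 0))"

text \<open>
  An operator belongs to \<open>att_operators \<theta> \<alpha>\<close> iff it is the bounded extension to the whole model
  space of the densely defined operator \<open>f \<mapsto> P\<^sub>\<alpha> (\<phi> f)\<close> for some symbol \<open>\<phi>\<close>.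
\<close>

definition att_operators :: "circle_L2 \<Rightarrow> circle_L2 \<Rightarrow> (circle_L2 \<Rightarrow> circle_L2) set" where
  "att_operators \<theta> \<alpha> = {A \<in> bounded_ops (model_space \<theta>) (model_space \<alpha>).
     \<exists>\<phi>. \<forall>f \<in> model_space \<theta> \<inter> essentially_bounded.
       A f = orth_proj (model_space \<alpha>) (L2_mult \<phi> f)}"

end

theory Submission
  imports Defs
begin

text \<open>
  Everything rests on one description of the operators: a bounded \<open>A\<close> from \<open>K\<^sub>\<theta>\<close> to \<open>K\<^sub>\<alpha>\<close> is an asymmetric
  truncated Toeplitz operator iff it is shift invariant, that is, iff
  \<open>\<langle>A h, k\<rangle> = \<langle>A (S\<^sup>* h), S\<^sup>* k\<rangle>\<close> for all bounded \<open>h \<in> K\<^sub>\<theta>\<close>, \<open>k \<in> K\<^sub>\<alpha>\<close> that vanish at the origin, where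
  \<open>S\<^sup>*\<close> is the backward shift (\<open>att_operators_iff_shift_invariant\<close>).  Each of these equations says that
  \<open>A\<close> is annihilated by the operator \<open>h \<otimes> k - S\<^sup>* h \<otimes> S\<^sup>* k\<close> of rank at most two.  So the space is the
  annihilator of a set of operators of rank at most two, which makes it a subspace that is closed in
  both topologies, and 2-reflexive.

  That truncated Toeplitz operators are shift invariant is immediate from \<open>h = z S\<^sup>* h\<close>, \<open>k = z S\<^sup>* k\<close>
  and \<open>\<bar>z\<bar> = 1\<close>.  Conversely, if \<open>A\<close> is shift invariant, the form
  \<open>\<langle>A h, k\<rangle> - \<langle>A (S\<^sup>* h), S\<^sup>* k\<rangle>\<close> vanishes when both arguments vanish at the origin, so
  it equals \<open>h(0) \<langle>\<psi>, k\<rangle> + cnj (k(0)) \<langle>h, \<eta>\<rangle>\<close> with some \<open>\<psi> \<in> K\<^sub>\<alpha>\<close> and \<open>\<eta> \<in> K\<^sub>\<theta>\<close>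
  (\<open>shift_invariant_decomposition\<close>).  The symbol is \<open>\<phi> = \<psi> + cnj \<eta>\<close>: multiplication by \<open>\<phi>\<close> has the same
  defect, hence \<open>D(h, k) = \<langle>A h, k\<rangle> - \<langle>\<phi> h, k\<rangle>\<close> satisfies \<open>D(h, k) = D(S\<^sup>*\<^sup>n h, S\<^sup>*\<^sup>n k)\<close> for all \<open>n\<close>.
  The first term of the latter tends to \<open>0\<close> because \<open>S\<^sup>*\<^sup>n h\<close> does.  In the second, \<open>S\<^sup>*\<^sup>n h\<close> need not stay
  bounded in the supremum norm, but \<open>\<langle>\<psi> S\<^sup>*\<^sup>n h, S\<^sup>*\<^sup>n k\<rangle>\<close> is the pairing of a Taylor remainder of \<open>h\<close>
  with \<open>cnj \<psi> k\<close>, which lies in \<open>L\<^sup>2\<close> as \<open>k\<close> is bounded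
  (\<open>analytic_symbol_bshift_funpow_tendsto_0\<close>).  Bounded functions separate the points of \<open>K\<^sub>\<alpha>\<close>
  (\<open>model_space_eqI\<close>), so \<open>D = 0\<close> identifies \<open>A\<close>.

  For transitivity, an operator \<open>f \<otimes> g\<close> in the preannihilator pairs to zero with the operators with
  symbols \<open>z\<^sup>n\<close>, so all Fourier coefficients of \<open>f cnj g\<close> vanish and \<open>f cnj g = 0\<close> almost everywhere.
  Since a nonzero function of the Hardy space is nonzero almost everywhere (\<open>hardy_nonzero_AE\<close>),
  \<open>f = 0\<close> or \<open>g = 0\<close>.

  The analytic background consists of the completeness of \<open>L\<^sup>2\<close>, the uniqueness of Fourier coefficients
  of integrable functions, the Riesz representation of functionals, and the independence of the trace
  pairing of the chosen nuclear representation.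
\<close>

section \<open>Complex inner product spaces\<close>

lemma scaleC_0_left [simp]: "0 *\<^sub>C (x::'a::complex_inner) = 0"
  and scaleC_0_right [simp]: "c *\<^sub>C (0::'a::complex_inner) = 0"
  and scaleC_minus1_left: "(- 1) *\<^sub>C (x::'a::complex_inner) = - x"
  and scaleC_diff_right: "c *\<^sub>C ((x::'a::complex_inner) - y) = c *\<^sub>C x - c *\<^sub>C y"
  using complex_vector.scale_minus_left[of 1 x] by (auto simp: complex_vector.scale_right_diff_distrib)

lemma cinner_add_right: "cinner (x::'a::complex_inner) (y + z) = cinner x y + cinner x z"
  by (metis cinner_add_left cinner_commute complex_cnj_add)

lemma cinner_scaleC_right: "cinner (x::'a::complex_inner) (c *\<^sub>C y) = cnj c * cinner x y"
  by (metis cinner_scaleC_left cinner_commute complex_cnj_mult)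

lemma cinner_zero_left [simp]: "cinner 0 (x::'a::complex_inner) = 0"
  using cinner_scaleC_left[of 0 x x] by simp

lemma cinner_zero_right [simp]: "cinner (x::'a::complex_inner) 0 = 0"
  using cinner_scaleC_right[of x 0 x] by simp

lemma cinner_diff_left: "cinner ((x::'a::complex_inner) - y) z = cinner x z - cinner y z"
  using cinner_add_left[of "x - y" y z] by simp

lemma cinner_diff_right: "cinner z ((x::'a::complex_inner) - y) = cinner z x - cinner z y"
  using cinner_add_right[of z "x - y" y] by simp

lemma cinner_self: "cinner x x = complex_of_real ((norm (x::'a::complex_inner))\<^sup>2)"
proof -
  have "Im (cinner x x) = 0"
    using arg_cong[OF cinner_commute[of x x], of Im] by simp
  moreover have "Re (cinner x x) = (norm x)\<^sup>2"
    by (simp add: inner_cinner[symmetric] power2_norm_eq_inner)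
  ultimately show ?thesis by (simp add: complex_eq_iff)
qed

lemma cinner_self_eq_0 [simp]: "cinner x x = 0 \<longleftrightarrow> (x::'a::complex_inner) = 0"
  by (simp add: cinner_self)

lemma norm_scaleC: "norm (c *\<^sub>C (x::'a::complex_inner)) = norm c * norm x"
proof -
  have "complex_of_real ((norm (c *\<^sub>C x))\<^sup>2) = complex_of_real ((norm c * norm x)\<^sup>2)"
    unfolding cinner_self[symmetric] cinner_scaleC_left cinner_scaleC_right
    by (simp add: cinner_self power_mult_distrib mult_ac flip: complex_norm_square)
  then have "(norm (c *\<^sub>C x))\<^sup>2 = (norm c * norm x)\<^sup>2"
    by (simp only: of_real_eq_iff)
  then show ?thesis
    using power2_eq_imp_eq by fastforce
qed

lemma cinner_bound: "norm (cinner x y) \<le> norm x * norm (y::'a::complex_inner)"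
proof (cases "cinner x y = 0")
  case False
  \<comment> \<open>rotate \<open>x\<close> so that the inner product becomes real\<close>
  define c where "c = cnj (cinner x y) / norm (cinner x y)"
  have "norm c = 1" using False by (simp add: c_def norm_divide)
  have "cinner (c *\<^sub>C x) y = norm (cinner x y)"
    using False by (simp add: c_def cinner_scaleC_left complex_norm_square[symmetric] mult.commute
        power2_eq_square)
  then have "norm (cinner x y) = inner (c *\<^sub>C x) y"
    by (simp add: inner_cinner)
  also have "\<dots> \<le> norm (c *\<^sub>C x) * norm y" by (rule norm_cauchy_schwarz)
  finally show ?thesis by (simp add: norm_scaleC \<open>norm c = 1\<close>)
qed simp

lemma bounded_bilinear_cinner: "bounded_bilinear (cinner :: 'a::complex_inner \<Rightarrow> 'a \<Rightarrow> complex)"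
proof
  show "\<exists>K. \<forall>a b::'a. norm (cinner a b) \<le> norm a * norm b * K"
    by (rule exI[of _ 1]) (simp add: cinner_bound)
qed (simp_all add: cinner_add_left cinner_add_right scaleR_scaleC cinner_scaleC_left
    cinner_scaleC_right scaleR_conv_of_real)

lemma bounded_bilinear_scaleC: "bounded_bilinear (scaleC :: complex \<Rightarrow> 'a::complex_inner \<Rightarrow> 'a)"
proof
  show "\<exists>K. \<forall>a (b::'a). norm (a *\<^sub>C b) \<le> norm a * norm b * K"
    by (rule exI[of _ 1]) (simp add: norm_scaleC)
qed (simp_all add: scaleC_add_left scaleC_add_right scaleR_scaleC scaleR_conv_of_real
    scaleC_scaleC mult_ac)

interpretation cinner: bounded_bilinear "cinner :: 'a::complex_inner \<Rightarrow> 'a \<Rightarrow> complex"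
  by (rule bounded_bilinear_cinner)

interpretation scaleC: bounded_bilinear "scaleC :: complex \<Rightarrow> 'a::complex_inner \<Rightarrow> 'a"
  by (rule bounded_bilinear_scaleC)

lemma cinner_eq_zero_comm: "cinner x y = 0 \<Longrightarrow> cinner y (x::'a::complex_inner) = 0"
  by (metis cinner_commute complex_cnj_zero)

lemma complex_subspaceD:
  assumes "complex_vector.subspace M"
  shows "0 \<in> M" "\<And>x y. x \<in> M \<Longrightarrow> y \<in> M \<Longrightarrow> x + y \<in> M" "\<And>c x. x \<in> M \<Longrightarrow> c *\<^sub>C x \<in> M"
    "\<And>x y. x \<in> M \<Longrightarrow> y \<in> M \<Longrightarrow> x - y \<in> M"
  using assms by (auto intro: complex_vector.subspace_0 complex_vector.subspace_add
      complex_vector.subspace_scale complex_vector.subspace_diff)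

text \<open>
  The representing vector minimizes \<open>x \<mapsto> \<parallel>x\<parallel>\<^sup>2 - 2 Re (l x)\<close>: by the parallelogram law every
  minimizing sequence is a Cauchy sequence, and the derivative vanishes at the limit.  Applied to
  \<open>l = (\<lambda>z. cinner z x)\<close> the same lemma yields the orthogonal projection of \<open>x\<close> onto \<open>M\<close>.
\<close>

lemma riesz_representation:
  fixes M :: "'a::{complex_inner, complete_space} set" and l :: "'a \<Rightarrow> complex"
  assumes M: "complex_vector.subspace M" "closed M"
    and add: "\<And>x y. x \<in> M \<Longrightarrow> y \<in> M \<Longrightarrow> l (x + y) = l x + l y"
    and scale: "\<And>c x. x \<in> M \<Longrightarrow> l (c *\<^sub>C x) = c * l x"
    and bound: "\<And>x. x \<in> M \<Longrightarrow> norm (l x) \<le> B * norm x"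
  shows "\<exists>y\<in>M. \<forall>x\<in>M. l x = cinner x y"
proof -
  note sub = complex_subspaceD[OF M(1)]
  have scaleR: "r *\<^sub>R x \<in> M" "l (r *\<^sub>R x) = of_real r * l x" if "x \<in> M" for r x
    using that sub(3) scale by (auto simp: scaleR_scaleC)
  have diff: "l (x - y) = l x - l y" if "x \<in> M" "y \<in> M" for x y
    using add[of x "(-1) *\<^sub>R y"] scaleR[of y "-1"] that by simp
  define J where "J x = (norm x)\<^sup>2 - 2 * Re (l x)" for x
  have J_bound: "J x \<ge> - B\<^sup>2" if "x \<in> M" for x
  proof -
    have "Re (l x) \<le> B * norm x"
      using bound[OF that] complex_Re_le_cmod[of "l x"] by linarith
    moreover have "0 \<le> (norm x - B)\<^sup>2" by simp
    ultimately show ?thesis by (simp add: J_def power2_eq_square algebra_simps)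
  qed
  define m where "m = Inf (J ` M)"
  have bdd: "bdd_below (J ` M)" using J_bound by (auto intro!: bdd_belowI2)
  have m_le: "m \<le> J x" if "x \<in> M" for x
    unfolding m_def using bdd that by (rule cINF_lower)
  have "\<exists>x\<in>M. J x < m + 1 / Suc n" for n
  proof -
    have "Inf (J ` M) < m + 1 / Suc n" by (simp add: m_def)
    then show ?thesis
      using cInf_less_iff[of "J ` M"] bdd sub(1) by auto
  qed
  then obtain X where X: "\<And>n. X n \<in> M" "\<And>n. J (X n) < m + 1 / Suc n" by metis
  have par: "(norm (x - y))\<^sup>2 \<le> 2 * (J x - m) + 2 * (J y - m)" if "x \<in> M" "y \<in> M" for x y
  proof -
    define w where "w = (1/2) *\<^sub>R (x + y)"
    have w: "w \<in> M" using that sub(2) scaleR by (simp add: w_def)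
    have "J w \<ge> m" using m_le[OF w] .
    moreover have "2 * Re (l w) = Re (l x) + Re (l y)"
      using that sub(2) scaleR add by (simp add: w_def)
    moreover have "(norm (x - y))\<^sup>2 = 2 * (norm x)\<^sup>2 + 2 * (norm y)\<^sup>2 - 4 * (norm w)\<^sup>2"
      by (simp add: w_def power2_norm_eq_inner algebra_simps inner_commute)
    ultimately show ?thesis by (simp add: J_def)
  qed
  have "Cauchy X"
  proof (rule metric_CauchyI)
    fix e :: real assume "0 < e"
    obtain N where N: "inverse (real (Suc N)) < e\<^sup>2 / 4"
      using reals_Archimedean[of "e\<^sup>2 / 4"] \<open>0 < e\<close> by auto
    have small: "J (X n) - m < e\<^sup>2 / 4" if "N \<le> n" for n
    proof -
      have "1 / real (Suc n) \<le> inverse (real (Suc N))"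
        using that by (simp add: field_simps)
      then show ?thesis using N X(2)[of n] by linarith
    qed
    show "\<exists>N. \<forall>i\<ge>N. \<forall>j\<ge>N. dist (X i) (X j) < e"
    proof (intro exI allI impI)
      fix i j assume "N \<le> i" "N \<le> j"
      have "(norm (X i - X j))\<^sup>2 \<le> 2 * (J (X i) - m) + 2 * (J (X j) - m)"
        by (rule par[OF X(1) X(1)])
      also have "\<dots> < 2 * (e\<^sup>2 / 4) + 2 * (e\<^sup>2 / 4)"
        by (intro add_strict_mono mult_strict_left_mono small \<open>N \<le> i\<close> \<open>N \<le> j\<close>) auto
      finally have "(norm (X i - X j))\<^sup>2 < e\<^sup>2" by simp
      then show "dist (X i) (X j) < e"
        using \<open>0 < e\<close> by (simp add: dist_norm power2_less_imp_less)
    qed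
  qed
  then obtain y where y: "X \<longlonglongrightarrow> y" using Cauchy_convergent convergent_def by blast
  have yM: "y \<in> M" using closed_sequentially[OF M(2) _ y] X(1) by blast
  have Jy: "J y \<le> m"
  proof (rule LIMSEQ_le)
    have "(\<lambda>n. l y - l (X n)) \<longlonglongrightarrow> 0"
    proof (rule Lim_null_comparison)
      show "\<forall>\<^sub>F n in sequentially. norm (l y - l (X n)) \<le> B * norm (y - X n)"
        using bound[of "y - X _"] diff[OF yM X(1)] sub(4)[OF yM X(1)] by auto
      have "(\<lambda>n. B * norm (y - X n)) \<longlonglongrightarrow> B * norm (y - y)"
        by (intro tendsto_intros y)
      then show "(\<lambda>n. B * norm (y - X n)) \<longlonglongrightarrow> 0" by simp
    qed
    then have "(\<lambda>n. l y - (l y - l (X n))) \<longlonglongrightarrow> l y - 0" by (intro tendsto_intros)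
    then have "(\<lambda>n. l (X n)) \<longlonglongrightarrow> l y" by simp
    then show "(\<lambda>n. J (X n)) \<longlonglongrightarrow> J y"
      unfolding J_def by (intro tendsto_intros y)
    have "(\<lambda>n. m + inverse (real (Suc n))) \<longlonglongrightarrow> m + 0"
      by (intro tendsto_intros LIMSEQ_inverse_real_of_nat)
    then show "(\<lambda>n. m + inverse (real (Suc n))) \<longlonglongrightarrow> m" by simp
    show "\<exists>N. \<forall>n\<ge>N. J (X n) \<le> m + inverse (real (Suc n))"
      using X(2) by (auto simp: field_simps intro!: less_imp_le)
  qed
  have re: "Re (l x) = Re (cinner x y)" if x: "x \<in> M" for x
  proof -
    define d where "d = inner x y - Re (l x)"
    have *: "0 \<le> 2 * r * d + r\<^sup>2 * (norm x)\<^sup>2" for r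
    proof -
      have "J y \<le> J (y + r *\<^sub>R x)"
        using Jy m_le[of "y + r *\<^sub>R x"] sub(2)[OF yM] scaleR[OF x] by fastforce
      moreover have "l (y + r *\<^sub>R x) = l y + of_real r * l x"
        using add[OF yM] scaleR[OF x] by simp
      moreover have "(norm (y + r *\<^sub>R x))\<^sup>2 = (norm y)\<^sup>2 + 2 * r * inner x y + r\<^sup>2 * (norm x)\<^sup>2"
        by (simp add: power2_norm_eq_inner algebra_simps inner_commute power2_eq_square[of r])
      ultimately show ?thesis by (simp add: J_def d_def algebra_simps)
    qed
    have "d = 0"
    proof (rule ccontr)
      assume "d \<noteq> 0"
      define n where "n = (norm x)\<^sup>2 + 1"
      have n: "n \<ge> 1" by (simp add: n_def)
      \<comment> \<open>this value of \<open>r\<close> makes the quadratic polynomial in \<open>*\<close> negative\<close>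
      have "0 \<le> 2 * (- d / n) * d + (- d / n)\<^sup>2 * (n - 1)"
        using *[of "- d / n"] by (simp add: n_def)
      also have "\<dots> = - d\<^sup>2 / n * (1 + 1 / n)"
        using n by (simp add: field_simps power2_eq_square)
      also have "\<dots> < 0"
        using n \<open>d \<noteq> 0\<close> by (intro mult_neg_pos) (auto simp: add_pos_pos)
      finally show False by simp
    qed
    then show ?thesis by (simp add: d_def inner_cinner)
  qed
  show ?thesis
  proof (intro bexI[OF _ yM] ballI)
    fix x assume x: "x \<in> M"
    have "Im (l x) = - Re (l (\<i> *\<^sub>C x))" using scale[OF x] by simp
    also have "\<dots> = Im (cinner x y)"
      using re[OF sub(3)[OF x]] by (simp add: cinner_scaleC_left)
    finally show "l x = cinner x y" using re[OF x] by (simp add: complex_eq_iff)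
  qed
qed

lemma orth_proj_unique:
  fixes M :: "'a::complex_inner set"
  assumes M: "complex_vector.subspace M"
    and y: "y \<in> M" "\<And>z. z \<in> M \<Longrightarrow> cinner (x - y) z = 0"
  shows "orth_proj M x = y"
  unfolding orth_proj_def
proof (rule the_equality)
  fix y' assume y': "y' \<in> M \<and> (\<forall>z\<in>M. cinner (x - y') z = 0)"
  then have "y' - y \<in> M" using M y by (simp add: complex_vector.subspace_diff)
  then have "cinner (x - y) (y' - y) - cinner (x - y') (y' - y) = 0"
    using y y' by simp
  then show "y' = y" by (simp flip: cinner_diff_left)
qed (use y in auto)

text \<open>
  By definition \<^const>\<open>orth_proj\<close> is a definite description; here completeness makes it denote.
\<close>

lemma orth_proj:
  fixes M :: "'a::{complex_inner, complete_space} set"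
  assumes M: "complex_vector.subspace M" "closed M"
  shows "orth_proj M x \<in> M" and "\<And>z. z \<in> M \<Longrightarrow> cinner (orth_proj M x) z = cinner x z"
proof -
  obtain y where y: "y \<in> M" "\<forall>z\<in>M. cinner z x = cinner z y"
    using riesz_representation[OF M, of "\<lambda>z. cinner z x" "norm x"]
    by (auto simp: cinner_add_left cinner_scaleC_left cinner_bound mult.commute)
  have z: "cinner x z = cinner y z" if "z \<in> M" for z
    using y(2) that cinner_commute by metis
  have "orth_proj M x = y"
    using y(1) z by (intro orth_proj_unique M) (auto simp: cinner_diff_left)
  then show "orth_proj M x \<in> M" "\<And>z. z \<in> M \<Longrightarrow> cinner (orth_proj M x) z = cinner x z"
    using y z by auto
qed

lemma orth_proj_linear:
  fixes M :: "'a::{complex_inner, complete_space} set"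
  assumes M: "complex_vector.subspace M" "closed M"
  shows "orth_proj M (x + y) = orth_proj M x + orth_proj M y"
    and "orth_proj M (c *\<^sub>C x) = c *\<^sub>C orth_proj M x"
  using M by (auto intro!: orth_proj_unique complex_vector.subspace_add
      complex_vector.subspace_scale
      simp: orth_proj cinner_diff_left cinner_add_left cinner_scaleC_left)

lemma norm_orth_proj_le:
  fixes M :: "'a::{complex_inner, complete_space} set"
  assumes M: "complex_vector.subspace M" "closed M"
  shows "norm (orth_proj M x) \<le> norm x"
proof -
  let ?y = "orth_proj M x"
  have "(norm ?y)\<^sup>2 = norm (cinner ?y ?y)" by (simp add: cinner_self norm_power)
  also have "\<dots> = norm (cinner x ?y)" using orth_proj[OF M] by simp
  also have "\<dots> \<le> norm x * norm ?y" by (rule cinner_bound)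
  finally show ?thesis
    by (cases "norm ?y = 0") (auto simp: power2_eq_square)
qed

section \<open>The trace pairing of operators of finite rank\<close>

definition orthonormal :: "'a::complex_inner set \<Rightarrow> bool" where
  "orthonormal E \<longleftrightarrow> (\<forall>a\<in>E. \<forall>b\<in>E. cinner a b = (if a = b then 1 else 0))"

text \<open>
  Supplies the finite-dimensional subspaces of \<open>K\<close> to which traces are compressed below.
\<close>

lemma gram_schmidt:
  fixes G :: "'a::complex_inner set"
  assumes K: "complex_vector.subspace K" and "finite G" "G \<subseteq> K"
  shows "\<exists>E. finite E \<and> E \<subseteq> K \<and> orthonormal E \<and> (\<forall>g\<in>G. g = (\<Sum>e\<in>E. cinner g e *\<^sub>C e))"
  using assms(2,3)
proof (induction G)
  case empty
  then show ?case by (intro exI[of _ "{}"]) (auto simp: orthonormal_def)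
next
  case (insert g G)
  then obtain E where E: "finite E" "E \<subseteq> K" "orthonormal E"
    and G: "\<And>g'. g' \<in> G \<Longrightarrow> g' = (\<Sum>e\<in>E. cinner g' e *\<^sub>C e)" by auto
  define p where "p = (\<Sum>e\<in>E. cinner g e *\<^sub>C e)"
  define r where "r = g - p"
  have pK: "p \<in> K"
    unfolding p_def using E K by (auto intro!: complex_vector.subspace_sum complex_vector.subspace_scale)
  have r_orth: "cinner r e = 0" if "e \<in> E" for e
  proof -
    have "cinner p e = (\<Sum>d\<in>E. if d = e then cinner g e else 0)"
      unfolding p_def cinner.sum_left using E(3) that
      by (intro sum.cong) (auto simp: cinner_scaleC_left orthonormal_def)
    then show ?thesis using that E(1) by (simp add: r_def cinner_diff_left)
  qed
  show ?case
  proof (cases "r = 0")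
    case True
    then show ?thesis using E G by (intro exI[of _ E]) (auto simp: r_def p_def)
  next
    case False
    define u where "u = complex_of_real (1 / norm r) *\<^sub>C r"
    have uu: "cinner u u = 1" and ru: "cinner r u = norm r"
      using False by (simp_all add: cinner_self u_def norm_scaleC norm_divide cinner_scaleC_right
          power2_eq_square)
    have ue: "cinner u e = 0" "cinner e u = 0" if "e \<in> E" for e
      using r_orth[OF that] cinner_eq_zero_comm[of r e]
      by (simp_all add: u_def cinner_scaleC_left cinner_scaleC_right)
    have "u \<notin> E" using ue uu by fastforce
    have span0: "cinner (\<Sum>e\<in>E. c e *\<^sub>C e) u = 0" for c
      using ue by (simp add: cinner.sum_left cinner_scaleC_left)
    show ?thesis
    proof (intro exI[of _ "insert u E"] conjI ballI)
      show "insert u E \<subseteq> K"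
        using E insert.prems pK K
        by (auto simp: u_def r_def intro!: complex_vector.subspace_scale complex_vector.subspace_diff)
      show "orthonormal (insert u E)"
        using E(3) ue uu \<open>u \<notin> E\<close> by (auto simp: orthonormal_def)
      fix x assume x: "x \<in> insert g G"
      show "x = (\<Sum>e\<in>insert u E. cinner x e *\<^sub>C e)"
      proof (cases "x \<in> G")
        case True
        have "cinner x u = 0" by (subst G[OF True]) (rule span0)
        then show ?thesis using E(1) \<open>u \<notin> E\<close> G[OF True] by simp
      next
        case gx: False
        then have [simp]: "x = g" using x by simp
        have "cinner g u = cinner r u + cinner p u"
          by (simp add: r_def cinner_diff_left)
        also have "\<dots> = norm r" using span0 by (simp add: ru p_def)
        finally have "cinner g u *\<^sub>C u = r"
          using False by (simp add: u_def scaleC_scaleC)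
        then show ?thesis using E(1) \<open>u \<notin> E\<close> by (simp add: r_def p_def)
      qed
    qed (use E in auto)
  qed
qed

text \<open>
  Compressing \<open>\<Sum>n. h n \<otimes> g n\<close> to the finite-dimensional space spanned by \<open>E\<close> does not touch the
  terms with \<open>g n\<close> in that space and does not increase the others.  So the trace, computed from
  the series, is approximated by a number that depends on the operator \<open>s\<close> alone.
\<close>

lemma trace_compression_error:
  fixes h g :: "nat \<Rightarrow> 'a::complex_inner"
  assumes E: "finite E" "orthonormal E"
    and span: "\<And>n. n < N \<Longrightarrow> g n = (\<Sum>e\<in>E. cinner (g n) e *\<^sub>C e)"
    and summ: "summable (\<lambda>n. norm (h n) * norm (g n))"
    and s: "\<And>e. e \<in> E \<Longrightarrow> (\<lambda>n. cinner e (g n) *\<^sub>C h n) sums s e"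
  shows "norm ((\<Sum>n. cinner (h n) (g n)) - (\<Sum>e\<in>E. cinner (s e) e))
           \<le> (\<Sum>n. norm (h (n + N)) * norm (g (n + N)))"
proof -
  define P where "P x = (\<Sum>e\<in>E. cinner x e *\<^sub>C e)" for x
  define d where "d n = cinner (h n) (g n - P (g n))" for n
  have Pe: "cinner (P x) e = cinner x e" if "e \<in> E" for x e
  proof -
    have "cinner (P x) e = (\<Sum>d\<in>E. if d = e then cinner x e else 0)"
      unfolding P_def cinner.sum_left using E(2) that
      by (intro sum.cong) (auto simp: cinner_scaleC_left orthonormal_def)
    then show ?thesis using that E(1) by simp
  qed
  have contr: "norm (x - P x) \<le> norm x" for x
  proof -
    have "cinner (x - P x) (P x) = (\<Sum>e\<in>E. cnj (cinner x e) * cinner (x - P x) e)"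
      by (subst (2) P_def) (simp add: cinner.sum_right cinner_scaleC_right)
    also have "\<dots> = 0" by (intro sum.neutral) (simp add: cinner_diff_left Pe)
    finally have "inner (x - P x) (P x) = 0" by (simp add: inner_cinner)
    moreover have "(norm x)\<^sup>2 = (norm (x - P x))\<^sup>2 + 2 * inner (x - P x) (P x) + (norm (P x))\<^sup>2"
      by (simp add: power2_norm_eq_inner algebra_simps inner_commute)
    ultimately have "(norm (x - P x))\<^sup>2 \<le> (norm x)\<^sup>2" by simp
    then show ?thesis by (rule power2_le_imp_le) simp
  qed
  have norm_d: "norm (d n) \<le> norm (h n) * norm (g n)" for n
    unfolding d_def using cinner_bound contr by (meson mult_left_mono norm_ge_zero order_trans)
  have summ_d: "summable (\<lambda>n. norm (d n))"
    by (rule summable_comparison_test'[OF summ, of 0]) (simp add: norm_d)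
  have summ_hg: "summable (\<lambda>n. cinner (h n) (g n))"
    by (rule summable_comparison_test'[OF summ, of 0]) (simp add: cinner_bound)
  have "(\<lambda>n. \<Sum>e\<in>E. cinner (cinner e (g n) *\<^sub>C h n) e) sums (\<Sum>e\<in>E. cinner (s e) e)"
    by (intro sums_sum bounded_linear.sums[OF cinner.bounded_linear_left] s)
  moreover have "(\<Sum>e\<in>E. cinner (cinner e (g n) *\<^sub>C h n) e) = cinner (h n) (P (g n))" for n
    unfolding P_def cinner.sum_right
    by (intro sum.cong) (simp_all add: cinner_scaleC_left cinner_scaleC_right flip: cinner_commute)
  ultimately have "(\<lambda>n. cinner (h n) (P (g n))) sums (\<Sum>e\<in>E. cinner (s e) e)" by simp
  from sums_diff[OF summable_sums[OF summ_hg] this]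
  have "(\<Sum>n. cinner (h n) (g n)) - (\<Sum>e\<in>E. cinner (s e) e) = (\<Sum>n. d n)"
    by (simp add: d_def cinner_diff_right sums_iff)
  also have "\<dots> = (\<Sum>n. d (n + N)) + (\<Sum>n<N. d n)"
    using summ_d summable_norm_cancel by (intro suminf_split_initial_segment) auto
  also have "(\<Sum>n<N. d n) = 0"
    using span by (intro sum.neutral) (auto simp: d_def P_def)
  finally have "norm ((\<Sum>n. cinner (h n) (g n)) - (\<Sum>e\<in>E. cinner (s e) e))
      = norm (\<Sum>n. d (n + N))" by simp
  also have "\<dots> \<le> (\<Sum>n. norm (d (n + N)))"
    using summ_d summable_iff_shift[of "\<lambda>n. norm (d n)" N] by (intro summable_norm) simp
  also have "\<dots> \<le> (\<Sum>n. norm (h (n + N)) * norm (g (n + N)))"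
    using norm_d summ_d summ
    by (intro suminf_le)
      (simp_all add: summable_iff_shift[of "\<lambda>n. norm (d n)"]
        summable_iff_shift[of "\<lambda>n. norm (h n) * norm (g n)"])
  finally show ?thesis .
qed

lemma bounded_opsD:
  assumes "T \<in> bounded_ops H K"
  shows "\<And>x. x \<in> H \<Longrightarrow> T x \<in> K"
    and "\<And>x y. x \<in> H \<Longrightarrow> y \<in> H \<Longrightarrow> T (x + y) = T x + T y"
    and "\<And>c x. x \<in> H \<Longrightarrow> T (c *\<^sub>C x) = c *\<^sub>C T x"
    and "\<exists>B\<ge>0. \<forall>x\<in>H. norm (T x) \<le> B * norm x"
proof -
  obtain B where "\<forall>x\<in>H. norm (T x) \<le> B * norm x"
    using assms by (auto simp: bounded_ops_def)
  then have "\<forall>x\<in>H. norm (T x) \<le> max B 0 * norm x"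
    by (meson max.cobounded1 mult_right_mono norm_ge_zero order_trans)
  then show "\<exists>B\<ge>0. \<forall>x\<in>H. norm (T x) \<le> B * norm x" by (intro exI[of _ "max B 0"]) auto
qed (use assms in \<open>auto simp: bounded_ops_def\<close>)

lemma bounded_ops_diff:
  assumes H: "complex_vector.subspace H" and T: "T \<in> bounded_ops H K" and "x \<in> H" "y \<in> H"
  shows "T (x - y) = T x - T y"
proof -
  have "x - y \<in> H" using assms by (intro complex_vector.subspace_diff)
  from bounded_opsD(2)[OF T this \<open>y \<in> H\<close>] show ?thesis by simp
qed

lemma bounded_ops_sums:
  assumes H: "complex_vector.subspace H" and T: "T \<in> bounded_ops H K"
    and X: "\<And>n. X n \<in> H" "X sums x" "x \<in> H"
  shows "(\<lambda>n. T (X n)) sums T x"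
proof -
  obtain B where B: "\<And>x. x \<in> H \<Longrightarrow> norm (T x) \<le> B * norm x"
    using bounded_opsD(4)[OF T] by auto
  have S: "(\<Sum>n<m. X n) \<in> H" for m using H X(1) by (intro complex_vector.subspace_sum) auto
  have TS: "T (\<Sum>n<m. X n) = (\<Sum>n<m. T (X n))" for m
  proof (induction m)
    case 0
    show ?case using bounded_opsD(3)[OF T, of 0 0] complex_vector.subspace_0[OF H] by simp
  next
    case (Suc m)
    then show ?case using bounded_opsD(2)[OF T S X(1)] by simp
  qed
  have "(\<lambda>m. T (\<Sum>n<m. X n) - T x) \<longlonglongrightarrow> 0"
  proof (rule Lim_null_comparison)
    show "\<forall>\<^sub>F m in sequentially. norm (T (\<Sum>n<m. X n) - T x) \<le> B * norm ((\<Sum>n<m. X n) - x)"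
      using B[OF complex_vector.subspace_diff[OF H S X(3)]] bounded_ops_diff[OF H T S X(3)] by simp
    have "(\<lambda>m. B * norm ((\<Sum>n<m. X n) - x)) \<longlonglongrightarrow> B * norm (x - x)"
      using X(2) by (intro tendsto_intros) (simp add: sums_def)
    then show "(\<lambda>m. B * norm ((\<Sum>n<m. X n) - x)) \<longlonglongrightarrow> 0" by simp
  qed
  then show ?thesis by (simp add: TS sums_def LIM_zero_iff)
qed

lemma summable_norm_mult:
  fixes f :: "nat \<Rightarrow> 'a::real_normed_vector" and g :: "nat \<Rightarrow> 'b::real_normed_vector"
  assumes "summable (\<lambda>n. (norm (f n))\<^sup>2)" "summable (\<lambda>n. (norm (g n))\<^sup>2)"
  shows "summable (\<lambda>n. norm (f n) * norm (g n))"
proof (rule summable_comparison_test'[OF summable_add[OF assms]])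
  fix n :: nat
  have "2 * (norm (f n) * norm (g n)) \<le> (norm (f n))\<^sup>2 + (norm (g n))\<^sup>2"
    using zero_le_power2[of "norm (f n) - norm (g n)"] by (simp add: power2_eq_square algebra_simps)
  moreover have "0 \<le> norm (f n) * norm (g n)" by simp
  ultimately show "norm (norm (f n) * norm (g n)) \<le> (norm (f n))\<^sup>2 + (norm (g n))\<^sup>2"
    unfolding real_norm_def abs_mult abs_norm_cancel by linarith
qed

text \<open>
  Given two representations of \<open>t\<close>, one finite orthonormal system can be chosen whose span contains
  the first \<open>N\<close> terms \<open>g n\<close> of both.  Both sums then differ from the same compressed trace of \<open>T \<circ> t\<close>
  by a tail of a convergent series.
\<close>

lemma trace_pairing_eq:
  fixes H :: "'a::complex_inner set" and K :: "'b::complex_inner set"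
  assumes H: "complex_vector.subspace H" and K: "complex_vector.subspace K"
    and T: "T \<in> bounded_ops H K" and t: "\<And>x. x \<in> K \<Longrightarrow> t x \<in> H" and rep: "nuclear_rep H K t f g"
  shows "trace_pairing H K T t = (\<Sum>n. cinner (T (f n)) (g n))"
proof -
  obtain B where B: "B \<ge> 0" "\<And>x. x \<in> H \<Longrightarrow> norm (T x) \<le> B * norm x"
    using bounded_opsD(4)[OF T] by auto
  have summ: "summable (\<lambda>n. norm (T (f n)) * norm (g n))" if "nuclear_rep H K t f g" for f g
  proof (rule summable_comparison_test')
    show "summable (\<lambda>n. B * (norm (f n) * norm (g n)))"
      using that by (intro summable_mult summable_norm_mult) (auto simp: nuclear_rep_def)
    show "norm (norm (T (f n)) * norm (g n)) \<le> B * (norm (f n) * norm (g n))" for n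
      using B(2)[of "f n"] that by (auto simp: nuclear_rep_def mult.assoc[symmetric] intro!: mult_right_mono)
  qed
  have sums: "(\<lambda>n. cinner e (g n) *\<^sub>C T (f n)) sums T (t e)"
    if r: "nuclear_rep H K t f g" and e: "e \<in> K" for f g e
  proof -
    have f: "\<And>n. f n \<in> H" "(\<lambda>n. cinner e (g n) *\<^sub>C f n) sums t e"
      using r e by (auto simp: nuclear_rep_def)
    have "(\<lambda>n. T (cinner e (g n) *\<^sub>C f n)) sums T (t e)"
      using f t[OF e] H by (intro bounded_ops_sums[OF H T] complex_vector.subspace_scale)
    then show ?thesis using bounded_opsD(3)[OF T] f(1) by simp
  qed
  have unique: "(\<Sum>n. cinner (T (f' n)) (g' n)) = (\<Sum>n. cinner (T (f n)) (g n))"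
    if rep': "nuclear_rep H K t f' g'" for f' g'
  proof (rule ccontr)
    let ?c = "\<Sum>n. cinner (T (f n)) (g n)" and ?c' = "\<Sum>n. cinner (T (f' n)) (g' n)"
    assume "?c' \<noteq> ?c"
    then have pos: "0 < norm (?c' - ?c) / 2" by simp
    obtain N1 where N1: "\<forall>n\<ge>N1. norm (\<Sum>i. norm (T (f (i + n))) * norm (g (i + n))) < norm (?c' - ?c) / 2"
      using suminf_exist_split[OF pos summ[OF rep]] by auto
    obtain N2 where N2: "\<forall>n\<ge>N2. norm (\<Sum>i. norm (T (f' (i + n))) * norm (g' (i + n))) < norm (?c' - ?c) / 2"
      using suminf_exist_split[OF pos summ[OF rep']] by auto
    define N where "N = max N1 N2"
    have "g ` {..<N} \<union> g' ` {..<N} \<subseteq> K"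
      using rep rep' by (auto simp: nuclear_rep_def)
    then obtain E where E: "finite E" "E \<subseteq> K" "orthonormal E"
      and G: "\<forall>x\<in>g ` {..<N} \<union> g' ` {..<N}. x = (\<Sum>e\<in>E. cinner x e *\<^sub>C e)"
      using gram_schmidt[OF K, of "g ` {..<N} \<union> g' ` {..<N}"] by auto
    define m where "m = (\<Sum>e\<in>E. cinner (T (t e)) e)"
    have "norm (?c - m) \<le> (\<Sum>i. norm (T (f (i + N))) * norm (g (i + N)))"
      unfolding m_def using G E sums[OF rep] summ[OF rep]
      by (intro trace_compression_error) auto
    also have "\<dots> < norm (?c' - ?c) / 2" using N1[rule_format, of N] by (simp add: N_def)
    finally have 1: "norm (?c - m) < norm (?c' - ?c) / 2" .
    have "norm (?c' - m) \<le> (\<Sum>i. norm (T (f' (i + N))) * norm (g' (i + N)))"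
      unfolding m_def using G E sums[OF rep'] summ[OF rep']
      by (intro trace_compression_error) auto
    also have "\<dots> < norm (?c' - ?c) / 2" using N2[rule_format, of N] by (simp add: N_def)
    finally have 2: "norm (?c' - m) < norm (?c' - ?c) / 2" .
    show False
      using norm_triangle_ineq4[of "?c' - m" "?c - m"] 1 2 by simp
  qed
  show ?thesis
    unfolding trace_pairing_def using rep unique by (intro the_equality) blast+
qed

text \<open>
  This is \<open>a \<otimes> b + c \<otimes> d\<close>.  With \<open>c = d = 0\<close> it also serves for operators of rank one.
\<close>

definition rank_two_op ::
  "'b set \<Rightarrow> 'a \<Rightarrow> 'b \<Rightarrow> 'a \<Rightarrow> 'b \<Rightarrow> 'b::complex_inner \<Rightarrow> 'a::complex_inner" where
  "rank_two_op K a b c d = (\<lambda>x\<in>K. cinner x b *\<^sub>C a + cinner x d *\<^sub>C c)"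

lemma rank_two_op:
  fixes H :: "'a::complex_inner set" and K :: "'b::complex_inner set"
  assumes H: "complex_vector.subspace H" and K: "complex_vector.subspace K"
    and mem: "a \<in> H" "b \<in> K" "c \<in> H" "d \<in> K"
  shows rank_two_op_in_trace_class: "rank_two_op K a b c d \<in> trace_class H K"
    and rank_two_op_rank_at_most_2: "rank_two_op K a b c d \<in> rank_at_most 2 H K"
    and trace_pairing_rank_two_op: "T \<in> bounded_ops H K \<Longrightarrow>
      trace_pairing H K T (rank_two_op K a b c d) = cinner (T a) b + cinner (T c) d"
proof -
  let ?t = "rank_two_op K a b c d"
  define f where "f n = (if n = 0 then a else if n = 1 then c else 0)" for n :: nat
  define g where "g n = (if n = 0 then b else if n = 1 then d else 0)" for n :: nat
  have fin: "u sums (u 0 + u 1)" if "\<And>n. n \<ge> 2 \<Longrightarrow> u n = 0"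
    for u :: "nat \<Rightarrow> 'z::{topological_comm_monoid_add, t2_space}"
    using sums_finite[of "{..<2}" u] that by (auto simp: numeral_2_eq_2 leI)
  have H0: "0 \<in> H" and K0: "0 \<in> K" using H K by (auto intro: complex_vector.subspace_0)
  have tH: "?t x \<in> H" if "x \<in> K" for x
    using that mem H by (auto simp: rank_two_op_def intro!: complex_vector.subspace_add
        complex_vector.subspace_scale)
  have rep: "nuclear_rep H K ?t f g"
    unfolding nuclear_rep_def
  proof (intro conjI allI ballI)
    show "f n \<in> H" "g n \<in> K" for n using mem H0 K0 by (auto simp: f_def g_def)
    show "summable (\<lambda>n. (norm (f n))\<^sup>2)" "summable (\<lambda>n. (norm (g n))\<^sup>2)"
      by (rule sums_summable[OF fin]; simp add: f_def g_def)+
    fix x assume "x \<in> K"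
    then show "(\<lambda>n. cinner x (g n) *\<^sub>C f n) sums ?t x"
      using fin[of "\<lambda>n. cinner x (g n) *\<^sub>C f n"] by (simp add: f_def g_def rank_two_op_def)
  qed
  have bd: "norm (?t x) \<le> (norm b * norm a + norm d * norm c) * norm x" if "x \<in> K" for x
  proof -
    have "norm (?t x) \<le> norm (cinner x b) * norm a + norm (cinner x d) * norm c"
      using that norm_triangle_ineq[of "cinner x b *\<^sub>C a" "cinner x d *\<^sub>C c"]
      by (simp add: rank_two_op_def norm_scaleC)
    also have "\<dots> \<le> (norm x * norm b) * norm a + (norm x * norm d) * norm c"
      by (intro add_mono mult_right_mono cinner_bound) auto
    finally show ?thesis by (simp add: algebra_simps)
  qed
  have "?t \<in> bounded_ops K H"
    unfolding bounded_ops_def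
  proof (intro CollectI conjI ballI allI)
    show "?t \<in> K \<rightarrow>\<^sub>E H" using tH by (auto simp: rank_two_op_def)
    show "?t (x + y) = ?t x + ?t y" if "x \<in> K" "y \<in> K" for x y
      using that complex_vector.subspace_add[OF K that]
      by (simp add: rank_two_op_def cinner_add_left scaleC_add_left)
    show "?t (r *\<^sub>C x) = r *\<^sub>C ?t x" if "x \<in> K" for r x
      using that complex_vector.subspace_scale[OF K that]
      by (simp add: rank_two_op_def cinner_scaleC_left scaleC_add_right scaleC_scaleC)
    show "\<exists>B. \<forall>x\<in>K. norm (?t x) \<le> B * norm x" using bd by blast
  qed
  then show tc: "?t \<in> trace_class H K" using rep by (auto simp: trace_class_def)
  have "?t ` K \<subseteq> complex_vector.span {a, c}"
  proof (rule image_subsetI)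
    fix x assume "x \<in> K"
    moreover have "cinner x b *\<^sub>C a + cinner x d *\<^sub>C c \<in> complex_vector.span {a, c}"
      by (intro complex_vector.span_add complex_vector.span_scale complex_vector.span_base) auto
    ultimately show "?t x \<in> complex_vector.span {a, c}" by (simp add: rank_two_op_def)
  qed
  moreover have "card {a, c} \<le> 2" by (simp add: card_insert_if)
  ultimately show "?t \<in> rank_at_most 2 H K"
    using tc by (auto simp: rank_at_most_def intro!: exI[of _ "{a, c}"])
  assume T: "T \<in> bounded_ops H K"
  have "(\<lambda>n. cinner (T (f n)) (g n)) sums (cinner (T a) b + cinner (T c) d)"
    using fin[of "\<lambda>n. cinner (T (f n)) (g n)"] by (simp add: f_def g_def)
  then show "trace_pairing H K T ?t = cinner (T a) b + cinner (T c) d"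
    using trace_pairing_eq[OF H K T tH rep] by (simp add: sums_iff)
qed

section \<open>Completeness of \<open>L\<^sup>2\<close> and uniqueness of Fourier coefficients\<close>

interpretation circle: prob_space circle_measure
  by (rule prob_space_circle_measure)

lemma sets_circle_measure [measurable_cong, simp]: "sets circle_measure = sets borel"
  by (simp add: circle_measure_def)

lemma space_circle_measure [simp]: "space circle_measure = UNIV"
  by (simp add: circle_measure_def)

lemma borel_measurable_cnj [measurable]: "cnj \<in> borel_measurable borel"
  by (intro borel_measurable_continuous_onI continuous_intros)

lemma borel_measurable_powi [measurable]: "(\<lambda>z::complex. z powi n) \<in> borel_measurable borel"
  by (cases "n \<ge> 0") (auto simp: power_int_def)

lemma fun_of_measurable [measurable]: "fun_of f \<in> borel_measurable borel"
  using square_integrable_fun_of[of f] by (simp add: square_integrable_def measurable_cong_sets[OF sets_circle_measure refl])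

lemma square_integrable_norm: "square_integrable f \<Longrightarrow> integrable circle_measure (\<lambda>z. (norm (f z))\<^sup>2)"
  by (simp add: square_integrable_def)

lemma L2_of_eq_iff:
  assumes "square_integrable f" "square_integrable g"
  shows "L2_of f = L2_of g \<longleftrightarrow> (AE z in circle_measure. f z = g z)"
  using Quotient_rel_abs[OF Quotient_circle_L2, of f g] assms Quotient_rel[OF Quotient_circle_L2, of f g]
  by (auto simp: L2_of_def circle_L2_rel_def)

lemma circle_L2_eqI: "(AE z in circle_measure. fun_of f z = fun_of g z) \<Longrightarrow> f = g"
  by (metis L2_of_eq_iff L2_of_fun_of square_integrable_fun_of)

lemma L2_of_add:
  "square_integrable f \<Longrightarrow> square_integrable g \<Longrightarrow> L2_of (\<lambda>z. f z + g z) = L2_of f + L2_of g"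
  by (simp add: L2_of_def square_integrable_add plus_circle_L2.abs_eq circle_L2_rel_def)

lemma L2_of_scale: "square_integrable f \<Longrightarrow> L2_of (\<lambda>z. c * f z) = c *\<^sub>C L2_of f"
  by (simp add: L2_of_def square_integrable_scale scaleC_circle_L2.abs_eq circle_L2_rel_def)

lemma AE_fun_of_add: "AE z in circle_measure. fun_of (f + g) z = fun_of f z + fun_of g z"
  using AE_fun_of_L2_of[OF square_integrable_add[OF square_integrable_fun_of[of f] square_integrable_fun_of[of g]]]
  by (simp add: L2_of_add square_integrable_fun_of L2_of_fun_of)

lemma AE_fun_of_scaleC: "AE z in circle_measure. fun_of (c *\<^sub>C f) z = c * fun_of f z"
  using AE_fun_of_L2_of[OF square_integrable_scale[OF square_integrable_fun_of[of f]], of c]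
  by (simp add: L2_of_scale square_integrable_fun_of L2_of_fun_of)

lemma AE_fun_of_diff: "AE z in circle_measure. fun_of (f - g) z = fun_of f z - fun_of g z"
  using AE_fun_of_add[of "f - g" g] by (auto elim: eventually_mono)

lemma AE_fun_of_zero: "AE z in circle_measure. fun_of 0 z = 0"
  using AE_fun_of_scaleC[of 0 0] by simp

lemma cinner_integral: "cinner f g = (\<integral>z. fun_of f z * cnj (fun_of g z) \<partial>circle_measure)"
  using cinner_circle_L2.abs_eq[of "fun_of f" "fun_of g"] L2_of_fun_of[of f] L2_of_fun_of[of g]
  by (simp add: L2_of_def square_integrable_fun_of circle_L2_rel_def)

lemma norm_circle_L2_integral: "(norm f)\<^sup>2 = (\<integral>z. (norm (fun_of f z))\<^sup>2 \<partial>circle_measure)"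
proof -
  have "complex_of_real ((norm f)\<^sup>2) = (\<integral>z. complex_of_real ((norm (fun_of f z))\<^sup>2) \<partial>circle_measure)"
    unfolding cinner_self[symmetric] cinner_integral complex_norm_square ..
  then show ?thesis by (simp only: integral_complex_of_real of_real_eq_iff)
qed

lemma integrable_fun_of: "integrable circle_measure (fun_of f)"
proof (rule Bochner_Integration.integrable_bound)
  show "integrable circle_measure (\<lambda>z. 1 + (norm (fun_of f z))\<^sup>2)"
    using square_integrable_norm[OF square_integrable_fun_of] by simp
  have "t \<le> 1 + t\<^sup>2" for t :: real
    using zero_le_power2[of "t - 1/2"] by (simp add: power2_eq_square algebra_simps)
  then show "AE z in circle_measure. norm (fun_of f z) \<le> norm (1 + (norm (fun_of f z))\<^sup>2)"
    by simp
qed simp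

lemma L1_norm_le_L2_norm: "(\<integral>z. norm (fun_of f z) \<partial>circle_measure) \<le> norm f"
proof -
  let ?m = "\<integral>z. norm (fun_of f z) \<partial>circle_measure"
  have int: "integrable circle_measure (\<lambda>z. norm (fun_of f z))"
    using integrable_fun_of by (rule integrable_norm)
  have "0 \<le> (\<integral>z. (norm (fun_of f z) - ?m)\<^sup>2 \<partial>circle_measure)" by simp
  also have "\<dots> = (\<integral>z. (norm (fun_of f z))\<^sup>2 - 2 * ?m * norm (fun_of f z) + ?m\<^sup>2 \<partial>circle_measure)"
    by (simp add: power2_diff algebra_simps)
  also have "\<dots> = (norm f)\<^sup>2 - ?m\<^sup>2"
    using int square_integrable_norm[OF square_integrable_fun_of]
    by (simp add: norm_circle_L2_integral circle.prob_space[simplified] power2_eq_square[of ?m])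
  finally have "?m\<^sup>2 \<le> (norm f)\<^sup>2" by simp
  then show ?thesis by (rule power2_le_imp_le) simp
qed

text \<open>
  An \<open>L\<^sup>2\<close>-Cauchy sequence is \<open>L\<^sup>1\<close>-Cauchy, so a subsequence converges almost everywhere; by Fatou's
  lemma its pointwise limit is also the limit in \<open>L\<^sup>2\<close>.
\<close>

instance circle_L2 :: complete_space
proof
  fix X :: "nat \<Rightarrow> circle_L2" assume X: "Cauchy X"
  have "\<exists>N. \<forall>i\<ge>N. \<forall>j\<ge>N. (\<integral>z. norm (fun_of (X i) z - fun_of (X j) z) \<partial>circle_measure) < e"
    if e: "e > 0" for e
  proof -
    obtain N where N: "\<forall>i\<ge>N. \<forall>j\<ge>N. norm (X i - X j) < e"
      using CauchyD[OF X e] by auto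
    have "(\<integral>z. norm (fun_of (X i) z - fun_of (X j) z) \<partial>circle_measure) \<le> norm (X i - X j)" for i j
    proof -
      have "(\<integral>z. norm (fun_of (X i) z - fun_of (X j) z) \<partial>circle_measure)
          = (\<integral>z. norm (fun_of (X i - X j) z) \<partial>circle_measure)"
        using AE_fun_of_diff[of "X i" "X j"] by (intro integral_cong_AE) auto
      then show ?thesis using L1_norm_le_L2_norm by simp
    qed
    then show ?thesis using N by (meson le_less_trans)
  qed
  then obtain r where r: "strict_mono r" "AE z in circle_measure. Cauchy (\<lambda>i. fun_of (X (r i)) z)"
    using cauchy_L1_AE_cauchy_subseq[of circle_measure "\<lambda>n. fun_of (X n)"] integrable_fun_of by blast
  define f where "f z = lim (\<lambda>i. fun_of (X (r i)) z)" for z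
  have [measurable]: "f \<in> borel_measurable borel"
    unfolding f_def by (rule borel_measurable_lim_metric) simp
  have lim: "AE z in circle_measure. (\<lambda>i. fun_of (X (r i)) z) \<longlonglongrightarrow> f z"
    using r(2) by eventually_elim (auto simp: f_def Cauchy_convergent convergent_LIMSEQ_iff[symmetric])
  have nn: "(\<integral>\<^sup>+z. ennreal ((norm (fun_of (X k) z - f z))\<^sup>2) \<partial>circle_measure) \<le> ennreal (e\<^sup>2)"
    if "e > 0" and k: "\<And>i. i \<ge> k \<Longrightarrow> norm (X k - X i) \<le> e" for k e
  proof -
    have "(\<integral>\<^sup>+z. ennreal ((norm (fun_of (X k) z - f z))\<^sup>2) \<partial>circle_measure)
        = (\<integral>\<^sup>+z. liminf (\<lambda>i. ennreal ((norm (fun_of (X k) z - fun_of (X (r i)) z))\<^sup>2)) \<partial>circle_measure)"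
    proof (rule nn_integral_cong_AE)
      show "AE z in circle_measure. ennreal ((norm (fun_of (X k) z - f z))\<^sup>2)
          = liminf (\<lambda>i. ennreal ((norm (fun_of (X k) z - fun_of (X (r i)) z))\<^sup>2))"
        using lim
      proof eventually_elim
        case (elim z)
        have "(\<lambda>i. ennreal ((norm (fun_of (X k) z - fun_of (X (r i)) z))\<^sup>2))
            \<longlonglongrightarrow> ennreal ((norm (fun_of (X k) z - f z))\<^sup>2)"
          by (intro tendsto_ennrealI tendsto_intros elim)
        then show ?case by (rule lim_imp_Liminf[OF sequentially_bot, symmetric])
      qed
    qed
    also have "\<dots> \<le> liminf (\<lambda>i. \<integral>\<^sup>+z. ennreal ((norm (fun_of (X k) z - fun_of (X (r i)) z))\<^sup>2) \<partial>circle_measure)"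
      by (rule nn_integral_liminf) simp
    also have "\<dots> \<le> ennreal (e\<^sup>2)"
    proof (rule Liminf_le)
      show "\<forall>\<^sub>F i in sequentially. (\<integral>\<^sup>+z. ennreal ((norm (fun_of (X k) z - fun_of (X (r i)) z))\<^sup>2) \<partial>circle_measure)
          \<le> ennreal (e\<^sup>2)"
      proof (rule eventually_sequentiallyI)
        fix i assume "k \<le> i"
        then have "k \<le> r i" using seq_suble[OF r(1), of i] by linarith
        have "(\<integral>\<^sup>+z. ennreal ((norm (fun_of (X k) z - fun_of (X (r i)) z))\<^sup>2) \<partial>circle_measure)
            = (\<integral>\<^sup>+z. ennreal ((norm (fun_of (X k - X (r i)) z))\<^sup>2) \<partial>circle_measure)"
          using AE_fun_of_diff[of "X k" "X (r i)"] by (intro nn_integral_cong_AE) (auto elim: eventually_mono)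
        also have "\<dots> = ennreal ((norm (X k - X (r i)))\<^sup>2)"
          unfolding norm_circle_L2_integral
          by (intro nn_integral_eq_integral square_integrable_norm square_integrable_fun_of) auto
        also have "\<dots> \<le> ennreal (e\<^sup>2)"
          using k[OF \<open>k \<le> r i\<close>] by (intro ennreal_leI power_mono) auto
        finally show "(\<integral>\<^sup>+z. ennreal ((norm (fun_of (X k) z - fun_of (X (r i)) z))\<^sup>2) \<partial>circle_measure)
          \<le> ennreal (e\<^sup>2)" .
      qed
    qed simp
    finally show ?thesis .
  qed
  have close: "square_integrable (\<lambda>z. fun_of (X k) z - f z)
      \<and> (\<integral>z. (norm (fun_of (X k) z - f z))\<^sup>2 \<partial>circle_measure) \<le> e\<^sup>2"
    if "e > 0" and k: "\<And>i. i \<ge> k \<Longrightarrow> norm (X k - X i) \<le> e" for k e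
  proof -
    have int: "integrable circle_measure (\<lambda>z. (norm (fun_of (X k) z - f z))\<^sup>2)"
      using le_less_trans[OF nn[OF that] ennreal_less_top]
      by (intro integrableI_bounded) auto
    then show ?thesis
      using nn[OF that] by (simp add: square_integrable_def nn_integral_eq_integral[OF int] ennreal_le_iff)
  qed
  have ex: "\<exists>k. \<forall>j\<ge>k. \<forall>i\<ge>j. norm (X j - X i) \<le> e" if "e > 0" for e
    using CauchyD[OF X that] by (meson less_imp_le order_trans)
  obtain k where k: "\<And>i. i \<ge> k \<Longrightarrow> norm (X k - X i) \<le> 1" using ex[of 1] by auto
  have "square_integrable f"
    using square_integrable_add[OF square_integrable_fun_of[of "X k"]
        square_integrable_scale[OF conjunct1[OF close[OF _ k]], of "-1"]] by simp
  have "X \<longlonglongrightarrow> L2_of f"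
  proof (rule LIMSEQ_I)
    fix e :: real assume "0 < e"
    then obtain k where k: "\<And>j i. j \<ge> k \<Longrightarrow> i \<ge> j \<Longrightarrow> norm (X j - X i) \<le> e / 2"
      using ex[of "e / 2"] by auto
    show "\<exists>n0. \<forall>n\<ge>n0. norm (X n - L2_of f) < e"
    proof (intro exI allI impI)
      fix n assume "k \<le> n"
      have "(norm (X n - L2_of f))\<^sup>2 = (\<integral>z. (norm (fun_of (X n) z - f z))\<^sup>2 \<partial>circle_measure)"
        unfolding norm_circle_L2_integral
        using AE_fun_of_diff[of "X n" "L2_of f"] AE_fun_of_L2_of[OF \<open>square_integrable f\<close>]
        by (intro integral_cong_AE) (auto elim: AE_mp)
      also have "\<dots> \<le> (e / 2)\<^sup>2" using close[of "e / 2" n] k[OF \<open>k \<le> n\<close>] \<open>0 < e\<close> by auto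
      finally have "norm (X n - L2_of f) \<le> e / 2"
        using \<open>0 < e\<close> power2_le_imp_le by fastforce
      then show "norm (X n - L2_of f) < e" using \<open>0 < e\<close> by simp
    qed
  qed
  then show "convergent X" by (auto simp: convergent_def)
qed

lemma integrable_mult_bounded:
  fixes f u :: "complex \<Rightarrow> complex"
  assumes f: "integrable circle_measure f" and [measurable]: "u \<in> borel_measurable borel"
    and u: "AE z in circle_measure. norm (u z) \<le> C"
  shows "integrable circle_measure (\<lambda>z. f z * u z)"
proof (rule Bochner_Integration.integrable_bound)
  show "integrable circle_measure (\<lambda>z. C * norm (f z))" using f by simp
  have [measurable]: "f \<in> borel_measurable borel"
    using borel_measurable_integrable[OF f] by (simp add: measurable_cong_sets[OF sets_circle_measure refl])
  show "(\<lambda>z. f z * u z) \<in> borel_measurable circle_measure" by simp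
  show "AE z in circle_measure. norm (f z * u z) \<le> norm (C * norm (f z))"
    using u
  proof eventually_elim
    case (elim z)
    then have "norm (f z) * norm (u z) \<le> norm (f z) * \<bar>C\<bar>" by (intro mult_left_mono) auto
    then show ?case by (simp add: norm_mult abs_mult mult.commute)
  qed
qed

text \<open>
  Multiplication by a trigonometric polynomial preserves the vanishing of all Fourier coefficients;
  the Weierstrass theorem carries the vanishing of the integral over to multiplication by
  continuous functions, and the functions \<open>(1 - n d)\<^sup>+\<close>, with \<open>d\<close> the distance to a closed set, carry
  it over to indicator functions.
\<close>

lemma integrable_fourier_unique:
  fixes f :: "complex \<Rightarrow> complex"
  assumes int: "integrable circle_measure f"
    and zero: "\<And>n. (\<integral>z. f z * z powi n \<partial>circle_measure) = 0"
  shows "AE z in circle_measure. f z = 0"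
proof -
  define Z where "Z f \<longleftrightarrow> integrable circle_measure f \<and> (\<forall>n. (\<integral>z. f z * z powi n \<partial>circle_measure) = 0)"
    for f :: "complex \<Rightarrow> complex"
  have powi_bd: "AE z in circle_measure. norm (z powi n) \<le> 1" for n
    using AE_circle_measure_norm by eventually_elim (simp add: norm_power_int)
  have int_powi: "integrable circle_measure (\<lambda>z. f z * z powi n)" if "integrable circle_measure f"
    for f :: "complex \<Rightarrow> complex" and n
    by (rule integrable_mult_bounded[OF that _ powi_bd]) simp
  have poly: "Z (\<lambda>z. f z * complex_of_real (p z))" if "real_polynomial_function p" "Z f" for p f
    using that
  proof (induction arbitrary: f rule: real_polynomial_function.induct)
    case (linear p)
    interpret p: bounded_linear p by (rule linear.hyps)
    \<comment> \<open>a real-linear \<open>p\<close> is \<open>z \<mapsto> a z + cnj a cnj z\<close>, and \<open>cnj z = inverse z\<close> on the circle\<close>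
    define a where "a = Complex (p 1 / 2) (- p \<i> / 2)"
    have eq: "complex_of_real (p z) = a * z powi 1 + cnj a * z powi (- 1)" if "norm z = 1" for z
    proof -
      have "p z = p (Re z *\<^sub>R 1 + Im z *\<^sub>R \<i>)"
        by (rule arg_cong[of _ _ p]) (simp add: complex_eq_iff)
      also have "\<dots> = Re z * p 1 + Im z * p \<i>" by (simp only: p.add p.scaleR real_scaleR_def)
      finally have "p z = Re z * p 1 + Im z * p \<i>" .
      moreover have "z powi (- 1) = cnj z"
        using that by (simp add: power_int_minus inverse_complex_def complex_eq_iff cmod_def)
      ultimately show ?thesis by (simp add: a_def complex_eq_iff)
    qed
    have f: "integrable circle_measure f" using linear.prems by (simp add: Z_def)
    have AE: "AE z in circle_measure. f z * complex_of_real (p z) * z powi n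
        = a * (f z * z powi (n + 1)) + cnj a * (f z * z powi (n - 1))" for n
      using AE_circle_measure_norm
    proof eventually_elim
      case (elim z)
      then have "z \<noteq> 0" by auto
      then have "z powi (n + 1) = z powi n * z" "z powi (n - 1) = z powi n * z powi (- 1)"
        using power_int_add[of z n 1] power_int_add[of z n "- 1"] by simp_all
      then show ?case by (simp only: eq[OF elim]) (simp add: algebra_simps)
    qed
    have [measurable]: "p \<in> borel_measurable borel"
      by (intro borel_measurable_continuous_onI linear_continuous_on linear.hyps)
    have [measurable]: "f \<in> borel_measurable borel"
      using borel_measurable_integrable[OF f] by (simp add: measurable_cong_sets[OF sets_circle_measure refl])
    have rhs: "integrable circle_measure (\<lambda>z. a * (f z * z powi (n + 1)) + cnj a * (f z * z powi (n - 1)))" for n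
      by (intro Bochner_Integration.integrable_add integrable_mult_right int_powi f)
    have "integrable circle_measure (\<lambda>z. f z * complex_of_real (p z) * z powi n)" for n
      using rhs[of n] AE[of n] by (subst integrable_cong_AE) auto
    from this[of 0] have "integrable circle_measure (\<lambda>z. f z * complex_of_real (p z))" by simp
    moreover have "(\<integral>z. f z * complex_of_real (p z) * z powi n \<partial>circle_measure) = 0" for n
    proof -
      have "(\<integral>z. f z * complex_of_real (p z) * z powi n \<partial>circle_measure)
          = (\<integral>z. a * (f z * z powi (n + 1)) + cnj a * (f z * z powi (n - 1)) \<partial>circle_measure)"
        using AE by (intro integral_cong_AE) auto
      also have "\<dots> = 0"
        using linear.prems int_powi[OF f] by (simp add: Z_def)
      finally show ?thesis .
    qed
    ultimately show ?case by (simp add: Z_def)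
  next
    case (const c)
    then show ?case by (simp add: Z_def mult.assoc mult.left_commute[of _ "complex_of_real c"])
  next
    case (add p q)
    have "Z (\<lambda>z. f z * complex_of_real (p z))" "Z (\<lambda>z. f z * complex_of_real (q z))"
      using add by blast+
    then show ?case using int_powi by (simp add: Z_def distrib_left distrib_right)
  next
    case (mult p q)
    then have "Z (\<lambda>z. f z * complex_of_real (p z) * complex_of_real (q z))" by blast
    then show ?case by (simp add: mult.assoc)
  qed
  have Zf: "Z f" using int zero by (simp add: Z_def)
  have [measurable]: "f \<in> borel_measurable borel"
    using borel_measurable_integrable[OF int] by (simp add: measurable_cong_sets[OF sets_circle_measure refl])
  have cont: "(\<integral>z. f z * complex_of_real (g z) \<partial>circle_measure) = 0"
    if g: "continuous_on UNIV g" and g_bd: "\<And>z. \<bar>g z\<bar> \<le> 1" for g :: "complex \<Rightarrow> real"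
  proof -
    have gm [measurable]: "g \<in> borel_measurable borel" by (intro borel_measurable_continuous_onI g)
    have int_g: "integrable circle_measure (\<lambda>z. f z * complex_of_real (g z))"
      by (rule integrable_mult_bounded[OF int, where C = 1]) (use g_bd in auto)
    have le: "norm (\<integral>z. f z * complex_of_real (g z) \<partial>circle_measure)
        \<le> e * (\<integral>z. norm (f z) \<partial>circle_measure)" if e: "e > 0" for e
    proof -
      obtain p where p: "real_polynomial_function p" "\<And>z. z \<in> sphere 0 1 \<Longrightarrow> \<bar>g z - p z\<bar> < e"
        using Stone_Weierstrass_real_polynomial_function[OF compact_sphere continuous_on_subset[OF g subset_UNIV] e]
        by blast
      have Zp: "Z (\<lambda>z. f z * complex_of_real (p z))" by (rule poly[OF p(1) Zf])
      then have int_p: "integrable circle_measure (\<lambda>z. f z * complex_of_real (p z))"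
        by (simp add: Z_def)
      have "(\<integral>z. f z * complex_of_real (p z) * z powi 0 \<partial>circle_measure) = 0"
        using Zp unfolding Z_def by blast
      then have zero_p: "(\<integral>z. f z * complex_of_real (p z) \<partial>circle_measure) = 0" by simp
      have "(\<integral>z. f z * complex_of_real (g z) \<partial>circle_measure)
          = (\<integral>z. f z * complex_of_real (g z) - f z * complex_of_real (p z) \<partial>circle_measure)"
        using int_g int_p zero_p by simp
      also have "norm \<dots> \<le> (\<integral>z. norm (f z * complex_of_real (g z) - f z * complex_of_real (p z)) \<partial>circle_measure)"
        by (rule integral_norm_bound)
      also have "\<dots> \<le> (\<integral>z. e * norm (f z) \<partial>circle_measure)"
      proof (rule integral_mono_AE)
        show "AE z in circle_measure. norm (f z * complex_of_real (g z) - f z * complex_of_real (p z)) \<le> e * norm (f z)"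
          using AE_circle_measure_norm
        proof eventually_elim
          case (elim z)
          then have "norm (complex_of_real (g z) - complex_of_real (p z)) \<le> e"
            using p(2)[of z] by (simp flip: of_real_diff)
          then have "norm (f z) * norm (complex_of_real (g z) - complex_of_real (p z)) \<le> norm (f z) * e"
            by (rule mult_left_mono) simp
          then show ?case by (simp add: mult.commute norm_mult flip: right_diff_distrib)
        qed
      qed (use int int_g int_p in auto)
      finally show ?thesis by simp
    qed
    have "norm (\<integral>z. f z * complex_of_real (g z) \<partial>circle_measure) \<le> 0"
    proof (rule field_le_epsilon)
      fix e :: real assume "e > 0"
      define I where "I = (\<integral>z. norm (f z) \<partial>circle_measure)"
      have I: "I \<ge> 0" by (simp add: I_def)
      have "norm (\<integral>z. f z * complex_of_real (g z) \<partial>circle_measure) \<le> e / (I + 1) * I"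
        unfolding I_def using I \<open>e > 0\<close> by (intro le) (simp add: I_def divide_pos_pos add_nonneg_pos)
      also have "\<dots> \<le> e" using I \<open>e > 0\<close> by (simp add: field_simps)
      finally show "norm (\<integral>z. f z * complex_of_real (g z) \<partial>circle_measure) \<le> 0 + e" by simp
    qed
    then show ?thesis by simp
  qed
  have closed: "set_lebesgue_integral circle_measure A f = 0" if "closed A" "A \<noteq> {}" for A
  proof -
    define g where "g n z = max 0 (1 - real n * infdist z A)" for n z
    have "(\<lambda>n. \<integral>z. f z * complex_of_real (g n z) \<partial>circle_measure)
        \<longlonglongrightarrow> (\<integral>z. f z * complex_of_real (indicator A z) \<partial>circle_measure)"
    proof (rule integral_dominated_convergence[where w = "\<lambda>z. norm (f z)"])
      have gc: "continuous_on UNIV (g n)" for n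
        unfolding g_def by (intro continuous_intros)
      then have [measurable]: "g n \<in> borel_measurable borel" for n
        by (intro borel_measurable_continuous_onI)
      show "(\<lambda>z. f z * complex_of_real (g n z)) \<in> borel_measurable circle_measure" for n
        by simp
      have [measurable]: "A \<in> sets borel" using that by simp
      show "(\<lambda>z. f z * complex_of_real (indicator A z)) \<in> borel_measurable circle_measure"
        by simp
      show "integrable circle_measure (\<lambda>z. norm (f z))" using int by simp
      show "AE z in circle_measure. (\<lambda>n. f z * complex_of_real (g n z)) \<longlonglongrightarrow> f z * complex_of_real (indicator A z)"
      proof (intro AE_I2 tendsto_mult tendsto_const tendsto_of_real)
        fix z
        show "(\<lambda>n. g n z) \<longlonglongrightarrow> indicator A z"
        proof (cases "z \<in> A")
          case True
          then show ?thesis by (simp add: g_def)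
        next
          case False
          then have pos: "infdist z A > 0" using that by (simp add: infdist_pos_not_in_closed)
          have "\<forall>\<^sub>F n in sequentially. g n z = indicator A z"
          proof (rule eventually_sequentiallyI)
            fix n assume "n \<ge> nat \<lceil>1 / infdist z A\<rceil>"
            then have "real n \<ge> 1 / infdist z A" by linarith
            then have "real n * infdist z A \<ge> 1" using pos by (simp add: field_simps)
            then show "g n z = indicator A z" using False by (simp add: g_def)
          qed
          then show ?thesis by (rule tendsto_eventually)
        qed
      qed
      show "AE z in circle_measure. norm (f z * complex_of_real (g n z)) \<le> norm (f z)" for n
        by (intro AE_I2) (auto simp: norm_mult g_def infdist_nonneg intro!: mult_left_le)
    qed
    moreover have "(\<integral>z. f z * complex_of_real (g n z) \<partial>circle_measure) = 0" for n
    proof (rule cont)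
      show "continuous_on UNIV (g n)" unfolding g_def by (intro continuous_intros)
      show "\<bar>g n z\<bar> \<le> 1" for z by (auto simp: g_def infdist_nonneg)
    qed
    ultimately have "(\<integral>z. f z * complex_of_real (indicator A z) \<partial>circle_measure) = 0"
      by (simp add: LIMSEQ_const_iff)
    then show ?thesis
      by (simp add: set_lebesgue_integral_def scaleR_conv_of_real mult.commute)
  qed
  have set_int: "set_integrable circle_measure A f" if "A \<in> sets borel" for A
    unfolding set_integrable_def using that int by (intro integrable_mult_indicator) auto
  have UNIV0: "set_lebesgue_integral circle_measure UNIV f = 0"
    by (rule closed) auto
  have stable: "Int_stable (Collect closed :: complex set set)" by (auto simp: Int_stable_def)
  have closed_Pow: "(Collect closed :: complex set set) \<subseteq> Pow UNIV" by simp
  have all: "set_lebesgue_integral circle_measure A f = 0" if "A \<in> sigma_sets UNIV (Collect closed)" for A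
    using stable closed_Pow that
  proof (induction rule: sigma_sets_induct_disjoint)
    case (basic A)
    then show ?case using closed[of A] by (cases "A = {}") (auto simp: set_lebesgue_integral_def)
  next
    case (compl A)
    then have A: "A \<in> sets borel" by (simp add: borel_eq_closed sets_measure_of)
    have "set_lebesgue_integral circle_measure UNIV f
        = set_lebesgue_integral circle_measure A f + set_lebesgue_integral circle_measure (UNIV - A) f"
      using set_integral_Un[of A "UNIV - A" circle_measure f] set_int[OF A] set_int[of "UNIV - A"] A by simp
    then show ?case using UNIV0 compl by simp
  next
    case (union A)
    then have A: "\<And>i. A i \<in> sets borel" by (auto simp: borel_eq_closed sets_measure_of)
    have "set_lebesgue_integral circle_measure (\<Union>i. A i) f = (\<Sum>i. set_lebesgue_integral circle_measure (A i) f)"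
      using union A by (intro lebesgue_integral_countable_add set_int) (auto simp: disjoint_family_on_def)
    then show ?case using union by simp
  qed (simp add: set_lebesgue_integral_def)
  have "set_lebesgue_integral circle_measure A f = 0" if "A \<in> sets circle_measure" for A
    using all[of A] that by (simp add: borel_eq_closed sets_measure_of)
  then show ?thesis by (rule circle.density_zero[OF int])
qed

section \<open>Fourier series\<close>

lemma square_integrable_bounded:
  assumes [measurable]: "f \<in> borel_measurable borel" and "AE z in circle_measure. norm (f z) \<le> C"
  shows "square_integrable f"
proof -
  have "integrable circle_measure (\<lambda>z. (norm (f z))\<^sup>2)"
  proof (rule circle.integrable_const_bound[where B = "C\<^sup>2"])
    show "AE z in circle_measure. norm ((norm (f z))\<^sup>2) \<le> C\<^sup>2"
      using assms(2) by eventually_elim (simp add: power_mono)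
  qed simp
  then show ?thesis by (simp add: square_integrable_def)
qed

definition zpow :: "int \<Rightarrow> circle_L2" where
  "zpow n = L2_of (\<lambda>z. z powi n)"

lemma AE_norm_powi: "AE z in circle_measure. norm (z powi n) = 1"
  using AE_circle_measure_norm by eventually_elim (simp add: norm_power_int)

lemma AE_fun_of_zpow: "AE z in circle_measure. fun_of (zpow n) z = z powi n"
  unfolding zpow_def using AE_norm_powi[of n]
  by (intro AE_fun_of_L2_of square_integrable_bounded[where C = 1]) (auto elim: eventually_mono)

lemma cnj_powi:
  assumes "norm z = 1"
  shows "cnj z powi n = z powi (- n)"
proof -
  have "cnj z = inverse z" using assms
    by (simp add: inverse_complex_def complex_eq_iff cmod_def)
  then show ?thesis by (simp add: power_int_inverse power_int_minus)
qed

lemma fourier_coeff_eq_cinner: "fourier_coeff f n = cinner f (zpow n)"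
  unfolding fourier_coeff_def cinner_integral
proof (rule integral_cong_AE)
  show "AE z in circle_measure. fun_of f z * z powi (- n) = fun_of f z * cnj (fun_of (zpow n) z)"
    using AE_fun_of_zpow[of n] AE_circle_measure_norm by eventually_elim (simp add: cnj_powi)
qed simp_all

text \<open>
  For \<open>n \<noteq> 0\<close> the integrand on the parameter interval has the \<open>2 \<pi>\<close>-periodic primitive
  \<open>cis (n t) / (\<i> n)\<close>.
\<close>

lemma integral_powi: "(\<integral>z. z powi n \<partial>circle_measure) = (if n = 0 then 1 else 0)"
proof (cases "n = 0")
  case True
  then show ?thesis using circle.prob_space by simp
next
  case False
  have [measurable]: "(\<lambda>t. cis (of_int n * t)) \<in> borel_measurable borel"
    by (intro borel_measurable_continuous_onI continuous_intros)
  define F where "F t = cis (of_int n * t) / (\<i> * of_int n)" for t :: real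
  have "(\<integral>z. z powi n \<partial>circle_measure) = (\<integral>t. cis t powi n \<partial>uniform_measure lborel {0..<2 * pi})"
    unfolding circle_measure_def
    by (rule integral_distr)
      (auto simp: measurable_cong_sets[OF sets_uniform_measure refl]
        intro!: borel_measurable_continuous_onI continuous_intros)
  also have "uniform_measure lborel {0..<2 * pi}
      = density lborel (\<lambda>t. ennreal (indicator {0..<2 * pi} t / (2 * pi)))"
    unfolding uniform_measure_def
    by (intro arg_cong[of _ _ "density lborel"] ext)
      (auto simp: indicator_def divide_ennreal[symmetric] simp flip: ennreal_1)
  also have "(\<integral>t. cis t powi n \<partial>\<dots>)
      = (\<integral>t. (indicator {0..<2 * pi} t / (2 * pi)) *\<^sub>R cis t powi n \<partial>lborel)"
    by (rule integral_density)
      (auto simp: cis_power_int intro!: borel_measurable_continuous_onI continuous_intros)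
  also have "\<dots> = (\<integral>t. (1 / (2 * pi)) *\<^sub>R (indicator {0..2 * pi} t *\<^sub>R cis (of_int n * t)) \<partial>lborel)"
  proof (rule integral_cong_AE)
    have "AE t in lborel. t \<noteq> 2 * pi" by (rule AE_lborel_singleton)
    then show "AE t in lborel. (indicator {0..<2 * pi} t / (2 * pi)) *\<^sub>R cis t powi n
        = (1 / (2 * pi)) *\<^sub>R (indicator {0..2 * pi} t *\<^sub>R cis (of_int n * t))"
      by eventually_elim (auto simp: cis_power_int indicator_def)
  qed (simp_all add: cis_power_int)
  also have "\<dots> = (1 / (2 * pi)) *\<^sub>R (\<integral>t. indicator {0..2 * pi} t *\<^sub>R cis (of_int n * t) \<partial>lborel)"
    by (rule integral_scaleR_right)
  also have "(\<integral>t. indicator {0..2 * pi} t *\<^sub>R cis (of_int n * t) \<partial>lborel) = F (2 * pi) - F 0"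
  proof (rule integral_FTC_atLeastAtMost)
    show "(F has_vector_derivative cis (of_int n * t)) (at t within {0..2 * pi})" for t
      unfolding F_def has_vector_derivative_def using False
      by (auto intro!: derivative_eq_intros simp: fun_eq_iff scaleR_conv_of_real mult.left_commute[of _ \<i>])
  qed (auto intro!: continuous_intros)
  also have "F (2 * pi) - F 0 = 0"
  proof -
    have "cis (of_int n * (2 * pi)) = 1"
      by (simp only: cis_power_int[symmetric] cis_2pi power_int_1_left)
    then show ?thesis by (simp add: F_def)
  qed
  finally show ?thesis using False by simp
qed

lemma cinner_zpow: "cinner (zpow m) (zpow n) = (if m = n then 1 else 0)"
proof -
  have "cinner (zpow m) (zpow n) = (\<integral>z. z powi (m - n) \<partial>circle_measure)"
    unfolding cinner_integral
  proof (rule integral_cong_AE)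
    show "AE z in circle_measure. fun_of (zpow m) z * cnj (fun_of (zpow n) z) = z powi (m - n)"
      using AE_fun_of_zpow[of n] AE_fun_of_zpow[of m] AE_circle_measure_norm
    proof eventually_elim
      case (elim z)
      then have "z \<noteq> 0" by auto
      then show ?case using elim power_int_add[of z m "- n"] by (simp add: cnj_powi)
    qed
  qed simp_all
  then show ?thesis by (simp add: integral_powi)
qed

lemma norm_zpow [simp]: "norm (zpow n) = 1"
proof -
  have "complex_of_real ((norm (zpow n))\<^sup>2) = 1"
    using cinner_zpow[of n n] by (simp add: cinner_self)
  then have "(norm (zpow n))\<^sup>2 = 1" by (simp only: of_real_eq_1_iff)
  then show ?thesis by (simp add: power2_eq_1_iff) (metis norm_ge_zero not_one_le_zero neg_0_le_iff_le)
qed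

lemma fourier_coeff_unique:
  assumes "\<And>n. fourier_coeff f n = fourier_coeff g n"
  shows "f = g"
proof (rule circle_L2_eqI)
  have "AE z in circle_measure. fun_of (f - g) z = 0"
  proof (rule integrable_fourier_unique[OF integrable_fun_of])
    fix n
    have "(\<integral>z. fun_of (f - g) z * z powi n \<partial>circle_measure) = fourier_coeff (f - g) (- n)"
      by (simp add: fourier_coeff_def)
    also have "\<dots> = 0"
      using assms[of "- n"] by (simp add: fourier_coeff_eq_cinner cinner_diff_left)
    finally show "(\<integral>z. fun_of (f - g) z * z powi n \<partial>circle_measure) = 0" .
  qed
  then show "AE z in circle_measure. fun_of f z = fun_of g z"
    using AE_fun_of_diff[of f g] by eventually_elim simp
qed

definition taylor_poly :: "circle_L2 \<Rightarrow> nat \<Rightarrow> circle_L2" where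
  "taylor_poly h n = (\<Sum>m<n. fourier_coeff h (int m) *\<^sub>C zpow (int m))"

lemma hardy_space_iff: "h \<in> hardy_space \<longleftrightarrow> (\<forall>n<0. cinner h (zpow n) = 0)"
  by (simp add: hardy_space_def fourier_coeff_eq_cinner)

lemma fourier_coeff_taylor_poly:
  "fourier_coeff (taylor_poly h n) k = (if 0 \<le> k \<and> k < int n then fourier_coeff h k else 0)"
proof -
  have "fourier_coeff (taylor_poly h n) k
      = cinner (\<Sum>m<n. fourier_coeff h (int m) *\<^sub>C zpow (int m)) (zpow k)"
    by (simp add: fourier_coeff_eq_cinner taylor_poly_def)
  also have "\<dots> = (\<Sum>m<n. if m = nat k \<and> 0 \<le> k then fourier_coeff h k else 0)"
    unfolding cinner.sum_left
    by (intro sum.cong) (auto simp: cinner_scaleC_left cinner_zpow)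
  also have "\<dots> = (if 0 \<le> k \<and> k < int n then fourier_coeff h k else 0)"
    by (cases "0 \<le> k") (auto simp: nat_less_iff)
  finally show ?thesis .
qed

text \<open>
  By Bessel's inequality the partial sums form a Cauchy sequence, and its limit has the same Fourier
  coefficients as \<open>h\<close>.
\<close>

lemma taylor_poly_LIMSEQ:
  assumes h: "h \<in> hardy_space"
  shows "taylor_poly h \<longlonglongrightarrow> h"
proof -
  define c where "c m = fourier_coeff h (int m)" for m
  define S where "S = taylor_poly h"
  have S_def': "S n = (\<Sum>m<n. c m *\<^sub>C zpow (int m))" for n
    by (simp add: S_def taylor_poly_def c_def)
  have block: "(norm (\<Sum>m\<in>A. c m *\<^sub>C zpow (int m)))\<^sup>2 = (\<Sum>m\<in>A. (norm (c m))\<^sup>2)" if "finite A" for A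
  proof -
    have "complex_of_real ((norm (\<Sum>m\<in>A. c m *\<^sub>C zpow (int m)))\<^sup>2)
        = (\<Sum>m\<in>A. \<Sum>k\<in>A. if k = m then c m * cnj (c m) else 0)"
      unfolding cinner_self[symmetric] cinner.sum_left cinner.sum_right
      by (intro sum.cong) (auto simp: cinner_scaleC_left cinner_scaleC_right cinner_zpow)
    also have "\<dots> = complex_of_real (\<Sum>m\<in>A. (norm (c m))\<^sup>2)"
      using that by (simp add: sum.delta flip: complex_norm_square)
    finally show ?thesis by (simp only: of_real_eq_iff)
  qed
  have bessel: "(\<Sum>m<n. (norm (c m))\<^sup>2) \<le> (norm h)\<^sup>2" for n
  proof -
    have "cinner h (S n) = (\<Sum>m<n. c m * cnj (c m))"
      unfolding S_def' cinner.sum_right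
      by (intro sum.cong) (auto simp: cinner_scaleC_right c_def fourier_coeff_eq_cinner)
    then have "cinner h (S n) = complex_of_real ((norm (S n))\<^sup>2)"
      using block[of "{..<n}"] by (simp add: S_def' flip: complex_norm_square)
    then have "inner h (S n) = (norm (S n))\<^sup>2" by (simp add: inner_cinner)
    moreover have "0 \<le> (norm (h - S n))\<^sup>2" by simp
    moreover have "(norm (h - S n))\<^sup>2 = (norm h)\<^sup>2 - 2 * inner h (S n) + (norm (S n))\<^sup>2"
      by (simp add: power2_norm_eq_inner algebra_simps inner_commute)
    ultimately have "(norm (S n))\<^sup>2 \<le> (norm h)\<^sup>2" by simp
    then show ?thesis using block[of "{..<n}"] by (simp add: S_def')
  qed
  have summ: "summable (\<lambda>m. (norm (c m))\<^sup>2)"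
    by (rule summableI_nonneg_bounded[OF _ bessel]) simp
  have "Cauchy S"
  proof (rule CauchyI')
    fix e :: real assume "0 < e"
    obtain N where N: "\<And>m n. m \<ge> N \<Longrightarrow> norm (\<Sum>k = m..<n. (norm (c k))\<^sup>2) < e\<^sup>2"
      using summable_Cauchy[THEN iffD1, OF summ, rule_format, of "e\<^sup>2"] \<open>0 < e\<close> by auto
    show "\<exists>M. \<forall>m\<ge>M. \<forall>n>m. dist (S m) (S n) < e"
    proof (intro exI allI impI)
      fix m n assume "N \<le> m" "m < n"
      have "S n - S m = (\<Sum>k = m..<n. c k *\<^sub>C zpow (int k))"
        unfolding S_def' using \<open>m < n\<close>
        by (simp add: sum_diff_nat_ivl[of 0 m n, symmetric] lessThan_atLeast0)
      then have "(norm (S m - S n))\<^sup>2 = (\<Sum>k = m..<n. (norm (c k))\<^sup>2)"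
        using block[of "{m..<n}"] by (subst norm_minus_commute) simp
      also have "\<dots> < e\<^sup>2" using N[OF \<open>N \<le> m\<close>, of n] by simp
      finally show "dist (S m) (S n) < e"
        using \<open>0 < e\<close> by (simp add: dist_norm power2_less_imp_less)
    qed
  qed
  then obtain s where s: "S \<longlonglongrightarrow> s" using Cauchy_convergent convergent_def by blast
  have "fourier_coeff s k = fourier_coeff h k" for k
  proof -
    have lim: "(\<lambda>n. fourier_coeff (S n) k) \<longlonglongrightarrow> fourier_coeff s k"
      unfolding fourier_coeff_eq_cinner by (intro cinner.tendsto s tendsto_const)
    have "\<forall>\<^sub>F n in sequentially. fourier_coeff (S n) k = fourier_coeff h k"
    proof (rule eventually_sequentiallyI)
      fix n assume "nat (k + 1) \<le> n"
      then show "fourier_coeff (S n) k = fourier_coeff h k"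
        using h by (auto simp: S_def fourier_coeff_taylor_poly hardy_space_def)
    qed
    then have "(\<lambda>n. fourier_coeff (S n) k) \<longlonglongrightarrow> fourier_coeff h k" by (rule tendsto_eventually)
    then show ?thesis using lim LIMSEQ_unique by blast
  qed
  then have "s = h" by (rule fourier_coeff_unique)
  then show ?thesis using s by (simp add: S_def)
qed

lemma parseval_hardy:
  assumes "h \<in> hardy_space"
  shows "(\<lambda>m. fourier_coeff h (int m) * cinner (zpow (int m)) g) sums cinner h g"
proof -
  have "(\<lambda>n. cinner (taylor_poly h n) g) \<longlonglongrightarrow> cinner h g"
    by (intro cinner.tendsto taylor_poly_LIMSEQ assms tendsto_const)
  then show ?thesis
    by (simp add: sums_def taylor_poly_def cinner.sum_left cinner_scaleC_left)
qed


section \<open>Multiplication operators\<close>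

abbreviation bdd :: "circle_L2 \<Rightarrow> bool" where
  "bdd f \<equiv> f \<in> essentially_bounded"

lemma square_integrable_mult_bdd:
  assumes "bdd f"
  shows "square_integrable (\<lambda>z. fun_of g z * fun_of f z)"
proof -
  obtain C where C: "AE z in circle_measure. norm (fun_of f z) \<le> C"
    using assms by (auto simp: essentially_bounded_def)
  have "integrable circle_measure (\<lambda>z. (norm (fun_of g z * fun_of f z))\<^sup>2)"
  proof (rule Bochner_Integration.integrable_bound)
    show "integrable circle_measure (\<lambda>z. C\<^sup>2 * (norm (fun_of g z))\<^sup>2)"
      using square_integrable_norm[OF square_integrable_fun_of] by simp
    show "AE z in circle_measure. norm ((norm (fun_of g z * fun_of f z))\<^sup>2)
        \<le> norm (C\<^sup>2 * (norm (fun_of g z))\<^sup>2)"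
      using C
    proof eventually_elim
      case (elim z)
      then have "(norm (fun_of f z))\<^sup>2 \<le> C\<^sup>2" by (simp add: power_mono)
      then show ?case by (simp add: norm_mult power_mult_distrib mult.commute mult_right_mono)
    qed
  qed simp
  then show ?thesis by (simp add: square_integrable_def)
qed

lemma AE_fun_of_mult: "bdd f \<Longrightarrow> AE z in circle_measure. fun_of (L2_mult g f) z = fun_of g z * fun_of f z"
  unfolding L2_mult_def by (rule AE_fun_of_L2_of[OF square_integrable_mult_bdd])

lemma L2_mult_commute: "L2_mult f g = L2_mult g f"
  by (simp add: L2_mult_def mult.commute)

lemma AE_fun_of_mult': "bdd g \<Longrightarrow> AE z in circle_measure. fun_of (L2_mult g f) z = fun_of g z * fun_of f z"
  using AE_fun_of_mult[of g f] by (simp add: L2_mult_commute mult.commute)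

lemma bddI: "(AE z in circle_measure. norm (fun_of f z) \<le> C) \<Longrightarrow> bdd f"
  by (auto simp: essentially_bounded_def)

lemma bdd_zpow [simp]: "bdd (zpow n)"
  by (rule bddI[of _ 1]) (use AE_fun_of_zpow[of n] AE_norm_powi[of n] in eventually_elim, simp)

lemma bdd_inner: "inner_function \<theta> \<Longrightarrow> bdd \<theta>"
  by (rule bddI[of _ 1]) (auto simp: inner_function_def elim: eventually_mono)

lemma bdd_scaleC: assumes "bdd f" shows "bdd (c *\<^sub>C f)"
proof -
  obtain C where C: "AE z in circle_measure. norm (fun_of f z) \<le> C"
    using assms by (auto simp: essentially_bounded_def)
  have "AE z in circle_measure. norm (fun_of (c *\<^sub>C f) z) \<le> norm c * C"
    using C AE_fun_of_scaleC[of c f] by eventually_elim (simp add: norm_mult mult_left_mono)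
  then show ?thesis by (rule bddI)
qed

lemma bdd_add: assumes "bdd f" "bdd g" shows "bdd (f + g)"
proof -
  obtain C D where C: "AE z in circle_measure. norm (fun_of f z) \<le> C"
    and D: "AE z in circle_measure. norm (fun_of g z) \<le> D"
    using assms by (auto simp: essentially_bounded_def)
  have "AE z in circle_measure. norm (fun_of (f + g) z) \<le> C + D"
    using C D AE_fun_of_add[of f g] by eventually_elim (simp add: norm_triangle_mono)
  then show ?thesis by (rule bddI)
qed

lemma bdd_diff: "bdd f \<Longrightarrow> bdd g \<Longrightarrow> bdd (f - g)"
  using bdd_add[of f "(- 1) *\<^sub>C g"] bdd_scaleC[of g "- 1"] by (simp add: scaleC_minus1_left)

lemma bdd_zero [simp]: "bdd 0"
  using bdd_scaleC[of "zpow 0" 0] by simp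

lemma bdd_sum: "(\<And>i. i \<in> A \<Longrightarrow> bdd (f i)) \<Longrightarrow> bdd (\<Sum>i\<in>A. f i)"
  by (induction A rule: infinite_finite_induct) (auto intro: bdd_add)

lemma bdd_mult: assumes "bdd f" "bdd g" shows "bdd (L2_mult f g)"
proof -
  obtain C D where C: "AE z in circle_measure. norm (fun_of f z) \<le> C"
    and D: "AE z in circle_measure. norm (fun_of g z) \<le> D"
    using assms by (auto simp: essentially_bounded_def)
  have "AE z in circle_measure. norm (fun_of (L2_mult f g) z) \<le> \<bar>C\<bar> * \<bar>D\<bar>"
    using C D AE_fun_of_mult[OF assms(2), of f]
    by eventually_elim (auto simp: norm_mult intro!: mult_mono)
  then show ?thesis by (rule bddI)
qed

definition L2_cnj :: "circle_L2 \<Rightarrow> circle_L2" where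
  "L2_cnj f = L2_of (\<lambda>z. cnj (fun_of f z))"

lemma AE_fun_of_L2_cnj: "AE z in circle_measure. fun_of (L2_cnj f) z = cnj (fun_of f z)"
  unfolding L2_cnj_def
  by (rule AE_fun_of_L2_of)
    (use square_integrable_fun_of[of f] in \<open>simp add: square_integrable_def\<close>)

lemma bdd_L2_cnj: assumes "bdd f" shows "bdd (L2_cnj f)"
proof -
  obtain C where C: "AE z in circle_measure. norm (fun_of f z) \<le> C"
    using assms by (auto simp: essentially_bounded_def)
  have "AE z in circle_measure. norm (fun_of (L2_cnj f) z) \<le> C"
    using C AE_fun_of_L2_cnj[of f] by eventually_elim simp
  then show ?thesis by (rule bddI)
qed

lemma L2_mult_add_left: assumes "bdd f" shows "L2_mult (g + h) f = L2_mult g f + L2_mult h f"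
  by (rule circle_L2_eqI)
    (use AE_fun_of_mult[OF assms, of "g + h"] AE_fun_of_mult[OF assms, of g] AE_fun_of_mult[OF assms, of h]
      AE_fun_of_add[of g h] AE_fun_of_add[of "L2_mult g f" "L2_mult h f"] in
      \<open>eventually_elim, simp add: distrib_right\<close>)

lemma L2_mult_scaleC_left: assumes "bdd f" shows "L2_mult (c *\<^sub>C g) f = c *\<^sub>C L2_mult g f"
  by (rule circle_L2_eqI)
    (use AE_fun_of_mult[OF assms, of "c *\<^sub>C g"] AE_fun_of_mult[OF assms, of g]
      AE_fun_of_scaleC[of c g] AE_fun_of_scaleC[of c "L2_mult g f"] in
      \<open>eventually_elim, simp add: mult.assoc\<close>)

lemma L2_mult_diff_left: "bdd f \<Longrightarrow> L2_mult (g - h) f = L2_mult g f - L2_mult h f"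
  using L2_mult_add_left[of f "g - h" h] by simp

lemma L2_mult_add_right: "bdd f \<Longrightarrow> L2_mult f (g + h) = L2_mult f g + L2_mult f h"
  and L2_mult_scaleC_right: "bdd f \<Longrightarrow> L2_mult f (c *\<^sub>C g) = c *\<^sub>C L2_mult f g"
  and L2_mult_diff_right: "bdd f \<Longrightarrow> L2_mult f (g - h) = L2_mult f g - L2_mult f h"
  using L2_mult_add_left L2_mult_scaleC_left L2_mult_diff_left by (simp_all add: L2_mult_commute[of f])

lemma L2_mult_add_right': assumes "bdd g" "bdd h" shows "L2_mult f (g + h) = L2_mult f g + L2_mult f h"
  by (rule circle_L2_eqI)
    (use AE_fun_of_mult[OF bdd_add[OF assms], of f] AE_fun_of_mult[OF assms(1), of f]
      AE_fun_of_mult[OF assms(2), of f] AE_fun_of_add[of g h]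
      AE_fun_of_add[of "L2_mult f g" "L2_mult f h"] in
      \<open>eventually_elim, simp add: distrib_left\<close>)

lemma L2_mult_scaleC_right': assumes "bdd g" shows "L2_mult f (c *\<^sub>C g) = c *\<^sub>C L2_mult f g"
  by (rule circle_L2_eqI)
    (use AE_fun_of_mult[OF bdd_scaleC[OF assms, of c], of f] AE_fun_of_mult[OF assms(1), of f]
      AE_fun_of_scaleC[of c g] AE_fun_of_scaleC[of c "L2_mult f g"] in
      \<open>eventually_elim, simp add: mult.left_commute\<close>)

lemma L2_mult_diff_right': "bdd g \<Longrightarrow> bdd h \<Longrightarrow> L2_mult f (g - h) = L2_mult f g - L2_mult f h"
  using L2_mult_add_right'[of "g - h" h f] by (simp add: bdd_diff)

lemma L2_mult_assoc: assumes "bdd f" "bdd g" shows "L2_mult (L2_mult h f) g = L2_mult h (L2_mult f g)"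
  by (rule circle_L2_eqI)
    (use AE_fun_of_mult[OF assms(2), of "L2_mult h f"] AE_fun_of_mult[OF assms(1), of h]
      AE_fun_of_mult[OF bdd_mult[OF assms], of h] AE_fun_of_mult[OF assms(2), of f] in
      \<open>eventually_elim, simp add: mult.assoc\<close>)

lemma cinner_L2_mult: "cinner (L2_mult g f) k = (\<integral>z. fun_of g z * fun_of f z * cnj (fun_of k z) \<partial>circle_measure)"
  if "bdd f"
  unfolding cinner_integral
proof (rule integral_cong_AE)
  show "AE z in circle_measure. fun_of (L2_mult g f) z * cnj (fun_of k z)
      = fun_of g z * fun_of f z * cnj (fun_of k z)"
    using AE_fun_of_mult[OF that, of g] by eventually_elim simp
qed simp_all

lemma cinner_L2_mult_adjoint:
  assumes "bdd f"
  shows "cinner (L2_mult f g) k = cinner g (L2_mult (L2_cnj f) k)"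
  unfolding L2_mult_commute[of f g] cinner_L2_mult[OF assms] cinner_integral[of g "L2_mult (L2_cnj f) k"]
proof (rule integral_cong_AE)
  show "AE z in circle_measure. fun_of g z * fun_of f z * cnj (fun_of k z)
      = fun_of g z * cnj (fun_of (L2_mult (L2_cnj f) k) z)"
    using AE_fun_of_mult'[OF bdd_L2_cnj[OF assms], of k] AE_fun_of_L2_cnj[of f]
    by eventually_elim (simp add: mult.assoc)
qed simp_all

text \<open>
  In contrast to the previous lemma the multiplier \<open>g\<close> may be unbounded here; in exchange both functions
  must be bounded, so that \<open>g\<close> can be moved from one to the other.
\<close>

lemma cinner_L2_mult_move:
  assumes "bdd f" "bdd k"
  shows "cinner (L2_mult g f) k = cinner f (L2_mult (L2_cnj g) k)"
  unfolding cinner_L2_mult[OF assms(1)] cinner_integral[of f "L2_mult (L2_cnj g) k"]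
proof (rule integral_cong_AE)
  show "AE z in circle_measure. fun_of g z * fun_of f z * cnj (fun_of k z)
      = fun_of f z * cnj (fun_of (L2_mult (L2_cnj g) k) z)"
    using AE_fun_of_mult[OF assms(2), of "L2_cnj g"] AE_fun_of_L2_cnj[of g]
    by eventually_elim (simp add: mult_ac)
qed simp_all

lemma zpow_mult_zpow: "L2_mult (zpow m) (zpow n) = zpow (m + n)"
proof (rule circle_L2_eqI)
  show "AE z in circle_measure. fun_of (L2_mult (zpow m) (zpow n)) z = fun_of (zpow (m + n)) z"
    using AE_fun_of_mult[OF bdd_zpow[of n], of "zpow m"] AE_fun_of_zpow[of m] AE_fun_of_zpow[of n]
      AE_fun_of_zpow[of "m + n"] AE_circle_measure_norm
  proof eventually_elim
    case (elim z)
    then have "z \<noteq> 0" by auto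
    with elim show ?case by (simp add: power_int_add)
  qed
qed

lemma zpow_0_mult [simp]: "L2_mult (zpow 0) f = f"
  by (rule circle_L2_eqI)
    (use AE_fun_of_mult'[OF bdd_zpow[of 0], of f] AE_fun_of_zpow[of 0] in \<open>eventually_elim, simp\<close>)

lemma L2_cnj_zpow: "L2_cnj (zpow n) = zpow (- n)"
  by (rule circle_L2_eqI)
    (use AE_fun_of_L2_cnj[of "zpow n"] AE_fun_of_zpow[of n] AE_fun_of_zpow[of "- n"] AE_circle_measure_norm in
      \<open>eventually_elim, simp add: cnj_powi\<close>)

lemma zpow_mult_mult: "L2_mult (zpow m) (L2_mult (zpow n) f) = L2_mult (zpow (m + n)) f"
  using L2_mult_assoc[of "zpow n" "zpow m" f] zpow_mult_zpow[of n m] by (simp add: L2_mult_commute add.commute)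

lemma cinner_zpow_mult: "cinner (L2_mult (zpow n) f) g = cinner f (L2_mult (zpow (- n)) g)"
  by (simp add: cinner_L2_mult_adjoint L2_cnj_zpow)

lemma cinner_zpow_mult_both [simp]: "cinner (L2_mult (zpow n) f) (L2_mult (zpow n) g) = cinner f g"
  by (simp add: cinner_zpow_mult zpow_mult_mult)

lemma norm_zpow_mult [simp]: "norm (L2_mult (zpow n) f) = norm f"
proof -
  have "complex_of_real ((norm (L2_mult (zpow n) f))\<^sup>2) = complex_of_real ((norm f)\<^sup>2)"
    by (simp only: cinner_self[symmetric] cinner_zpow_mult_both)
  then have "(norm (L2_mult (zpow n) f))\<^sup>2 = (norm f)\<^sup>2" by (simp only: of_real_eq_iff)
  then show ?thesis by simp
qed

lemma fourier_coeff_zpow_mult: "fourier_coeff (L2_mult (zpow n) f) m = fourier_coeff f (m - n)"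
  by (simp add: fourier_coeff_eq_cinner cinner_zpow_mult zpow_mult_zpow)

lemma L2_mult_zpow_mult: "bdd f \<Longrightarrow> L2_mult g (L2_mult (zpow n) f) = L2_mult (zpow n) (L2_mult g f)"
  using L2_mult_assoc[of "zpow n" f g] L2_mult_assoc[of f "zpow n" g] by (simp add: L2_mult_commute)

lemma fourier_coeff_add: "fourier_coeff (f + g) n = fourier_coeff f n + fourier_coeff g n"
  and fourier_coeff_diff: "fourier_coeff (f - g) n = fourier_coeff f n - fourier_coeff g n"
  and fourier_coeff_scaleC: "fourier_coeff (c *\<^sub>C f) n = c * fourier_coeff f n"
  and fourier_coeff_zpow: "fourier_coeff (zpow m) n = (if m = n then 1 else 0)"
  by (simp_all add: fourier_coeff_eq_cinner cinner_add_left cinner_diff_left cinner_scaleC_left cinner_zpow)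

text \<open>
  Parseval's identity for \<open>g\<close>, paired with \<open>cnj f z\<^sup>n\<close>.
\<close>

lemma cauchy_product_sums:
  assumes f: "bdd f" and g: "g \<in> hardy_space"
  shows "(\<lambda>m. fourier_coeff g (int m) * fourier_coeff f (n - int m)) sums fourier_coeff (L2_mult f g) n"
proof -
  have "cinner (zpow (int m)) (L2_mult (L2_cnj f) (zpow n)) = fourier_coeff f (n - int m)" for m
  proof -
    have "cinner (zpow (int m)) (L2_mult (L2_cnj f) (zpow n)) = cinner (L2_mult f (zpow (int m))) (zpow n)"
      by (simp add: cinner_L2_mult_adjoint f)
    also have "\<dots> = fourier_coeff (L2_mult (zpow (int m)) f) n"
      by (simp add: fourier_coeff_eq_cinner L2_mult_commute)
    finally show ?thesis by (simp add: fourier_coeff_zpow_mult)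
  qed
  then show ?thesis
    using parseval_hardy[OF g, of "L2_mult (L2_cnj f) (zpow n)"]
    by (simp add: fourier_coeff_eq_cinner[of "L2_mult f g"] cinner_L2_mult_adjoint f)
qed

lemma hardy_mult_fourier:
  assumes f: "f \<in> hardy_space" "bdd f" and g: "g \<in> hardy_space"
  shows "n < 0 \<Longrightarrow> fourier_coeff (L2_mult f g) n = 0"
    and "fourier_coeff (L2_mult f g) 0 = fourier_coeff f 0 * fourier_coeff g 0"
proof -
  note sums = cauchy_product_sums[OF f(2) g]
  show "fourier_coeff (L2_mult f g) n = 0" if "n < 0"
  proof -
    have "fourier_coeff f (n - int m) = 0" for m
      using f(1) that by (simp add: hardy_space_def)
    then show ?thesis using sums[of n] by (simp add: sums_iff)
  qed
  have "fourier_coeff g (int m) * fourier_coeff f (0 - int m)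
      = (if m = 0 then fourier_coeff g (int m) * fourier_coeff f 0 else 0)" for m
    using f(1) by (simp add: hardy_space_def)
  then have "(\<lambda>m. if m = 0 then fourier_coeff g (int m) * fourier_coeff f 0 else 0) sums fourier_coeff (L2_mult f g) 0"
    using sums[of 0] by simp
  moreover have "(\<lambda>m. if m = 0 then fourier_coeff g (int m) * fourier_coeff f 0 else 0) sums
      (fourier_coeff g (int 0) * fourier_coeff f 0)"
    by (rule sums_single)
  ultimately show "fourier_coeff (L2_mult f g) 0 = fourier_coeff f 0 * fourier_coeff g 0"
    using sums_unique2 by (fastforce simp: mult.commute)
qed

lemma hardy_mult: "f \<in> hardy_space \<Longrightarrow> bdd f \<Longrightarrow> g \<in> hardy_space \<Longrightarrow> L2_mult f g \<in> hardy_space"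
  using hardy_mult_fourier(1) by (simp add: hardy_space_def)

section \<open>The backward shift on model spaces\<close>

definition bshift :: "circle_L2 \<Rightarrow> circle_L2" where
  "bshift h = L2_mult (zpow (- 1)) (h - fourier_coeff h 0 *\<^sub>C zpow 0)"

lemma zpow_mult_bshift: "L2_mult (zpow 1) (bshift h) = h - fourier_coeff h 0 *\<^sub>C zpow 0"
  by (simp add: bshift_def zpow_mult_mult)

lemma bdd_bshift: "bdd h \<Longrightarrow> bdd (bshift h)"
  unfolding bshift_def by (intro bdd_mult bdd_diff bdd_scaleC bdd_zpow)

lemma bshift_add: "bshift (g + h) = bshift g + bshift h"
proof -
  have "g + h - fourier_coeff (g + h) 0 *\<^sub>C zpow 0
      = (g - fourier_coeff g 0 *\<^sub>C zpow 0) + (h - fourier_coeff h 0 *\<^sub>C zpow 0)"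
    by (simp add: fourier_coeff_add scaleC_add_left)
  then show ?thesis by (simp only: bshift_def L2_mult_add_right bdd_zpow)
qed

lemma bshift_scaleC: "bshift (c *\<^sub>C h) = c *\<^sub>C bshift h"
proof -
  have "c *\<^sub>C h - fourier_coeff (c *\<^sub>C h) 0 *\<^sub>C zpow 0 = c *\<^sub>C (h - fourier_coeff h 0 *\<^sub>C zpow 0)"
    by (simp add: fourier_coeff_scaleC scaleC_diff_right scaleC_scaleC)
  then show ?thesis by (simp only: bshift_def L2_mult_scaleC_right bdd_zpow)
qed

lemma fourier_coeff_bshift:
  "fourier_coeff (bshift h) n = (if n = - 1 then 0 else fourier_coeff h (n + 1))"
  by (simp add: bshift_def fourier_coeff_zpow_mult fourier_coeff_diff fourier_coeff_scaleC fourier_coeff_zpow)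

lemma bshift_hardy: "h \<in> hardy_space \<Longrightarrow> bshift h \<in> hardy_space"
  by (auto simp: hardy_space_def fourier_coeff_bshift)

lemma norm_bshift_le: "norm (bshift h) \<le> 2 * norm h"
proof -
  have "norm (bshift h) \<le> norm h + norm (fourier_coeff h 0)"
    using norm_triangle_ineq4[of h "fourier_coeff h 0 *\<^sub>C zpow 0"]
    by (simp add: bshift_def norm_scaleC)
  also have "norm (fourier_coeff h 0) \<le> norm h"
    using cinner_bound[of h "zpow 0"] by (simp add: fourier_coeff_eq_cinner)
  finally show ?thesis by simp
qed

lemma bshift_funpow_hardy: "h \<in> hardy_space \<Longrightarrow> (bshift ^^ n) h \<in> hardy_space"
  by (induction n) (auto intro: bshift_hardy)

lemma bdd_bshift_funpow: "bdd h \<Longrightarrow> bdd ((bshift ^^ n) h)"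
  by (induction n) (auto intro: bdd_bshift)

lemma fourier_coeff_bshift_funpow: "fourier_coeff ((bshift ^^ n) h) (int k) = fourier_coeff h (int (k + n))"
proof (induction n arbitrary: k)
  case (Suc n)
  then show ?case using Suc.IH[of "Suc k"] by (simp add: fourier_coeff_bshift add_ac)
qed simp

text \<open>
  The iterated backward shift is a Taylor remainder, up to the unimodular factor \<open>z\<^sup>n\<close>; therefore its
  norm tends to \<open>0\<close>.
\<close>

lemma zpow_mult_bshift_funpow: "L2_mult (zpow (int n)) ((bshift ^^ n) h) = h - taylor_poly h n"
proof (induction n)
  case 0
  show ?case by (simp add: taylor_poly_def)
next
  case (Suc n)
  let ?x = "(bshift ^^ n) h"
  have "L2_mult (zpow (int (Suc n))) ((bshift ^^ Suc n) h)
      = L2_mult (zpow (int n)) (L2_mult (zpow 1) (bshift ?x))"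
    by (simp add: zpow_mult_mult add.commute)
  also have "\<dots> = L2_mult (zpow (int n)) ?x - fourier_coeff ?x 0 *\<^sub>C zpow (int n)"
    by (simp add: zpow_mult_bshift L2_mult_diff_right L2_mult_scaleC_right zpow_mult_zpow)
  also have "fourier_coeff ?x 0 = fourier_coeff h (int n)"
    using fourier_coeff_bshift_funpow[of n h 0] by simp
  finally show ?case by (simp add: Suc.IH taylor_poly_def)
qed

lemma bshift_funpow_tendsto_0:
  assumes "h \<in> hardy_space"
  shows "(\<lambda>n. norm ((bshift ^^ n) h)) \<longlonglongrightarrow> 0"
proof -
  have "norm ((bshift ^^ n) h) = norm (h - taylor_poly h n)" for n
    by (simp flip: zpow_mult_bshift_funpow)
  moreover have "(\<lambda>n. norm (h - taylor_poly h n)) \<longlonglongrightarrow> norm (h - h)"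
    by (intro tendsto_intros taylor_poly_LIMSEQ assms)
  ultimately show ?thesis by simp
qed

lemma cinner_bshift:
  assumes "f \<in> hardy_space"
  shows "cinner f (bshift g) = cinner (L2_mult (zpow 1) f) g"
proof -
  have "cinner (L2_mult (zpow 1) f) (zpow 0) = fourier_coeff f (- 1)"
    using fourier_coeff_zpow_mult[of 1 f 0] by (simp add: fourier_coeff_eq_cinner)
  also have "\<dots> = 0" using assms by (simp add: hardy_space_def)
  finally have "cinner (L2_mult (zpow 1) f) (g - fourier_coeff g 0 *\<^sub>C zpow 0) = cinner (L2_mult (zpow 1) f) g"
    by (simp add: cinner_diff_right cinner_scaleC_right)
  then show ?thesis by (simp add: bshift_def cinner_zpow_mult[of 1])
qed

lemma hardy_zpow_mult: "f \<in> hardy_space \<Longrightarrow> 0 \<le> n \<Longrightarrow> L2_mult (zpow n) f \<in> hardy_space"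
  by (auto simp: hardy_space_def fourier_coeff_zpow_mult)

lemma cinner_bshift_funpow:
  assumes "f \<in> hardy_space"
  shows "cinner f ((bshift ^^ n) g) = cinner (L2_mult (zpow (int n)) f) g"
  using assms
proof (induction n arbitrary: f)
  case (Suc n)
  have "cinner f ((bshift ^^ Suc n) g) = cinner (L2_mult (zpow 1) f) ((bshift ^^ n) g)"
    using cinner_bshift[OF Suc.prems] by simp
  also have "\<dots> = cinner (L2_mult (zpow (int n)) (L2_mult (zpow 1) f)) g"
    using Suc.prems by (intro Suc.IH hardy_zpow_mult) auto
  finally show ?case by (simp add: zpow_mult_mult add.commute)
qed simp

lemma closed_subspace_orthogonal:
  fixes G :: "'a::complex_inner set"
  shows "complex_vector.subspace {f. \<forall>g\<in>G. cinner f g = 0}" and "closed {f. \<forall>g\<in>G. cinner f g = 0}"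
proof -
  show "complex_vector.subspace {f. \<forall>g\<in>G. cinner f g = 0}"
    by (auto simp: complex_vector.subspace_def cinner_add_left cinner_scaleC_left)
  have "closed (\<Inter>g\<in>G. {f. cinner f g = 0})"
    by (intro closed_INT ballI closed_Collect_eq continuous_intros cinner.continuous_on)
  then show "closed {f. \<forall>g\<in>G. cinner f g = 0}" by (simp add: INT_extend_simps Collect_ball_eq)
qed

lemma hardy_space_subspace: "complex_vector.subspace hardy_space" "closed hardy_space"
proof -
  have "hardy_space = {f. \<forall>g\<in>zpow ` {..<0}. cinner f g = 0}" by (auto simp: hardy_space_iff)
  then show "complex_vector.subspace hardy_space" "closed hardy_space"
    using closed_subspace_orthogonal[of "zpow ` {..<0}"] by simp_all
qed

lemma model_space_subspace: "complex_vector.subspace (model_space \<theta>)" "closed (model_space \<theta>)"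
proof -
  have "model_space \<theta> = {f. \<forall>g\<in>zpow ` {..<0} \<union> L2_mult \<theta> ` hardy_space. cinner f g = 0}"
    by (auto simp: model_space_def hardy_space_iff)
  then show "complex_vector.subspace (model_space \<theta>)" "closed (model_space \<theta>)"
    using closed_subspace_orthogonal[of "zpow ` {..<0} \<union> L2_mult \<theta> ` hardy_space"] by simp_all
qed

lemmas model_space_subspaceD = complex_subspaceD[OF model_space_subspace(1)]

lemma model_space_hardy: "h \<in> model_space \<theta> \<Longrightarrow> h \<in> hardy_space"
  by (simp add: model_space_def)

lemma zpow_hardy: "0 \<le> n \<Longrightarrow> zpow n \<in> hardy_space"
  by (simp add: hardy_space_def fourier_coeff_zpow)

lemma L2_mult_inner_zpow:
  assumes "bdd \<theta>"
  shows "L2_mult \<theta> (L2_mult (zpow n) g) = L2_mult (zpow n) (L2_mult \<theta> g)"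
  using L2_mult_assoc[OF assms bdd_zpow, of g n] L2_mult_assoc[OF bdd_zpow assms, of g n]
  by (simp add: L2_mult_commute)

text \<open>
  Orthogonality to \<open>\<theta> g\<close> after the shift becomes orthogonality to \<open>\<theta> (z g)\<close> before it; the constant
  that the shift subtracts is orthogonal to \<open>z \<theta> g\<close>.
\<close>

lemma bshift_model_space:
  assumes "inner_function \<theta>" and h: "h \<in> model_space \<theta>"
  shows "bshift h \<in> model_space \<theta>"
proof -
  have \<theta>: "\<theta> \<in> hardy_space" "bdd \<theta>" using assms bdd_inner by (auto simp: inner_function_def)
  have "cinner (bshift h) (L2_mult \<theta> g) = 0" if g: "g \<in> hardy_space" for g
  proof -
    have "cinner (bshift h) (L2_mult \<theta> g)
        = cinner (L2_mult (zpow 1) (bshift h)) (L2_mult (zpow 1) (L2_mult \<theta> g))" by simp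
    also have "\<dots> = cinner h (L2_mult \<theta> (L2_mult (zpow 1) g))
        - fourier_coeff h 0 * cinner (zpow 0) (L2_mult (zpow 1) (L2_mult \<theta> g))"
      by (simp add: zpow_mult_bshift cinner_diff_left cinner_scaleC_left L2_mult_inner_zpow[OF \<theta>(2)])
    also have "cinner h (L2_mult \<theta> (L2_mult (zpow 1) g)) = 0"
      using h hardy_zpow_mult[OF g, of 1] by (simp add: model_space_def)
    also have "cinner (L2_mult (zpow 1) (L2_mult \<theta> g)) (zpow 0) = fourier_coeff (L2_mult \<theta> g) (- 1)"
      using fourier_coeff_zpow_mult[of 1 "L2_mult \<theta> g" 0] by (simp add: fourier_coeff_eq_cinner)
    then have "cinner (zpow 0) (L2_mult (zpow 1) (L2_mult \<theta> g)) = 0"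
      using hardy_mult_fourier(1)[OF \<theta> g, of "- 1"] by (subst cinner_commute) simp
    finally show ?thesis by simp
  qed
  then show ?thesis using h bshift_hardy by (simp add: model_space_def)
qed

lemma bshift_funpow_model_space:
  "inner_function \<theta> \<Longrightarrow> h \<in> model_space \<theta> \<Longrightarrow> (bshift ^^ n) h \<in> model_space \<theta>"
  by (induction n) (auto intro: bshift_model_space)

lemma inner_mult_isometry:
  assumes "inner_function \<theta>"
  shows "cinner (L2_mult \<theta> f) (L2_mult \<theta> g) = cinner f g"
proof -
  have "L2_mult (L2_cnj \<theta>) (L2_mult \<theta> g) = g"
  proof (rule circle_L2_eqI)
    have "AE z in circle_measure. norm (fun_of \<theta> z) = 1"
      using assms by (simp add: inner_function_def)
    then show "AE z in circle_measure. fun_of (L2_mult (L2_cnj \<theta>) (L2_mult \<theta> g)) z = fun_of g z"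
      using AE_fun_of_mult'[OF bdd_L2_cnj[OF bdd_inner[OF assms]], of "L2_mult \<theta> g"] AE_fun_of_L2_cnj[of \<theta>]
        AE_fun_of_mult'[OF bdd_inner[OF assms], of g]
    proof eventually_elim
      case (elim z)
      have "cnj (fun_of \<theta> z) * fun_of \<theta> z = 1"
        using elim(1) complex_norm_square[of "fun_of \<theta> z"] by (simp add: mult.commute)
      then show ?case using elim by (simp add: mult.assoc[symmetric])
    qed
  qed
  then show ?thesis by (simp add: cinner_L2_mult_adjoint bdd_inner[OF assms])
qed

text \<open>The reproducing kernel of the model space at the origin: the projection of the constant \<open>1\<close>.\<close>

definition kernel0 :: "circle_L2 \<Rightarrow> circle_L2" where
  "kernel0 \<theta> = zpow 0 - cnj (fourier_coeff \<theta> 0) *\<^sub>C \<theta>"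

text \<open>
  The value at the origin is \<open>1 - \<bar>\<theta>(0)\<bar>\<^sup>2 = \<parallel>\<theta> - \<theta>(0)\<parallel>\<^sup>2\<close>, which is positive for nonconstant \<open>\<theta>\<close>.
\<close>

lemma kernel0:
  assumes "inner_function \<theta>"
  shows "kernel0 \<theta> \<in> model_space \<theta>" and "bdd (kernel0 \<theta>)"
    and "nonconstant \<theta> \<Longrightarrow> fourier_coeff (kernel0 \<theta>) 0 \<noteq> 0"
proof -
  have \<theta>: "\<theta> \<in> hardy_space" "bdd \<theta>" using assms bdd_inner by (auto simp: inner_function_def)
  let ?c = "fourier_coeff \<theta> 0"
  have \<theta>1: "L2_mult \<theta> (zpow 0) = \<theta>" by (simp add: L2_mult_commute[of \<theta>])
  show "bdd (kernel0 \<theta>)" using \<theta> by (simp add: kernel0_def bdd_diff bdd_scaleC)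
  have "kernel0 \<theta> \<in> hardy_space"
    unfolding kernel0_def using hardy_space_subspace \<theta> zpow_hardy[of 0]
    by (intro complex_vector.subspace_diff complex_vector.subspace_scale) auto
  moreover have "cinner (kernel0 \<theta>) (L2_mult \<theta> g) = 0" if g: "g \<in> hardy_space" for g
  proof -
    have "cinner (zpow 0) (L2_mult \<theta> g) = cnj (fourier_coeff (L2_mult \<theta> g) 0)"
      by (simp add: fourier_coeff_eq_cinner flip: cinner_commute)
    moreover have "cinner \<theta> (L2_mult \<theta> g) = cinner (zpow 0) g"
      using inner_mult_isometry[OF assms, of "zpow 0" g] by (simp add: \<theta>1)
    moreover have "cinner (zpow 0) g = cnj (fourier_coeff g 0)"
      by (simp add: fourier_coeff_eq_cinner flip: cinner_commute)
    ultimately show ?thesis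
      by (simp add: kernel0_def cinner_diff_left cinner_scaleC_left hardy_mult_fourier(2)[OF \<theta> g])
  qed
  ultimately show "kernel0 \<theta> \<in> model_space \<theta>" by (simp add: model_space_def)
  assume nc: "nonconstant \<theta>"
  show "fourier_coeff (kernel0 \<theta>) 0 \<noteq> 0"
  proof
    assume "fourier_coeff (kernel0 \<theta>) 0 = 0"
    then have c: "cnj ?c * ?c = 1"
      by (simp add: kernel0_def fourier_coeff_diff fourier_coeff_scaleC fourier_coeff_zpow)
    have "cinner \<theta> \<theta> = 1"
      using inner_mult_isometry[OF assms, of "zpow 0" "zpow 0"] by (simp add: \<theta>1 cinner_zpow)
    moreover have "cinner \<theta> (zpow 0) = ?c" "cinner (zpow 0) \<theta> = cnj ?c"
      by (simp_all add: fourier_coeff_eq_cinner flip: cinner_commute)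
    ultimately have "cinner (\<theta> - ?c *\<^sub>C zpow 0) (\<theta> - ?c *\<^sub>C zpow 0) = 0"
      using c by (simp add: cinner_diff_left cinner_diff_right cinner_scaleC_left cinner_scaleC_right
          cinner_zpow algebra_simps)
    then have "\<theta> = ?c *\<^sub>C zpow 0" by simp
    then have "AE z in circle_measure. fun_of \<theta> z = ?c"
      using AE_fun_of_scaleC[of ?c "zpow 0"] AE_fun_of_zpow[of 0] by (auto elim: AE_mp)
    then show False using nc by (auto simp: nonconstant_def)
  qed
qed

text \<open>
  The projection of \<open>z\<^sup>j\<close> to the model space is bounded: it is \<open>z\<^sup>j - \<theta> p\<close> with a polynomial \<open>p\<close>.
\<close>

lemma bounded_coefficient_functional:
  assumes "inner_function \<theta>"
  shows "\<exists>u \<in> model_space \<theta>. bdd u \<and> (\<forall>y\<in>model_space \<theta>. cinner y u = fourier_coeff y (int j))"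
proof -
  have \<theta>: "\<theta> \<in> hardy_space" "bdd \<theta>" using assms bdd_inner by (auto simp: inner_function_def)
  define p where "p = (\<Sum>i\<le>j. cnj (fourier_coeff \<theta> (int j - int i)) *\<^sub>C zpow (int i))"
  have p: "p \<in> hardy_space" "bdd p"
    unfolding p_def using hardy_space_subspace
    by (auto intro!: complex_vector.subspace_sum complex_vector.subspace_scale zpow_hardy bdd_sum bdd_scaleC)
  define u where "u = zpow (int j) - L2_mult \<theta> p"
  have "bdd u" unfolding u_def by (intro bdd_diff bdd_mult bdd_zpow \<theta> p)
  have "u \<in> hardy_space"
    unfolding u_def using hardy_space_subspace zpow_hardy hardy_mult[OF \<theta> p(1)]
    by (intro complex_vector.subspace_diff) auto
  moreover have "cinner u (L2_mult \<theta> g) = 0" if g: "g \<in> hardy_space" for g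
  proof -
    have "(\<lambda>m. fourier_coeff g (int m) * fourier_coeff \<theta> (int j - int m)) sums
        (\<Sum>m\<le>j. fourier_coeff g (int m) * fourier_coeff \<theta> (int j - int m))"
      using \<theta>(1) by (intro sums_finite) (auto simp: hardy_space_def)
    with cauchy_product_sums[OF \<theta>(2) g, of "int j"]
    have "fourier_coeff (L2_mult \<theta> g) (int j)
        = (\<Sum>m\<le>j. fourier_coeff g (int m) * fourier_coeff \<theta> (int j - int m))"
      by (rule sums_unique2)
    moreover have "cinner g p = (\<Sum>m\<le>j. fourier_coeff g (int m) * fourier_coeff \<theta> (int j - int m))"
      by (simp add: p_def cinner.sum_right cinner_scaleC_right fourier_coeff_eq_cinner mult.commute)
    moreover have "cinner (L2_mult \<theta> g) u = fourier_coeff (L2_mult \<theta> g) (int j) - cinner g p"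
      by (simp add: u_def cinner_diff_right inner_mult_isometry[OF assms] fourier_coeff_eq_cinner)
    ultimately have "cinner (L2_mult \<theta> g) u = 0" by simp
    then show ?thesis by (rule cinner_eq_zero_comm)
  qed
  ultimately have "u \<in> model_space \<theta>" by (simp add: model_space_def)
  moreover have "cinner y u = fourier_coeff y (int j)" if "y \<in> model_space \<theta>" for y
    using that p(1) by (simp add: u_def cinner_diff_right model_space_def fourier_coeff_eq_cinner)
  ultimately show ?thesis using \<open>bdd u\<close> by blast
qed

text \<open>
  Each Fourier coefficient on the model space is the inner product with a bounded function, so bounded
  functions separate points.
\<close>

lemma model_space_eqI:
  assumes "inner_function \<theta>" and y: "y \<in> model_space \<theta>" "y' \<in> model_space \<theta>"
    and eq: "\<And>k. k \<in> model_space \<theta> \<Longrightarrow> bdd k \<Longrightarrow> cinner y k = cinner y' k"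
  shows "y = y'"
proof (rule fourier_coeff_unique)
  fix n
  show "fourier_coeff y n = fourier_coeff y' n"
  proof (cases "n < 0")
    case True
    then show ?thesis using y by (simp add: model_space_def hardy_space_def)
  next
    case False
    then obtain u where "u \<in> model_space \<theta>" "bdd u"
      "\<forall>y\<in>model_space \<theta>. cinner y u = fourier_coeff y n"
      using bounded_coefficient_functional[OF assms(1), of "nat n"] by auto
    then show ?thesis using eq y by metis
  qed
qed

section \<open>Shift invariance characterizes truncated Toeplitz operators\<close>

text \<open>
  The projection in the definition disappears when it is tested against bounded functions of \<open>K\<^sub>\<alpha>\<close>.
\<close>

lemma att_operators_iff:
  assumes \<alpha>: "inner_function \<alpha>"
  shows "A \<in> att_operators \<theta> \<alpha> \<longleftrightarrow> A \<in> bounded_ops (model_space \<theta>) (model_space \<alpha>) \<and>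
    (\<exists>\<phi>. \<forall>h\<in>model_space \<theta>. \<forall>k\<in>model_space \<alpha>. bdd h \<longrightarrow> bdd k \<longrightarrow>
      cinner (A h) k = cinner (L2_mult \<phi> h) k)"
proof -
  note P = orth_proj[OF model_space_subspace[of \<alpha>]]
  have key: "(\<forall>h\<in>model_space \<theta> \<inter> essentially_bounded. A h = orth_proj (model_space \<alpha>) (L2_mult \<phi> h)) \<longleftrightarrow>
     (\<forall>h\<in>model_space \<theta>. \<forall>k\<in>model_space \<alpha>. bdd h \<longrightarrow> bdd k \<longrightarrow> cinner (A h) k = cinner (L2_mult \<phi> h) k)"
    if A: "A \<in> bounded_ops (model_space \<theta>) (model_space \<alpha>)" for \<phi>
  proof (intro iffI ballI impI)
    fix h k
    assume "\<forall>h\<in>model_space \<theta> \<inter> essentially_bounded. A h = orth_proj (model_space \<alpha>) (L2_mult \<phi> h)"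
      "h \<in> model_space \<theta>" "k \<in> model_space \<alpha>" "bdd h" "bdd k"
    then show "cinner (A h) k = cinner (L2_mult \<phi> h) k" using P(2) by simp
  next
    fix h
    assume eq: "\<forall>h\<in>model_space \<theta>. \<forall>k\<in>model_space \<alpha>. bdd h \<longrightarrow> bdd k \<longrightarrow> cinner (A h) k = cinner (L2_mult \<phi> h) k"
      and h: "h \<in> model_space \<theta> \<inter> essentially_bounded"
    show "A h = orth_proj (model_space \<alpha>) (L2_mult \<phi> h)"
    proof (rule model_space_eqI[OF \<alpha>])
      show "A h \<in> model_space \<alpha>" using bounded_opsD(1)[OF A] h by simp
      show "orth_proj (model_space \<alpha>) (L2_mult \<phi> h) \<in> model_space \<alpha>" by (rule P(1))
      show "cinner (A h) k = cinner (orth_proj (model_space \<alpha>) (L2_mult \<phi> h)) k"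
        if "k \<in> model_space \<alpha>" "bdd k" for k
        using eq h that by (simp add: P(2))
    qed
  qed
  show ?thesis
    by (cases "A \<in> bounded_ops (model_space \<theta>) (model_space \<alpha>)")
      (simp_all add: att_operators_def key)
qed

text \<open>
  The test functions are bounded so that their products with an unbounded symbol are square integrable.
\<close>

definition shift_invariant ::
  "circle_L2 \<Rightarrow> circle_L2 \<Rightarrow> (circle_L2 \<Rightarrow> circle_L2) \<Rightarrow> bool" where
  "shift_invariant \<theta> \<alpha> A \<longleftrightarrow>
     (\<forall>h\<in>model_space \<theta>. \<forall>k\<in>model_space \<alpha>. bdd h \<longrightarrow> bdd k \<longrightarrow>
       fourier_coeff h 0 = 0 \<longrightarrow> fourier_coeff k 0 = 0 \<longrightarrow>
       cinner (A h) k = cinner (A (bshift h)) (bshift k))"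

lemma att_operators_shift_invariant:
  assumes inner: "inner_function \<theta>" "inner_function \<alpha>" and A: "A \<in> att_operators \<theta> \<alpha>"
  shows "shift_invariant \<theta> \<alpha> A"
proof -
  obtain \<phi> where "\<forall>h\<in>model_space \<theta>. \<forall>k\<in>model_space \<alpha>. bdd h \<longrightarrow> bdd k \<longrightarrow>
      cinner (A h) k = cinner (L2_mult \<phi> h) k"
    using A unfolding att_operators_iff[OF inner(2)] by (elim conjE exE)
  then have \<phi>: "cinner (A h) k = cinner (L2_mult \<phi> h) k"
    if "h \<in> model_space \<theta>" "k \<in> model_space \<alpha>" "bdd h" "bdd k" for h k
    using that by simp
  show ?thesis
    unfolding shift_invariant_def
  proof (intro ballI impI)
    fix h k
    assume h: "h \<in> model_space \<theta>" "bdd h" "fourier_coeff h 0 = 0"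
      and k: "k \<in> model_space \<alpha>" "bdd k" "fourier_coeff k 0 = 0"
    have "cinner (A h) k = cinner (L2_mult \<phi> (L2_mult (zpow 1) (bshift h))) (L2_mult (zpow 1) (bshift k))"
      by (simp add: zpow_mult_bshift \<phi> h k)
    also have "\<dots> = cinner (L2_mult \<phi> (bshift h)) (bshift k)"
      by (simp add: L2_mult_zpow_mult bdd_bshift h)
    also have "\<dots> = cinner (A (bshift h)) (bshift k)"
      using h k inner by (simp add: \<phi> bdd_bshift bshift_model_space)
    finally show "cinner (A h) k = cinner (A (bshift h)) (bshift k)" .
  qed
qed

lemma L2_cnj_L2_cnj [simp]: "L2_cnj (L2_cnj f) = f"
  by (rule circle_L2_eqI)
    (use AE_fun_of_L2_cnj[of f] AE_fun_of_L2_cnj[of "L2_cnj f"] in \<open>eventually_elim, simp\<close>)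

lemma cinner_L2_cnj_mult:
  "bdd h \<Longrightarrow> bdd k \<Longrightarrow> cinner (L2_mult (L2_cnj g) h) k = cnj (cinner (L2_mult g k) h)"
  by (simp add: cinner_L2_mult_move flip: cinner_commute)

text \<open>
  As \<open>\<psi> S\<^sup>* h\<close> lies in the Hardy space, the backward shift of \<open>k\<close> can be moved to the other side, where it
  becomes multiplication by \<open>z\<close>, and \<open>z S\<^sup>* h = h - h(0)\<close>.
\<close>

lemma analytic_symbol_bshift:
  assumes \<psi>: "\<psi> \<in> hardy_space" and h: "h \<in> hardy_space" "bdd h"
  shows "cinner (L2_mult \<psi> (bshift h)) (bshift k)
    = cinner (L2_mult \<psi> h) k - fourier_coeff h 0 * cinner \<psi> k"
proof -
  have "L2_mult \<psi> (bshift h) \<in> hardy_space"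
    using hardy_mult[of "bshift h" \<psi>] \<psi> h by (simp add: bshift_hardy bdd_bshift L2_mult_commute)
  then have "cinner (L2_mult \<psi> (bshift h)) (bshift k) = cinner (L2_mult (zpow 1) (L2_mult \<psi> (bshift h))) k"
    by (rule cinner_bshift)
  also have "L2_mult (zpow 1) (L2_mult \<psi> (bshift h)) = L2_mult \<psi> (L2_mult (zpow 1) (bshift h))"
    by (simp add: L2_mult_zpow_mult bdd_bshift h)
  also have "\<dots> = L2_mult \<psi> h - fourier_coeff h 0 *\<^sub>C \<psi>"
    using h by (simp add: zpow_mult_bshift L2_mult_diff_right' bdd_scaleC L2_mult_scaleC_right'
        L2_mult_commute[of \<psi> "zpow 0"])
  finally show ?thesis by (simp add: cinner_diff_left cinner_scaleC_left)
qed

text \<open>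
  Iterating the previous lemma subtracts the partial sums of the Parseval series of
  \<open>\<langle>h, cnj \<psi> k\<rangle> = \<langle>\<psi> h, k\<rangle>\<close>; this inner product makes sense because \<open>k\<close> is bounded.
\<close>

lemma analytic_symbol_bshift_funpow_tendsto_0:
  assumes \<psi>: "\<psi> \<in> hardy_space" and h: "h \<in> hardy_space" "bdd h" and k: "bdd k"
  shows "(\<lambda>n. cinner (L2_mult \<psi> ((bshift ^^ n) h)) ((bshift ^^ n) k)) \<longlonglongrightarrow> 0"
proof -
  let ?G = "L2_mult (L2_cnj \<psi>) k"
  have eq: "cinner (L2_mult \<psi> ((bshift ^^ n) h)) ((bshift ^^ n) k)
      = cinner h ?G - (\<Sum>m<n. fourier_coeff h (int m) * cinner (zpow (int m)) ?G)" for n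
  proof (induction n)
    case 0
    show ?case by (simp add: cinner_L2_mult_move h k)
  next
    case (Suc n)
    have "cinner \<psi> ((bshift ^^ n) k) = cinner (L2_mult \<psi> (zpow (int n))) k"
      by (simp add: cinner_bshift_funpow[OF \<psi>] L2_mult_commute)
    then have "cinner \<psi> ((bshift ^^ n) k) = cinner (zpow (int n)) ?G"
      by (simp add: cinner_L2_mult_move k)
    moreover have "fourier_coeff ((bshift ^^ n) h) 0 = fourier_coeff h (int n)"
      using fourier_coeff_bshift_funpow[of n h 0] by simp
    ultimately show ?case
      using analytic_symbol_bshift[OF \<psi> bshift_funpow_hardy[OF h(1), of n] bdd_bshift_funpow[OF h(2), of n],
          of "(bshift ^^ n) k"]
      by (simp add: Suc.IH)
  qed
  have "(\<lambda>n. cinner h ?G - (\<Sum>m<n. fourier_coeff h (int m) * cinner (zpow (int m)) ?G))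
      \<longlonglongrightarrow> cinner h ?G - cinner h ?G"
    using parseval_hardy[OF h(1), of ?G] by (intro tendsto_intros) (simp add: sums_def)
  then show ?thesis by (simp add: eq)
qed

text \<open>
  Subtracting multiples of the kernels at the origin makes \<open>h\<close> and \<open>k\<close> vanish there, so the form on
  the left is determined by its values with one argument equal to a kernel.  The vector \<open>\<psi>\<close> is the
  projection of an explicit function; \<open>\<eta>\<close> comes from the Riesz representation.
\<close>

lemma shift_invariant_decomposition:
  assumes inner: "inner_function \<theta>" "inner_function \<alpha>"
    and nc: "nonconstant \<theta>" "nonconstant \<alpha>"
    and A: "A \<in> bounded_ops (model_space \<theta>) (model_space \<alpha>)" and inv: "shift_invariant \<theta> \<alpha> A"
  obtains \<psi> \<eta> where "\<psi> \<in> model_space \<alpha>" "\<eta> \<in> model_space \<theta>"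
    "\<And>h k. h \<in> model_space \<theta> \<Longrightarrow> k \<in> model_space \<alpha> \<Longrightarrow> bdd h \<Longrightarrow> bdd k \<Longrightarrow>
      cinner (A h) k - cinner (A (bshift h)) (bshift k)
        = fourier_coeff h 0 * cinner \<psi> k + cnj (fourier_coeff k 0) * cinner h \<eta>"
proof -
  define \<kappa> where "\<kappa> = kernel0 \<theta>"
  define \<mu> where "\<mu> = kernel0 \<alpha>"
  define a where "a = fourier_coeff \<kappa> 0"
  define b where "b = fourier_coeff \<mu> 0"
  have \<kappa>: "\<kappa> \<in> model_space \<theta>" "bdd \<kappa>" "a \<noteq> 0" and \<mu>: "\<mu> \<in> model_space \<alpha>" "bdd \<mu>" "b \<noteq> 0"
    using kernel0 inner nc by (auto simp: \<kappa>_def \<mu>_def a_def b_def)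
  note sub = model_space_subspaceD
  note bs = bshift_model_space[OF inner(1)]
  note lin = bounded_opsD(2,3)[OF A]
  define B where "B h k = cinner (A h) k - cinner (A (bshift h)) (bshift k)" for h k
  have B_add_l: "B (h + h') k = B h k + B h' k" if "h \<in> model_space \<theta>" "h' \<in> model_space \<theta>" for h h' k
    using that bs by (simp add: B_def bshift_add lin cinner_add_left)
  have B_scale_l: "B (c *\<^sub>C h) k = c * B h k" if "h \<in> model_space \<theta>" for h k c
    using that bs by (simp add: B_def bshift_scaleC lin cinner_scaleC_left right_diff_distrib)
  have B_add_r: "B h (k + k') = B h k + B h k'" for h k k'
    by (simp add: B_def bshift_add cinner_add_right)
  have B_scale_r: "B h (c *\<^sub>C k) = cnj c * B h k" for h k c
    by (simp add: B_def bshift_scaleC cinner_scaleC_right right_diff_distrib)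
  have B_zero: "B h k = 0" if "h \<in> model_space \<theta>" "k \<in> model_space \<alpha>" "bdd h" "bdd k"
    "fourier_coeff h 0 = 0" "fourier_coeff k 0 = 0" for h k
    using inv that by (simp add: shift_invariant_def B_def)
  define \<psi> where "\<psi> = orth_proj (model_space \<alpha>) ((1 / a) *\<^sub>C (A \<kappa> - L2_mult (zpow 1) (A (bshift \<kappa>))))"
  have \<psi>: "\<psi> \<in> model_space \<alpha>" "cinner \<psi> k = B \<kappa> k / a" if "k \<in> model_space \<alpha>" for k
  proof -
    show "\<psi> \<in> model_space \<alpha>" unfolding \<psi>_def by (rule orth_proj[OF model_space_subspace])
    have "A (bshift \<kappa>) \<in> hardy_space"
      using bounded_opsD(1)[OF A bs[OF \<kappa>(1)]] model_space_hardy by blast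
    then show "cinner \<psi> k = B \<kappa> k / a"
      using that by (simp add: \<psi>_def orth_proj[OF model_space_subspace] cinner_scaleC_left
          cinner_diff_left B_def cinner_bshift)
  qed
  obtain C where C: "C \<ge> 0" "\<And>x. x \<in> model_space \<theta> \<Longrightarrow> norm (A x) \<le> C * norm x"
    using bounded_opsD(4)[OF A] by auto
  define l where "l h = (B h \<mu> - fourier_coeff h 0 * cinner \<psi> \<mu>) / cnj b" for h
  \<comment> \<open>the factor \<open>5\<close> is \<open>1 + 2 * 2\<close>, as the backward shift is applied to both arguments and has norm at most \<open>2\<close>\<close>
  have l_bound: "norm (l h) \<le> ((5 * C + norm \<psi>) * norm \<mu> / norm b) * norm h" if h: "h \<in> model_space \<theta>" for h
  proof -
    have "norm (cinner (A h) \<mu>) \<le> (C * norm h) * norm \<mu>"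
      by (rule order_trans[OF cinner_bound mult_right_mono[OF C(2)[OF h] norm_ge_zero]])
    moreover have "norm (cinner (A (bshift h)) (bshift \<mu>)) \<le> (C * (2 * norm h)) * (2 * norm \<mu>)"
    proof -
      have "norm (A (bshift h)) \<le> C * (2 * norm h)"
        using C(2)[OF bs[OF h]] mult_left_mono[OF norm_bshift_le[of h] C(1)] by linarith
      then have "norm (A (bshift h)) * norm (bshift \<mu>) \<le> (C * (2 * norm h)) * (2 * norm \<mu>)"
        using C(1) by (intro mult_mono norm_bshift_le) auto
      then show ?thesis by (rule order_trans[OF cinner_bound])
    qed
    moreover have "norm (fourier_coeff h 0 * cinner \<psi> \<mu>) \<le> norm h * (norm \<psi> * norm \<mu>)"
      unfolding fourier_coeff_eq_cinner norm_mult
      using cinner_bound[of h "zpow 0"] cinner_bound[of \<psi> \<mu>] by (intro mult_mono) simp_all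
    moreover have "norm (B h \<mu> - fourier_coeff h 0 * cinner \<psi> \<mu>)
        \<le> norm (cinner (A h) \<mu>) + norm (cinner (A (bshift h)) (bshift \<mu>)) + norm (fourier_coeff h 0 * cinner \<psi> \<mu>)"
      unfolding B_def
      by (rule order_trans[OF norm_triangle_ineq4 add_right_mono[OF norm_triangle_ineq4]])
    ultimately have "norm (B h \<mu> - fourier_coeff h 0 * cinner \<psi> \<mu>) \<le> (5 * C + norm \<psi>) * norm \<mu> * norm h"
      by (simp add: algebra_simps)
    then have "norm (B h \<mu> - fourier_coeff h 0 * cinner \<psi> \<mu>) / norm b \<le> (5 * C + norm \<psi>) * norm \<mu> * norm h / norm b"
      by (rule divide_right_mono) simp
    then show ?thesis by (simp add: l_def norm_divide)
  qed
  have "\<exists>\<eta>\<in>model_space \<theta>. \<forall>h\<in>model_space \<theta>. l h = cinner h \<eta>"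
  proof (rule riesz_representation[OF model_space_subspace _ _ l_bound])
    show "l (x + y) = l x + l y" if "x \<in> model_space \<theta>" "y \<in> model_space \<theta>" for x y
      using that by (simp add: l_def B_add_l fourier_coeff_add algebra_simps add_divide_distrib diff_divide_distrib)
    show "l (c *\<^sub>C x) = c * l x" if "x \<in> model_space \<theta>" for c x
      using that by (simp add: l_def B_scale_l fourier_coeff_scaleC algebra_simps diff_divide_distrib)
  qed
  then obtain \<eta> where \<eta>: "\<eta> \<in> model_space \<theta>" "\<And>h. h \<in> model_space \<theta> \<Longrightarrow> cinner h \<eta> = l h" by metis
  show ?thesis
  proof (rule that)
    show "\<psi> \<in> model_space \<alpha>" using \<psi>(1) \<mu>(1) by blast
    show "\<eta> \<in> model_space \<theta>" by (rule \<eta>)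
    fix h k
    assume h: "h \<in> model_space \<theta>" "bdd h" and k: "k \<in> model_space \<alpha>" "bdd k"
    define r where "r = fourier_coeff h 0 / a"
    define s where "s = fourier_coeff k 0 / b"
    define h' where "h' = h - r *\<^sub>C \<kappa>"
    define k' where "k' = k - s *\<^sub>C \<mu>"
    have h': "h' \<in> model_space \<theta>" "bdd h'" "fourier_coeff h' 0 = 0"
      using h \<kappa> sub by (simp_all add: h'_def bdd_diff bdd_scaleC fourier_coeff_diff fourier_coeff_scaleC r_def a_def)
    have k': "k' \<in> model_space \<alpha>" "bdd k'" "fourier_coeff k' 0 = 0"
      using k \<mu> sub by (simp_all add: k'_def bdd_diff bdd_scaleC fourier_coeff_diff fourier_coeff_scaleC s_def b_def)
    have hr: "h = h' + r *\<^sub>C \<kappa>" and ks: "k = k' + s *\<^sub>C \<mu>" by (simp_all add: h'_def k'_def)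
    have B_h: "B h x = B h' x + r * B \<kappa> x" for x
      using h'(1) \<kappa>(1) sub by (subst hr) (simp add: B_add_l B_scale_l)
    have B_k: "B x k = B x k' + cnj s * B x \<mu>" for x
      by (subst ks) (simp add: B_add_r B_scale_r)
    have "B h k = B h' k' + cnj s * B h' \<mu> + r * B \<kappa> k"
      by (simp add: B_h[of k] B_k[of h'])
    also have "B h' k' = 0" using B_zero h' k' by blast
    also have "B h' \<mu> = B h \<mu> - r * B \<kappa> \<mu>" using B_h[of \<mu>] by simp
    also have "cnj s * (B h \<mu> - r * B \<kappa> \<mu>) = cnj (fourier_coeff k 0) * cinner h \<eta>"
      using \<kappa>(3) \<mu>(3) by (simp add: \<eta>(2)[OF h(1)] l_def \<psi>(2)[OF \<mu>(1)] r_def s_def)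
    also have "r * B \<kappa> k = fourier_coeff h 0 * cinner \<psi> k"
      using \<kappa>(3) by (simp add: \<psi>(2)[OF k(1)] r_def)
    finally show "cinner (A h) k - cinner (A (bshift h)) (bshift k)
        = fourier_coeff h 0 * cinner \<psi> k + cnj (fourier_coeff k 0) * cinner h \<eta>"
      by (simp add: B_def)
  qed
qed

text \<open>
  In the nontrivial direction \<open>D\<close> below compares \<open>A\<close> with its candidate symbol.  Both have the same
  defect, so \<open>D\<close> is unchanged when both arguments are shifted back, and repeated shifts drive it to \<open>0\<close>.
\<close>

theorem att_operators_iff_shift_invariant:
  assumes inner: "inner_function \<theta>" "inner_function \<alpha>"
    and nc: "nonconstant \<theta>" "nonconstant \<alpha>"
  shows "A \<in> att_operators \<theta> \<alpha> \<longleftrightarrow>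
    A \<in> bounded_ops (model_space \<theta>) (model_space \<alpha>) \<and> shift_invariant \<theta> \<alpha> A"
proof
  assume "A \<in> att_operators \<theta> \<alpha>"
  then show "A \<in> bounded_ops (model_space \<theta>) (model_space \<alpha>) \<and> shift_invariant \<theta> \<alpha> A"
    using att_operators_shift_invariant[OF inner] by (auto simp: att_operators_def)
next
  assume "A \<in> bounded_ops (model_space \<theta>) (model_space \<alpha>) \<and> shift_invariant \<theta> \<alpha> A"
  then have A: "A \<in> bounded_ops (model_space \<theta>) (model_space \<alpha>)" and inv: "shift_invariant \<theta> \<alpha> A" by auto
  obtain \<psi> \<eta> where \<psi>: "\<psi> \<in> model_space \<alpha>" and \<eta>: "\<eta> \<in> model_space \<theta>"
    and dec: "\<And>h k. h \<in> model_space \<theta> \<Longrightarrow> k \<in> model_space \<alpha> \<Longrightarrow> bdd h \<Longrightarrow> bdd k \<Longrightarrow>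
      cinner (A h) k - cinner (A (bshift h)) (bshift k)
        = fourier_coeff h 0 * cinner \<psi> k + cnj (fourier_coeff k 0) * cinner h \<eta>"
    using shift_invariant_decomposition[OF inner nc A inv] by blast
  have \<psi>H: "\<psi> \<in> hardy_space" and \<eta>H: "\<eta> \<in> hardy_space" using \<psi> \<eta> model_space_hardy by auto
  define \<phi> where "\<phi> = \<psi> + L2_cnj \<eta>"
  have \<phi>: "cinner (L2_mult \<phi> h) k = cinner (L2_mult \<psi> h) k + cnj (cinner (L2_mult \<eta> k) h)"
    if "bdd h" "bdd k" for h k
    using that by (simp add: \<phi>_def L2_mult_add_left cinner_add_left cinner_L2_cnj_mult)
  define D where "D h k = cinner (A h) k - cinner (L2_mult \<phi> h) k" for h k
  have D_bshift: "D h k = D (bshift h) (bshift k)"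
    if h: "h \<in> model_space \<theta>" "bdd h" and k: "k \<in> model_space \<alpha>" "bdd k" for h k
  proof -
    have H: "h \<in> hardy_space" "k \<in> hardy_space" using h k model_space_hardy by auto
    have "cnj (cinner \<eta> h) = cinner h \<eta>" by (rule cinner_commute[symmetric])
    then have "cinner (L2_mult \<phi> (bshift h)) (bshift k) = cinner (L2_mult \<phi> h) k
        - (fourier_coeff h 0 * cinner \<psi> k + cnj (fourier_coeff k 0) * cinner h \<eta>)"
      by (simp add: \<phi> bdd_bshift h k analytic_symbol_bshift[OF \<psi>H] analytic_symbol_bshift[OF \<eta>H] H)
    with dec[OF h(1) k(1) h(2) k(2)] show ?thesis by (simp add: D_def algebra_simps)
  qed
  have D_zero: "D h k = 0"
    if h: "h \<in> model_space \<theta>" "bdd h" and k: "k \<in> model_space \<alpha>" "bdd k" for h k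
  proof -
    have H: "h \<in> hardy_space" "k \<in> hardy_space" using h k model_space_hardy by auto
    let ?h = "\<lambda>n. (bshift ^^ n) h" and ?k = "\<lambda>n. (bshift ^^ n) k"
    have const: "D (?h n) (?k n) = D h k" for n
    proof (induction n)
      case (Suc n)
      then show ?case
        using D_bshift[of "?h n" "?k n"] h k inner
        by (simp add: bshift_funpow_model_space bdd_bshift_funpow)
    qed simp
    obtain C where C: "\<And>x. x \<in> model_space \<theta> \<Longrightarrow> norm (A x) \<le> C * norm x"
      using bounded_opsD(4)[OF A] by auto
    have "(\<lambda>n. cinner (A (?h n)) (?k n)) \<longlonglongrightarrow> 0"
    proof (rule Lim_null_comparison)
      show "\<forall>\<^sub>F n in sequentially. norm (cinner (A (?h n)) (?k n)) \<le> C * norm (?h n) * norm (?k n)"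
      proof (intro always_eventually allI)
        fix n
        have "norm (A (?h n)) \<le> C * norm (?h n)"
          using C bshift_funpow_model_space[OF inner(1) h(1)] by blast
        then show "norm (cinner (A (?h n)) (?k n)) \<le> C * norm (?h n) * norm (?k n)"
          by (rule order_trans[OF cinner_bound mult_right_mono[OF _ norm_ge_zero]])
      qed
      have "(\<lambda>n. C * norm (?h n) * norm (?k n)) \<longlonglongrightarrow> C * 0 * 0"
        by (intro tendsto_intros bshift_funpow_tendsto_0 H)
      then show "(\<lambda>n. C * norm (?h n) * norm (?k n)) \<longlonglongrightarrow> 0" by simp
    qed
    moreover have "(\<lambda>n. cinner (L2_mult \<phi> (?h n)) (?k n)) \<longlonglongrightarrow> 0 + cnj 0"
      unfolding \<phi>[OF bdd_bshift_funpow[OF h(2)] bdd_bshift_funpow[OF k(2)]]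
      by (intro tendsto_add tendsto_cnj analytic_symbol_bshift_funpow_tendsto_0 \<psi>H \<eta>H H h k)
    ultimately have "(\<lambda>n. D (?h n) (?k n)) \<longlonglongrightarrow> 0 - (0 + cnj 0)"
      unfolding D_def by (rule tendsto_diff)
    then show ?thesis by (simp add: const LIMSEQ_const_iff)
  qed
  then show "A \<in> att_operators \<theta> \<alpha>"
    using A by (auto simp: att_operators_iff[OF inner(2)] D_def intro!: exI[of _ \<phi>])
qed

section \<open>Zero sets of functions in the Hardy space\<close>

lemma cinner_zpow_mult_integral:
  "cinner (L2_mult (zpow n) f) g = (\<integral>z. fun_of f z * cnj (fun_of g z) * z powi n \<partial>circle_measure)"
  unfolding L2_mult_commute[of "zpow n"] cinner_L2_mult[OF bdd_zpow]
proof (rule integral_cong_AE)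
  show "AE z in circle_measure. fun_of f z * fun_of (zpow n) z * cnj (fun_of g z)
      = fun_of f z * cnj (fun_of g z) * z powi n"
    using AE_fun_of_zpow[of n] by eventually_elim simp
qed simp_all

text \<open>
  Helson's argument: let \<open>m\<close> be the order of the zero of \<open>f\<close> at the origin, \<open>M\<close> the space of all
  functions with vanishing coefficients up to \<open>m\<close> that are \<open>0\<close> wherever \<open>f\<close> is, and \<open>u = f - P\<^sub>M f\<close>.
  Then \<open>u \<noteq> 0\<close> also vanishes on the zero set of \<open>f\<close>.  Since \<open>z\<^sup>n u\<close> is in \<open>M\<close> for \<open>n \<ge> 1\<close>, it is orthogonal
  to \<open>u\<close>, so \<open>\<bar>u\<bar>\<^sup>2\<close> has no Fourier coefficients except the zeroth one.  Thus \<open>\<bar>u\<bar>\<close> is a nonzero constant,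
  and the zero set of \<open>f\<close> is a null set.
\<close>

lemma hardy_nonzero_AE:
  assumes f: "f \<in> hardy_space" "f \<noteq> 0"
  shows "AE z in circle_measure. fun_of f z \<noteq> 0"
proof -
  \<comment> \<open>the indicator function of the zero set of \<open>f\<close>\<close>
  define e where "e = L2_of (\<lambda>z. if fun_of f z = 0 then 1 else 0)"
  have e_AE: "AE z in circle_measure. fun_of e z = (if fun_of f z = 0 then 1 else 0)"
    unfolding e_def by (intro AE_fun_of_L2_of square_integrable_bounded[where C = 1]) auto
  have e: "bdd e" by (rule bddI[of _ 1]) (use e_AE in eventually_elim, simp)
  have cnj_e: "L2_cnj e = e"
    by (rule circle_L2_eqI) (use AE_fun_of_L2_cnj[of e] e_AE in eventually_elim, simp)
  have ef: "L2_mult e f = 0"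
    by (rule circle_L2_eqI)
      (use AE_fun_of_mult'[OF e, of f] e_AE AE_fun_of_zero in eventually_elim, simp)
  have "\<exists>k. fourier_coeff f (int k) \<noteq> 0"
  proof (rule ccontr)
    assume "\<nexists>k. fourier_coeff f (int k) \<noteq> 0"
    then have "fourier_coeff f n = fourier_coeff 0 n" for n
      using f(1) by (cases "n < 0") (auto simp: hardy_space_def fourier_coeff_eq_cinner[of 0] dest: spec[of _ "nat n"])
    then show False using fourier_coeff_unique f(2) by blast
  qed
  then obtain m :: nat where m: "fourier_coeff f (int m) \<noteq> 0" "\<And>k. k < m \<Longrightarrow> fourier_coeff f (int k) = 0"
    using exists_least_iff[of "\<lambda>k. fourier_coeff f (int k) \<noteq> 0"] by blast
  define G where "G = zpow ` {..int m} \<union> range (L2_mult e)"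
  define M where "M = {g. \<forall>x\<in>G. cinner g x = 0}"
  have sub: "complex_vector.subspace M" "closed M"
    unfolding M_def by (rule closed_subspace_orthogonal)+
  have M_iff: "g \<in> M \<longleftrightarrow> L2_mult e g = 0 \<and> (\<forall>j\<le>int m. fourier_coeff g j = 0)" for g
  proof -
    have "cinner g (L2_mult e w) = cinner (L2_mult e g) w" for w
      by (simp add: cinner_L2_mult_adjoint e cnj_e)
    then have "(\<forall>w. cinner g (L2_mult e w) = 0) \<longleftrightarrow> L2_mult e g = 0"
      by (metis cinner_self_eq_0 cinner_zero_left)
    moreover have "g \<in> M \<longleftrightarrow> (\<forall>w. cinner g (L2_mult e w) = 0) \<and> (\<forall>j\<le>int m. cinner g (zpow j) = 0)"
      unfolding M_def G_def by blast
    ultimately show ?thesis by (simp add: fourier_coeff_eq_cinner)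
  qed
  define u where "u = f - orth_proj M f"
  have PM: "orth_proj M f \<in> M" by (rule orth_proj[OF sub])
  have eu: "L2_mult e u = 0"
    using PM by (simp add: u_def L2_mult_diff_right[OF e] ef M_iff)
  have u_low: "fourier_coeff u j = 0" if "j < int m" for j
  proof -
    have "fourier_coeff f j = 0"
      using f(1) m(2)[of "nat j"] that by (cases "j < 0") (auto simp: hardy_space_def)
    then show ?thesis using PM that by (simp add: u_def fourier_coeff_diff M_iff)
  qed
  have "fourier_coeff u (int m) \<noteq> 0"
    using PM m(1) by (simp add: u_def fourier_coeff_diff M_iff)
  then have "u \<noteq> 0" by (auto simp: fourier_coeff_eq_cinner)
  have shift_M: "L2_mult (zpow n) u \<in> M" if "n > 0" for n
    using that by (simp add: M_iff L2_mult_inner_zpow[OF e] eu fourier_coeff_zpow_mult u_low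
        L2_mult_scaleC_right[of "zpow n" 0 0, simplified])
  have orth: "cinner u x = 0" if "x \<in> M" for x
    using orth_proj(2)[OF sub that, of f] by (simp add: u_def cinner_diff_left)
  have autocorr: "cinner (L2_mult (zpow n) u) u = 0" if "n \<noteq> 0" for n
  proof (cases "n > 0")
    case True
    then show ?thesis using orth[OF shift_M] cinner_eq_zero_comm by blast
  next
    case False
    then show ?thesis using that orth[OF shift_M[of "- n"]] by (simp add: cinner_zpow_mult)
  qed
  define F where "F z = fun_of u z * cnj (fun_of u z)" for z
  define c where "c = complex_of_real ((norm u)\<^sup>2)"
  have F: "integrable circle_measure F"
    unfolding F_def by (intro integrable_square_integrable_mult square_integrable_fun_of)
  have int_F: "(\<integral>z. F z * z powi n \<partial>circle_measure) = (if n = 0 then c else 0)" for n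
  proof -
    have "(\<integral>z. F z * z powi n \<partial>circle_measure) = cinner (L2_mult (zpow n) u) u"
      by (simp add: F_def cinner_zpow_mult_integral)
    then show ?thesis using autocorr[of n] by (simp add: c_def cinner_self)
  qed
  have int_powi: "integrable circle_measure (\<lambda>z. g z * z powi n)" if "integrable circle_measure g"
    for g :: "complex \<Rightarrow> complex" and n
    using AE_norm_powi[of n]
    by (intro integrable_mult_bounded[OF that, where C = 1]) (auto elim: eventually_mono)
  have "AE z in circle_measure. F z - c = 0"
  proof (rule integrable_fourier_unique)
    show "integrable circle_measure (\<lambda>z. F z - c)" using F by simp
    show "(\<integral>z. (F z - c) * z powi n \<partial>circle_measure) = 0" for n
      using int_powi[OF F, of n] int_powi[of "\<lambda>_. c" n]
      by (simp add: left_diff_distrib int_F integral_powi)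
  qed
  moreover have "AE z in circle_measure. fun_of (L2_mult e u) z = fun_of e z * fun_of u z"
    by (rule AE_fun_of_mult'[OF e])
  ultimately show ?thesis
    using AE_fun_of_zero e_AE
  proof eventually_elim
    case (elim z)
    have "c \<noteq> 0" using \<open>u \<noteq> 0\<close> by (simp add: c_def)
    then have "fun_of u z \<noteq> 0" using elim(1) by (auto simp: F_def)
    then show ?case using elim by (auto simp: eu split: if_splits)
  qed
qed


section \<open>Transitivity\<close>

lemma bounded_opsI:
  assumes "\<And>x. x \<in> H \<Longrightarrow> T x \<in> K" and "complex_vector.subspace H"
    and "\<And>x y. x \<in> H \<Longrightarrow> y \<in> H \<Longrightarrow> T (x + y) = T x + T y"
    and "\<And>c x. x \<in> H \<Longrightarrow> T (c *\<^sub>C x) = c *\<^sub>C T x"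
    and "\<And>x. x \<in> H \<Longrightarrow> norm (T x) \<le> B * norm x"
  shows "(\<lambda>x\<in>H. T x) \<in> bounded_ops H K"
  using assms(1-4)
  by (auto simp: bounded_ops_def complex_vector.subspace_add complex_vector.subspace_scale
      intro!: exI[of _ B] assms(5))

lemma zpow_symbol_att_operator:
  assumes "inner_function \<alpha>"
  shows "(\<lambda>x\<in>model_space \<theta>. orth_proj (model_space \<alpha>) (L2_mult (zpow n) x)) \<in> att_operators \<theta> \<alpha>"
proof -
  note P = model_space_subspace[of \<alpha>]
  have "(\<lambda>x\<in>model_space \<theta>. orth_proj (model_space \<alpha>) (L2_mult (zpow n) x))
      \<in> bounded_ops (model_space \<theta>) (model_space \<alpha>)"
  proof (rule bounded_opsI[where B = 1])
    show "norm (orth_proj (model_space \<alpha>) (L2_mult (zpow n) x)) \<le> 1 * norm x" for x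
      using norm_orth_proj_le[OF P, of "L2_mult (zpow n) x"] by simp
  qed (simp_all add: orth_proj[OF P] model_space_subspace L2_mult_add_right L2_mult_scaleC_right
      orth_proj_linear[OF P])
  then show ?thesis by (auto simp: att_operators_def intro!: exI[of _ "zpow n"])
qed

text \<open>
  The symbols \<open>z\<^sup>n\<close> alone already force all Fourier coefficients of \<open>f cnj g\<close> to vanish.
\<close>

lemma separating_vectors:
  assumes \<alpha>: "inner_function \<alpha>" and f: "f \<in> model_space \<theta>" and g: "g \<in> model_space \<alpha>"
    and zero: "\<And>T. T \<in> att_operators \<theta> \<alpha> \<Longrightarrow> cinner (T f) g = 0"
  shows "f = 0 \<or> g = 0"
proof (rule ccontr)
  assume nz: "\<not> (f = 0 \<or> g = 0)"
  have "AE z in circle_measure. fun_of f z * cnj (fun_of g z) = 0"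
  proof (rule integrable_fourier_unique)
    show "integrable circle_measure (\<lambda>z. fun_of f z * cnj (fun_of g z))"
      by (intro integrable_square_integrable_mult square_integrable_fun_of)
    show "(\<integral>z. fun_of f z * cnj (fun_of g z) * z powi n \<partial>circle_measure) = 0" for n
      using zero[OF zpow_symbol_att_operator[OF \<alpha>, where \<theta> = \<theta> and n = n]] f g
      by (simp add: orth_proj[OF model_space_subspace] cinner_zpow_mult_integral)
  qed
  moreover have "AE z in circle_measure. fun_of f z \<noteq> 0" "AE z in circle_measure. fun_of g z \<noteq> 0"
    using nz f g by (auto intro!: hardy_nonzero_AE model_space_hardy)
  ultimately have "AE z in circle_measure. False" by eventually_elim simp
  then show False by simp
qed

text \<open>
  The coefficient of \<open>t x\<close> with respect to a vector spanning the range is a bounded functional of \<open>x\<close>,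
  hence represented by some \<open>b\<close>.
\<close>

lemma rank_at_most_1_cases:
  fixes H :: "'a::complex_inner set" and K :: "'b::{complex_inner, complete_space} set"
  assumes H: "complex_vector.subspace H" and K: "complex_vector.subspace K" "closed K"
    and t: "t \<in> rank_at_most 1 H K"
  obtains a b where "a \<in> H" "b \<in> K" "t = rank_two_op K a b 0 0"
proof -
  have tb: "t \<in> bounded_ops K H" using t by (auto simp: rank_at_most_def trace_class_def)
  then have off_K: "t x = undefined" if "x \<notin> K" for x
    using that by (auto simp: bounded_ops_def PiE_def extensional_def)
  note lin = bounded_opsD[OF tb]
  show thesis
  proof (cases "\<forall>x\<in>K. t x = 0")
    case True
    have "t = rank_two_op K 0 0 0 0"
      by (rule ext) (simp add: rank_two_op_def off_K True)
    then show thesis by (rule that[OF complex_vector.subspace_0[OF H] complex_vector.subspace_0[OF K(1)]])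
  next
    case False
    then obtain x0 where x0: "x0 \<in> K" "t x0 \<noteq> 0" by blast
    define a where "a = t x0"
    obtain S where S: "finite S" "card S \<le> 1" "t ` K \<subseteq> complex_vector.span S"
      using t by (auto simp: rank_at_most_def)
    have "S \<noteq> {}" using S(3) x0 by auto
    then obtain s where s: "S = {s}" using S(1,2) by (metis card_1_singletonE card_0_eq le_less less_one)
    have span_s: "\<exists>c. t x = c *\<^sub>C s" if "x \<in> K" for x
      using S(3) that by (auto simp: s complex_vector.span_singleton)
    obtain c0 where c0: "a = c0 *\<^sub>C s" using span_s[OF x0(1)] by (auto simp: a_def)
    have "c0 \<noteq> 0" using c0 x0(2) by (auto simp: a_def)
    define l where "l x = cinner (t x) a / cinner a a" for x
    have tl: "t x = l x *\<^sub>C a" if x: "x \<in> K" for x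
    proof -
      obtain c where c: "t x = c *\<^sub>C s" using span_s[OF x] by blast
      then have "t x = (c / c0) *\<^sub>C a" using \<open>c0 \<noteq> 0\<close> by (simp add: c0 scaleC_scaleC)
      then show ?thesis using x0(2) by (simp add: l_def cinner_scaleC_left a_def)
    qed
    obtain B where B: "\<And>x. x \<in> K \<Longrightarrow> norm (t x) \<le> B * norm x" using lin(4) by blast
    have "\<exists>b\<in>K. \<forall>x\<in>K. l x = cinner x b"
    proof (rule riesz_representation[OF K])
      fix x assume x: "x \<in> K"
      have "norm (cinner (t x) a) \<le> B * norm x * norm a"
        by (rule order_trans[OF cinner_bound mult_right_mono[OF B[OF x] norm_ge_zero]])
      then have "norm (cinner (t x) a) / norm (cinner a a) \<le> B * norm x * norm a / norm (cinner a a)"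
        by (rule divide_right_mono) simp
      then show "norm (l x) \<le> (B * norm a / norm (cinner a a)) * norm x"
        by (simp add: l_def norm_divide mult_ac)
    qed (simp_all add: l_def lin cinner_add_left cinner_scaleC_left add_divide_distrib)
    then obtain b where b: "b \<in> K" "\<forall>x\<in>K. l x = cinner x b" by blast
    have "t = rank_two_op K a b 0 0"
      by (rule ext) (simp add: rank_two_op_def off_K tl b(2))
    moreover have "a \<in> H" unfolding a_def by (rule lin(1)[OF x0(1)])
    ultimately show thesis using that b(1) by blast
  qed
qed

lemma att_operators_transitive:
  assumes \<alpha>: "inner_function \<alpha>"
  shows "transitive_space (model_space \<theta>) (model_space \<alpha>) (att_operators \<theta> \<alpha>)"
proof -
  let ?H = "model_space \<theta>" and ?K = "model_space \<alpha>"
  note H = model_space_subspace[of \<theta>] and K = model_space_subspace[of \<alpha>]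
  have H0: "0 \<in> ?H" and K0: "0 \<in> ?K" using model_space_subspaceD(1) by auto
  have zero: "(\<lambda>x\<in>?K. 0) = rank_two_op ?K (0::circle_L2) 0 0 0" by (simp add: rank_two_op_def)
  have S: "att_operators \<theta> \<alpha> \<subseteq> bounded_ops ?H ?K" by (auto simp: att_operators_def)
  have "t = (\<lambda>x\<in>?K. 0)" if t: "t \<in> preannihilator ?H ?K (att_operators \<theta> \<alpha>)" "t \<in> rank_at_most 1 ?H ?K" for t
  proof -
    obtain a b where ab: "a \<in> ?H" "b \<in> ?K" "t = rank_two_op ?K a b 0 0"
      using rank_at_most_1_cases[OF H(1) K t(2)] by blast
    have "cinner (T a) b = 0" if "T \<in> att_operators \<theta> \<alpha>" for T
    proof -
      have "trace_pairing ?H ?K T t = cinner (T a) b + cinner (T 0) 0"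
        unfolding ab(3) using S that ab H0 K0 by (intro trace_pairing_rank_two_op H K) auto
      then show ?thesis using t(1) that by (simp add: preannihilator_def)
    qed
    then have "a = 0 \<or> b = 0" by (rule separating_vectors[OF \<alpha> ab(1,2)])
    then show ?thesis unfolding ab(3) by (auto simp: rank_two_op_def)
  qed
  moreover have "(\<lambda>x\<in>?K. 0) \<in> preannihilator ?H ?K (att_operators \<theta> \<alpha>)"
  proof -
    have "trace_pairing ?H ?K T (rank_two_op ?K 0 0 0 0) = 0" if "T \<in> att_operators \<theta> \<alpha>" for T
      using trace_pairing_rank_two_op[OF H(1) K(1) H0 K0 H0 K0] S that by auto
    then show ?thesis
      unfolding zero using rank_two_op_in_trace_class[OF H(1) K(1) H0 K0 H0 K0] by (simp add: preannihilator_def)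
  qed
  moreover have "(\<lambda>x\<in>?K. 0) \<in> rank_at_most 1 ?H ?K"
    using rank_two_op_in_trace_class[OF H(1) K(1) H0 K0 H0 K0]
    by (auto simp: rank_at_most_def zero[symmetric] intro!: exI[of _ "{}"])
  ultimately show ?thesis unfolding transitive_space_def by blast
qed


section \<open>Closedness and reflexivity\<close>

lemma topspace_weak_star: "topspace (weak_star_topology H K) = bounded_ops H K"
  if "complex_vector.subspace H" "complex_vector.subspace K"
proof -
  have "rank_two_op K 0 0 0 0 \<in> trace_class H K"
    by (intro rank_two_op_in_trace_class that complex_vector.subspace_0)
  then have "bounded_ops H K \<in> {{T \<in> bounded_ops H K. trace_pairing H K T t \<in> U} | t U. t \<in> trace_class H K \<and> open U}"
    by (intro CollectI exI[of _ "rank_two_op K 0 0 0 0"] exI[of _ UNIV]) auto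
  then show ?thesis unfolding weak_star_topology_def topology_generated_by_topspace by auto
qed

lemma topspace_weak_operator: "topspace (weak_operator_topology H K) = bounded_ops H K"
  if "complex_vector.subspace H" "complex_vector.subspace K"
proof -
  have "bounded_ops H K \<in> {{T \<in> bounded_ops H K. cinner (T x) y \<in> U} | x y U. x \<in> H \<and> y \<in> K \<and> open U}"
    using complex_vector.subspace_0[OF that(1)] complex_vector.subspace_0[OF that(2)]
    by (intro CollectI exI[of _ 0] exI[of _ UNIV]) auto
  then show ?thesis unfolding weak_operator_topology_def topology_generated_by_topspace by auto
qed

lemma continuous_trace_pairing:
  assumes "complex_vector.subspace H" "complex_vector.subspace K" "t \<in> trace_class H K"
  shows "continuous_map (weak_star_topology H K) euclidean (\<lambda>T. trace_pairing H K T t)"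
  unfolding continuous_map_def topspace_weak_star[OF assms(1,2)]
  unfolding weak_star_topology_def
  using assms(3) by (auto intro!: topology_generated_by_Basis simp: open_openin[symmetric])

lemma continuous_matrix_coefficient:
  assumes "complex_vector.subspace H" "complex_vector.subspace K" "x \<in> H" "y \<in> K"
  shows "continuous_map (weak_operator_topology H K) euclidean (\<lambda>T. cinner (T x) y)"
  unfolding continuous_map_def topspace_weak_operator[OF assms(1,2)]
  unfolding weak_operator_topology_def
  using assms(3,4) by (auto intro!: topology_generated_by_Basis simp: open_openin[symmetric])

lemma closedin_zero_sets:
  fixes F :: "'i \<Rightarrow> 'a \<Rightarrow> complex"
  assumes "\<And>i. i \<in> I \<Longrightarrow> continuous_map X euclidean (F i)"
  shows "closedin X {x \<in> topspace X. \<forall>i\<in>I. F i x = 0}"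
proof -
  have "closedin X (topspace X \<inter> (\<Inter>i\<in>I. {x \<in> topspace X. F i x \<in> {0}}))"
  proof (cases "I = {}")
    case False
    then show ?thesis
      using assms by (intro closedin_Int closedin_INT closedin_topspace
          closedin_continuous_map_preimage[where Y = euclidean]) auto
  qed simp
  also have "topspace X \<inter> (\<Inter>i\<in>I. {x \<in> topspace X. F i x \<in> {0}}) = {x \<in> topspace X. \<forall>i\<in>I. F i x = 0}"
    by auto
  finally show ?thesis .
qed

definition shift_tests :: "circle_L2 \<Rightarrow> circle_L2 \<Rightarrow> (circle_L2 \<times> circle_L2) set" where
  "shift_tests \<theta> \<alpha> = {(h, k). h \<in> model_space \<theta> \<and> k \<in> model_space \<alpha> \<and> bdd h \<and> bdd k \<and>
     fourier_coeff h 0 = 0 \<and> fourier_coeff k 0 = 0}"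

text \<open>
  The operator \<open>h \<otimes> k - S\<^sup>* h \<otimes> S\<^sup>* k\<close>, whose pairing with \<open>T\<close> is the defect of shift invariance of \<open>T\<close>
  at \<open>(h, k)\<close>.
\<close>

definition shift_test_op :: "circle_L2 \<Rightarrow> circle_L2 \<times> circle_L2 \<Rightarrow> circle_L2 \<Rightarrow> circle_L2" where
  "shift_test_op \<alpha> = (\<lambda>(h, k). rank_two_op (model_space \<alpha>) h k (- bshift h) (bshift k))"

lemma shift_test_op:
  assumes inner: "inner_function \<theta>" "inner_function \<alpha>" and p: "p \<in> shift_tests \<theta> \<alpha>"
  shows "shift_test_op \<alpha> p \<in> trace_class (model_space \<theta>) (model_space \<alpha>)"
    and "shift_test_op \<alpha> p \<in> rank_at_most 2 (model_space \<theta>) (model_space \<alpha>)"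
    and "T \<in> bounded_ops (model_space \<theta>) (model_space \<alpha>) \<Longrightarrow>
      trace_pairing (model_space \<theta>) (model_space \<alpha>) T (shift_test_op \<alpha> p)
        = cinner (T (fst p)) (snd p) - cinner (T (bshift (fst p))) (bshift (snd p))"
proof -
  obtain h k where hk: "p = (h, k)" "h \<in> model_space \<theta>" "k \<in> model_space \<alpha>"
    using p by (auto simp: shift_tests_def)
  have b: "bshift h \<in> model_space \<theta>" "bshift k \<in> model_space \<alpha>"
    using inner hk bshift_model_space by auto
  have nb: "- bshift h \<in> model_space \<theta>"
    using b model_space_subspaceD(3)[of "bshift h" \<theta> "- 1"] by (simp add: scaleC_minus1_left)
  note facts = model_space_subspace(1)[of \<theta>] model_space_subspace(1)[of \<alpha>] hk(2,3) nb b(2)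
  show "shift_test_op \<alpha> p \<in> trace_class (model_space \<theta>) (model_space \<alpha>)"
    "shift_test_op \<alpha> p \<in> rank_at_most 2 (model_space \<theta>) (model_space \<alpha>)"
    unfolding shift_test_op_def hk(1) prod.case
    by (rule rank_two_op_in_trace_class[OF facts], rule rank_two_op_rank_at_most_2[OF facts])
  assume T: "T \<in> bounded_ops (model_space \<theta>) (model_space \<alpha>)"
  have "T (- bshift h) = - T (bshift h)"
    using bounded_opsD(3)[OF T b(1), of "- 1"] by (simp add: scaleC_minus1_left)
  then have "cinner (T (- bshift h)) (bshift k) = - cinner (T (bshift h)) (bshift k)"
    by (simp add: cinner.minus_left)
  then show "trace_pairing (model_space \<theta>) (model_space \<alpha>) T (shift_test_op \<alpha> p)
        = cinner (T (fst p)) (snd p) - cinner (T (bshift (fst p))) (bshift (snd p))"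
    using trace_pairing_rank_two_op[OF facts T] by (simp add: shift_test_op_def hk(1))
qed

lemma att_operators_eq_zero_set:
  assumes "inner_function \<theta>" "inner_function \<alpha>" "nonconstant \<theta>" "nonconstant \<alpha>"
  shows "att_operators \<theta> \<alpha> = {T \<in> bounded_ops (model_space \<theta>) (model_space \<alpha>).
    \<forall>p\<in>shift_tests \<theta> \<alpha>. cinner (T (fst p)) (snd p) - cinner (T (bshift (fst p))) (bshift (snd p)) = 0}"
  using att_operators_iff_shift_invariant[OF assms]
  by (auto simp: shift_invariant_def shift_tests_def)

lemma att_operators_eq_annihilator:
  assumes "inner_function \<theta>" "inner_function \<alpha>" "nonconstant \<theta>" "nonconstant \<alpha>"
  shows "att_operators \<theta> \<alpha>
    = annihilator (model_space \<theta>) (model_space \<alpha>) (shift_test_op \<alpha> ` shift_tests \<theta> \<alpha>)"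
  unfolding att_operators_eq_zero_set[OF assms] annihilator_def
  using shift_test_op(3)[OF assms(1,2)] by auto

lemma att_operators_subspace:
  assumes "inner_function \<theta>" "inner_function \<alpha>" "nonconstant \<theta>" "nonconstant \<alpha>"
  shows "operator_subspace (model_space \<theta>) (model_space \<alpha>) (att_operators \<theta> \<alpha>)"
proof -
  let ?H = "model_space \<theta>" and ?K = "model_space \<alpha>"
  note eq = att_operators_eq_zero_set[OF assms]
  note H = model_space_subspace(1)[of \<theta>]
  note K = model_space_subspaceD[where \<theta> = \<alpha>]
  have bs: "fst p \<in> ?H \<and> bshift (fst p) \<in> ?H" if "p \<in> shift_tests \<theta> \<alpha>" for p
    using that bshift_model_space assms by (auto simp: shift_tests_def)
  show ?thesis
    unfolding operator_subspace_def
  proof (intro conjI ballI allI)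
    show "att_operators \<theta> \<alpha> \<subseteq> bounded_ops ?H ?K" by (auto simp: att_operators_def)
    have "(\<lambda>x\<in>?H. 0) \<in> bounded_ops ?H ?K"
      by (rule bounded_opsI[OF _ H, where B = 0]) (use K in auto)
    then show "(\<lambda>x\<in>?H. 0) \<in> att_operators \<theta> \<alpha>" using bs by (auto simp: eq)
  next
    fix A B assume AB: "A \<in> att_operators \<theta> \<alpha>" "B \<in> att_operators \<theta> \<alpha>"
    then have A: "A \<in> bounded_ops ?H ?K" and B: "B \<in> bounded_ops ?H ?K" by (auto simp: att_operators_def)
    obtain a where a: "\<And>x. x \<in> ?H \<Longrightarrow> norm (A x) \<le> a * norm x" using bounded_opsD(4)[OF A] by blast
    obtain b where b: "\<And>x. x \<in> ?H \<Longrightarrow> norm (B x) \<le> b * norm x" using bounded_opsD(4)[OF B] by blast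
    have "(\<lambda>x\<in>?H. A x + B x) \<in> bounded_ops ?H ?K"
    proof (rule bounded_opsI[OF _ H, where B = "a + b"])
      show "norm (A x + B x) \<le> (a + b) * norm x" if "x \<in> ?H" for x
        using norm_triangle_mono[OF a[OF that] b[OF that]] by (simp add: distrib_right)
    qed (simp_all add: bounded_opsD[OF A] bounded_opsD[OF B] K scaleC_add_right)
    then show "(\<lambda>x\<in>?H. A x + B x) \<in> att_operators \<theta> \<alpha>"
      using AB bs by (simp add: eq cinner_add_left)
  next
    fix c A assume AA: "A \<in> att_operators \<theta> \<alpha>"
    then have A: "A \<in> bounded_ops ?H ?K" by (auto simp: att_operators_def)
    obtain a where a: "\<And>x. x \<in> ?H \<Longrightarrow> norm (A x) \<le> a * norm x" using bounded_opsD(4)[OF A] by blast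
    have "(\<lambda>x\<in>?H. c *\<^sub>C A x) \<in> bounded_ops ?H ?K"
    proof (rule bounded_opsI[OF _ H, where B = "norm c * a"])
      show "norm (c *\<^sub>C A x) \<le> norm c * a * norm x" if "x \<in> ?H" for x
        using mult_left_mono[OF a[OF that], of "norm c"] by (simp add: norm_scaleC mult.assoc)
    qed (simp_all add: bounded_opsD[OF A] K scaleC_add_right scaleC_scaleC mult.commute)
    then show "(\<lambda>x\<in>?H. c *\<^sub>C A x) \<in> att_operators \<theta> \<alpha>"
      using AA bs by (simp add: eq cinner_scaleC_left)
  qed
qed

lemma att_operators_weak_star_closed:
  assumes "inner_function \<theta>" "inner_function \<alpha>" "nonconstant \<theta>" "nonconstant \<alpha>"
  shows "closedin (weak_star_topology (model_space \<theta>) (model_space \<alpha>)) (att_operators \<theta> \<alpha>)"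
proof -
  note sub = model_space_subspace(1)[of \<theta>] model_space_subspace(1)[of \<alpha>]
  have "att_operators \<theta> \<alpha> = {T \<in> topspace (weak_star_topology (model_space \<theta>) (model_space \<alpha>)).
      \<forall>p\<in>shift_tests \<theta> \<alpha>. trace_pairing (model_space \<theta>) (model_space \<alpha>) T (shift_test_op \<alpha> p) = 0}"
    by (auto simp: att_operators_eq_annihilator[OF assms] annihilator_def topspace_weak_star[OF sub])
  then show ?thesis
    using closedin_zero_sets[OF continuous_trace_pairing[OF sub shift_test_op(1)[OF assms(1,2)]]] by simp
qed

lemma att_operators_weak_operator_closed:
  assumes "inner_function \<theta>" "inner_function \<alpha>" "nonconstant \<theta>" "nonconstant \<alpha>"
  shows "closedin (weak_operator_topology (model_space \<theta>) (model_space \<alpha>)) (att_operators \<theta> \<alpha>)"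
proof -
  note sub = model_space_subspace(1)[of \<theta>] model_space_subspace(1)[of \<alpha>]
  have "continuous_map (weak_operator_topology (model_space \<theta>) (model_space \<alpha>)) euclidean
      (\<lambda>T. cinner (T (fst p)) (snd p) - cinner (T (bshift (fst p))) (bshift (snd p)))"
    if "p \<in> shift_tests \<theta> \<alpha>" for p
    using that assms bshift_model_space
    by (intro continuous_map_diff continuous_matrix_coefficient[OF sub]) (auto simp: shift_tests_def)
  then show ?thesis
    unfolding att_operators_eq_zero_set[OF assms] topspace_weak_operator[OF sub, symmetric]
    by (rule closedin_zero_sets)
qed

text \<open>
  Any set of operators of rank at most two whose annihilator is the space lies in its preannihilator,
  and annihilators reverse inclusions.
\<close>

lemma att_operators_2_reflexive:
  assumes "inner_function \<theta>" "inner_function \<alpha>" "nonconstant \<theta>" "nonconstant \<alpha>"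
  shows "k_reflexive 2 (model_space \<theta>) (model_space \<alpha>) (att_operators \<theta> \<alpha>)"
proof -
  let ?H = "model_space \<theta>" and ?K = "model_space \<alpha>"
  let ?S = "att_operators \<theta> \<alpha>" and ?R = "shift_test_op \<alpha> ` shift_tests \<theta> \<alpha>"
  note eq = att_operators_eq_annihilator[OF assms]
  have "?R \<subseteq> preannihilator ?H ?K ?S \<inter> rank_at_most 2 ?H ?K"
    using shift_test_op(1,2)[OF assms(1,2)] by (auto simp: preannihilator_def eq annihilator_def)
  then have "annihilator ?H ?K (preannihilator ?H ?K ?S \<inter> rank_at_most 2 ?H ?K) \<subseteq> annihilator ?H ?K ?R"
    by (auto simp: annihilator_def)
  moreover have "?S \<subseteq> annihilator ?H ?K (preannihilator ?H ?K ?S \<inter> rank_at_most 2 ?H ?K)"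
    by (auto simp: annihilator_def preannihilator_def att_operators_def)
  ultimately show ?thesis unfolding k_reflexive_def using eq by blast
qed

theorem theorem5p1:
  fixes \<theta> \<alpha> :: circle_L2
  assumes "inner_function \<theta>" and "nonconstant \<theta>"
    and "inner_function \<alpha>" and "nonconstant \<alpha>"
  shows "weak_star_closed_subspace (model_space \<theta>) (model_space \<alpha>) (att_operators \<theta> \<alpha>)
    \<and> closedin (weak_operator_topology (model_space \<theta>) (model_space \<alpha>)) (att_operators \<theta> \<alpha>)
    \<and> transitive_space (model_space \<theta>) (model_space \<alpha>) (att_operators \<theta> \<alpha>)
    \<and> k_reflexive 2 (model_space \<theta>) (model_space \<alpha>) (att_operators \<theta> \<alpha>)"
  unfolding weak_star_closed_subspace_def
  using assms
  by (intro conjI att_operators_subspace att_operators_weak_star_closed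
      att_operators_weak_operator_closed att_operators_transitive att_operators_2_reflexive)

end
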